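(* Let $M\subset\mathbb{C}^N$ be a real-analytic generic submanifold with $0\in M$, of finite type at $0$. Let $M'\subset\mathbb{C}^{N'}$ be a real-analytic generic submanifold through $0$ and let $\Sigma'_0$ be its Segre variety at $0$. Denote by $\pi\colon\mathcal{O}_{N'}(0)\to\mathcal{O}_{\Sigma'_0}(0)$ the canonical homomorphism. Let $\phi\colon\mathcal{O}_{\Sigma'_0}(0)\to\mathcal{O}_{N'}(0)$ be any ring homomorphism such that $\pi\circ\phi\colon\mathcal{O}_{\Sigma'_0}(0)\to\mathcal{O}_{\Sigma'_0}(0)$ is an isomorphism. Then, for any germ at $0$ of a holomorphic mapping $H\colon(\mathbb{C}^N,0)\to(\mathbb{C}^{N'},0)$ such that $H(M)\subset M'$, the induced homomorphism $\Phi_H$ is uniquely determined by $\Phi_H\circ\phi$; that is, if $H^1,H^2$ are two such germs and $\Phi_{H^1}\circ\phi=\Phi_{H^2}\circ\phi$, then $\Phi_{H^1}=\Phi_{H^2}$.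
   Context: A real-analytic generic submanifold $M\subset\mathbb{C}^N$ of (real) codimension $d$ through $0$ is given near $0$ by $\rho_1(Z,\bar Z)=\dots=\rho_d(Z,\bar Z)=0$, where $\rho(Z,\zeta)=(\rho_1,\ldots,\rho_d)(Z,\zeta)$ is a $\mathbb{C}^d$-valued holomorphic function near $0\in\mathbb{C}^N\times\mathbb{C}^N$ with $\rho(Z,\zeta)=\overline{\rho(\bar\zeta,\bar Z)}$ and $\partial_Z\rho_1\wedge\cdots\wedge\partial_Z\rho_d\neq0$ near $0$. $M$ is of finite type at $p\in M$ (in the sense of Kohn and Bloom–Graham) if the complex Lie algebra $\mathfrak g_M$ generated by all smooth $(1,0)$ and $(0,1)$ vector fields tangent to $M$ satisfies $\mathfrak g_M(p)=\mathbb{C}T_pM$, the complexified tangent space of $M$ at $p$. For a sufficiently small neighborhood $U$ of $0$ and $p$ close to $0$, the Segre variety of $M$ at $p$ is $\Sigma_p:=\{Z\in U:\rho(Z,\bar p)=0\}$, a complex submanifold of dimension $N-d$. $\Sigma'_p$ denotes the Segre variety of $M'$. The inclusion $H(M)\subset M'$ is understood in the sense of germs at $0$. For a complex manifold $X$ and $p\in X$, $\mathcal{O}_X(p)$ is the ring of germs at $p$ of holomorphic functions on $X$; $\mathcal{O}_N(p):=\mathcal{O}_{\mathbb{C}^N}(p)$. If $Y\subset X$ is a complex analytic subvariety through $p$, then $\mathcal{O}_Y(p)=\mathcal{O}_X(p)/I(Y)$, where $I(Y)$ is the ideal of germs vanishing on $Y$; the canonical homomorphism is the quotient (restriction) map.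 A germ of a holomorphic mapping $H\colon(X,p)\to(W,q)$ between complex manifolds induces the ring homomorphism $\Phi_H\colon\mathcal{O}_W(q)\to\mathcal{O}_X(p)$, $\Phi_H(f)=f\circ H$. *)

theory Defs
  imports "HOL-Analysis.Analysis" "HOL-Algebra.QuotRing"
begin

section \<open>Holomorphic functions of several variables\<close>

text \<open>
  A function is complex differentiable at \<open>x\<close> if it is Frechet differentiable there with a
  \<open>\<complex>\<close>-linear derivative. The scalar action is a parameter because the library has no class of
  complex vector spaces; it is used for \<open>\<complex>\<^sup>n\<close> and for \<open>\<complex>\<^sup>n \<times> \<complex>\<^sup>n\<close>.
  Holomorphic near \<open>x\<close> means complex differentiable at every point of a neighbourhood of \<open>x\<close>.
\<close>

definition complex_diff_at ::
  "(complex \<Rightarrow> 'a \<Rightarrow> 'a) \<Rightarrow> ('a::real_normed_vector \<Rightarrow> complex) \<Rightarrow> 'a \<Rightarrow> bool"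
  where "complex_diff_at sc f x \<longleftrightarrow>
    (\<exists>D. (f has_derivative D) (at x) \<and> (\<forall>c v. D (sc c v) = c * D v))"

definition hol_near :: "complex^'n \<Rightarrow> (complex^'n \<Rightarrow> complex) \<Rightarrow> bool"
  where "hol_near p f \<longleftrightarrow> (\<forall>\<^sub>F Z in nhds p. complex_diff_at (*s) f Z)"

definition hol_near2 ::
  "(complex^'n) \<times> (complex^'n) \<Rightarrow> ((complex^'n) \<times> (complex^'n) \<Rightarrow> complex) \<Rightarrow> bool"
  where "hol_near2 p f \<longleftrightarrow>
    (\<forall>\<^sub>F x in nhds p. complex_diff_at (\<lambda>c (Z, \<zeta>). (c *s Z, c *s \<zeta>)) f x)"

definition hol_map_near :: "complex^'n \<Rightarrow> (complex^'n \<Rightarrow> complex^'m) \<Rightarrow> bool"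
  where "hol_map_near p H \<longleftrightarrow> (\<forall>k. hol_near p (\<lambda>Z. H Z $ k))"


section \<open>Generic submanifolds and Segre varieties\<close>

definition vcnj :: "complex^'n \<Rightarrow> complex^'n"
  where "vcnj Z = (\<chi> k. cnj (Z $ k))"

text \<open>The exterior product \<open>\<theta>\<^sub>0 \<and> \<dots> \<and> \<theta>\<^sub>d\<^sub>-\<^sub>1\<close> of one-forms, as an alternating \<open>d\<close>-form.\<close>

definition wedge :: "nat \<Rightarrow> (nat \<Rightarrow> 'a \<Rightarrow> complex) \<Rightarrow> (nat \<Rightarrow> 'a) \<Rightarrow> complex"
  where "wedge d \<theta> v =
    (\<Sum>\<sigma> | \<sigma> permutes {..<d}. of_int (sign \<sigma>) * (\<Prod>j<d. \<theta> j (v (\<sigma> j))))"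

definition partial_Z ::
  "((complex^'n) \<times> (complex^'n) \<Rightarrow> complex) \<Rightarrow> (complex^'n) \<times> (complex^'n) \<Rightarrow> complex^'n \<Rightarrow> complex"
  where "partial_Z r x = frechet_derivative (\<lambda>Z. r (Z, snd x)) (at (fst x))"

text \<open>
  \<open>M\<close> is, near \<open>0 \<in> M\<close>, the real-analytic generic submanifold of real codimension \<open>d\<close> with
  complexified defining functions \<open>\<rho> 0, \<dots>, \<rho> (d - 1)\<close>. Only the germs at \<open>0\<close> of \<open>M\<close> and of
  the \<open>\<rho> j\<close> matter.
\<close>

definition generic_submanifold ::
  "nat \<Rightarrow> (nat \<Rightarrow> (complex^'n) \<times> (complex^'n) \<Rightarrow> complex) \<Rightarrow> (complex^'n) set \<Rightarrow> bool"
  where "generic_submanifold d \<rho> M \<longleftrightarrow>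
    0 \<in> M \<and>
    (\<forall>j<d. hol_near2 (0, 0) (\<rho> j)) \<and>
    (\<forall>j<d. \<forall>\<^sub>F (Z, \<zeta>) in nhds (0, 0). \<rho> j (Z, \<zeta>) = cnj (\<rho> j (vcnj \<zeta>, vcnj Z))) \<and>
    (\<forall>\<^sub>F x in nhds (0, 0). wedge d (\<lambda>j. partial_Z (\<rho> j) x) \<noteq> (\<lambda>v. 0)) \<and>
    (\<forall>\<^sub>F Z in nhds 0. Z \<in> M \<longleftrightarrow> (\<forall>j<d. \<rho> j (Z, vcnj Z) = 0))"

definition segre_variety ::
  "nat \<Rightarrow> (nat \<Rightarrow> (complex^'n) \<times> (complex^'n) \<Rightarrow> complex) \<Rightarrow> (complex^'n) set \<Rightarrow>
    complex^'n \<Rightarrow> (complex^'n) set"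
  where "segre_variety d \<rho> U p = {Z \<in> U. \<forall>j<d. \<rho> j (Z, vcnj p) = 0}"


section \<open>Finite type\<close>

text \<open>\<open>C\<^sup>k\<close> and \<open>C\<^sup>\<infinity>\<close> maps; meant for open \<open>U\<close>.\<close>

fun Ck_on :: "nat \<Rightarrow> ('a::euclidean_space \<Rightarrow> 'b::real_normed_vector) \<Rightarrow> 'a set \<Rightarrow> bool"
  where
    "Ck_on 0 f U \<longleftrightarrow> continuous_on U f"
  | "Ck_on (Suc k) f U \<longleftrightarrow>
      (\<forall>x\<in>U. f differentiable at x) \<and> (\<forall>v. Ck_on k (\<lambda>x. frechet_derivative f (at x) v) U)"

definition smooth_on :: "('a::euclidean_space \<Rightarrow> 'b::real_normed_vector) \<Rightarrow> 'a set \<Rightarrow> bool"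
  where "smooth_on f U \<longleftrightarrow> (\<forall>k. Ck_on k f U)"

text \<open>
  The pair \<open>(u, v)\<close> stands for the complexified tangent vector \<open>u + \<i> v \<in> \<complex> \<otimes> T\<^sub>p\<complex>\<^sup>n\<close>, where the
  real tangent space \<open>T\<^sub>p\<complex>\<^sup>n\<close> is identified with \<open>\<complex>\<^sup>n\<close>. The formal \<open>\<i>\<close> acting through \<open>cscale\<close> is
  different from the complex structure \<open>cJ\<close> of \<open>\<complex>\<^sup>n\<close>, extended complex linearly. Vectors of type
  \<open>(1,0)\<close> and \<open>(0,1)\<close> are the eigenvectors of \<open>cJ\<close> for the eigenvalues \<open>\<i>\<close> and \<open>-\<i>\<close>.
\<close>

type_synonym 'n ctangent = "(complex^'n) \<times> (complex^'n)"
type_synonym 'n cfield = "complex^'n \<Rightarrow> 'n ctangent"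

definition cscale :: "complex \<Rightarrow> 'n::finite ctangent \<Rightarrow> 'n ctangent"
  where "cscale c X =
    (Re c *\<^sub>R fst X - Im c *\<^sub>R snd X, Re c *\<^sub>R snd X + Im c *\<^sub>R fst X)"

definition cJ :: "'n::finite ctangent \<Rightarrow> 'n ctangent"
  where "cJ X = (\<i> *s fst X, \<i> *s snd X)"

definition type10 :: "'n::finite ctangent \<Rightarrow> bool"
  where "type10 X \<longleftrightarrow> cJ X = cscale \<i> X"

definition type01 :: "'n::finite ctangent \<Rightarrow> bool"
  where "type01 X \<longleftrightarrow> cJ X = cscale (- \<i>) X"

text \<open>
  The real tangent space at \<open>p \<in> M\<close> is the kernel of the differentials of the (real-valued)
  defining functions \<open>Z \<mapsto> \<rho> j (Z, vcnj Z)\<close> of \<open>M\<close>.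
\<close>

definition tangent_space ::
  "nat \<Rightarrow> (nat \<Rightarrow> (complex^'n) \<times> (complex^'n) \<Rightarrow> complex) \<Rightarrow> complex^'n \<Rightarrow> (complex^'n) set"
  where "tangent_space d \<rho> p =
    {u. \<forall>j<d. frechet_derivative (\<lambda>Z. \<rho> j (Z, vcnj Z)) (at p) u = 0}"

definition ctangent_space ::
  "nat \<Rightarrow> (nat \<Rightarrow> (complex^'n) \<times> (complex^'n) \<Rightarrow> complex) \<Rightarrow> complex^'n \<Rightarrow> 'n::finite ctangent set"
  where "ctangent_space d \<rho> p = tangent_space d \<rho> p \<times> tangent_space d \<rho> p"

text \<open>Lie bracket of real vector fields, and its complex bilinear extension.\<close>

definition real_bracket ::
  "(complex^'n \<Rightarrow> complex^'n) \<Rightarrow> (complex^'n \<Rightarrow> complex^'n) \<Rightarrow> complex^'n \<Rightarrow> complex^'n"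
  where "real_bracket u v p =
    frechet_derivative v (at p) (u p) - frechet_derivative u (at p) (v p)"

definition lie_bracket :: "'n::finite cfield \<Rightarrow> 'n cfield \<Rightarrow> 'n cfield"
  where "lie_bracket X Y p =
    (real_bracket (fst \<circ> X) (fst \<circ> Y) p - real_bracket (snd \<circ> X) (snd \<circ> Y) p,
     real_bracket (fst \<circ> X) (snd \<circ> Y) p + real_bracket (snd \<circ> X) (fst \<circ> Y) p)"

text \<open>
  Smooth vector fields on \<open>M\<close> near \<open>p\<close> are represented by smooth extensions to a neighbourhood of
  \<open>p\<close> in \<open>\<complex>\<^sup>n\<close>. Tangency and type are required along \<open>M\<close> only; for fields tangent to \<open>M\<close>, the
  restriction of the bracket to \<open>M\<close> does not depend on the extensions.
\<close>

definition cr_fields ::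
  "nat \<Rightarrow> (nat \<Rightarrow> (complex^'n) \<times> (complex^'n) \<Rightarrow> complex) \<Rightarrow> (complex^'n) set \<Rightarrow> complex^'n \<Rightarrow>
    'n::finite cfield set"
  where "cr_fields d \<rho> M p = {X. \<exists>U. open U \<and> p \<in> U \<and> smooth_on X U \<and>
    (\<forall>q\<in>M \<inter> U. X q \<in> ctangent_space d \<rho> q) \<and>
    ((\<forall>q\<in>M \<inter> U. type10 (X q)) \<or> (\<forall>q\<in>M \<inter> U. type01 (X q)))}"

inductive_set lie_generated :: "'n::finite cfield set \<Rightarrow> 'n cfield set"
  for G :: "'n cfield set"
  where
    gen: "X \<in> G \<Longrightarrow> X \<in> lie_generated G"
  | add: "X \<in> lie_generated G \<Longrightarrow> Y \<in> lie_generated G \<Longrightarrow> (\<lambda>q. X q + Y q) \<in> lie_generated G"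
  | scale: "X \<in> lie_generated G \<Longrightarrow> (\<lambda>q. cscale c (X q)) \<in> lie_generated G"
  | bracket: "X \<in> lie_generated G \<Longrightarrow> Y \<in> lie_generated G \<Longrightarrow> lie_bracket X Y \<in> lie_generated G"

definition finite_type ::
  "nat \<Rightarrow> (nat \<Rightarrow> (complex^'n) \<times> (complex^'n) \<Rightarrow> complex) \<Rightarrow> (complex^'n) set \<Rightarrow> complex^'n \<Rightarrow> bool"
  where "finite_type d \<rho> M p \<longleftrightarrow>
    (\<lambda>X. X p) ` lie_generated (cr_fields d \<rho> M p) = ctangent_space d \<rho> p"


section \<open>Rings of germs\<close>

definition germ :: "complex^'n \<Rightarrow> (complex^'n \<Rightarrow> complex) \<Rightarrow> (complex^'n \<Rightarrow> complex) set"
  where "germ p f = {g. \<forall>\<^sub>F Z in nhds p. g Z = f Z}"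

text \<open>\<open>\<O>\<^sub>N(p)\<close>; the unions below are over all representatives and do not depend on them.\<close>

definition hol_germs :: "complex^'n \<Rightarrow> (complex^'n \<Rightarrow> complex) set ring"
  where "hol_germs p =
    \<lparr>carrier = germ p ` {f. hol_near p f},
     mult = (\<lambda>F G. \<Union>f\<in>F. \<Union>g\<in>G. germ p (\<lambda>Z. f Z * g Z)),
     one = germ p (\<lambda>Z. 1),
     zero = germ p (\<lambda>Z. 0),
     add = (\<lambda>F G. \<Union>f\<in>F. \<Union>g\<in>G. germ p (\<lambda>Z. f Z + g Z))\<rparr>"

definition vanishing_ideal ::
  "complex^'n \<Rightarrow> (complex^'n) set \<Rightarrow> (complex^'n \<Rightarrow> complex) set set"
  where "vanishing_ideal p Y =
    {F \<in> carrier (hol_germs p). \<forall>f\<in>F. \<forall>\<^sub>F Z in nhds p. Z \<in> Y \<longrightarrow> f Z = 0}"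

text \<open>\<open>\<O>\<^sub>Y(p)\<close> for a subvariety \<open>Y\<close> of \<open>\<complex>\<^sup>n\<close>, and the canonical homomorphism onto it.\<close>

definition hol_germs_on ::
  "complex^'n \<Rightarrow> (complex^'n) set \<Rightarrow> (complex^'n \<Rightarrow> complex) set set ring"
  where "hol_germs_on p Y = hol_germs p Quot vanishing_ideal p Y"

definition canonical_hom ::
  "complex^'n \<Rightarrow> (complex^'n) set \<Rightarrow> (complex^'n \<Rightarrow> complex) set \<Rightarrow> (complex^'n \<Rightarrow> complex) set set"
  where "canonical_hom p Y F = vanishing_ideal p Y +>\<^bsub>hol_germs p\<^esub> F"

text \<open>\<open>\<Phi>\<^sub>H(f) = f \<circ> H\<close> on germs, for \<open>H\<close> holomorphic near \<open>p\<close>.\<close>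

definition induced_hom ::
  "complex^'n \<Rightarrow> (complex^'n \<Rightarrow> complex^'m) \<Rightarrow> (complex^'m \<Rightarrow> complex) set \<Rightarrow>
    (complex^'n \<Rightarrow> complex) set"
  where "induced_hom p H F = (\<Union>f\<in>F. germ p (f \<circ> H))"


subsection \<open>Well-definedness\<close>

lemma germ_eq_iff: "germ p f = germ p g \<longleftrightarrow> (\<forall>\<^sub>F Z in nhds p. f Z = g Z)"
proof
  assume "germ p f = germ p g"
  moreover have "f \<in> germ p f" by (simp add: germ_def)
  ultimately show "\<forall>\<^sub>F Z in nhds p. f Z = g Z" by (simp add: germ_def)
next
  assume *: "\<forall>\<^sub>F Z in nhds p. f Z = g Z"
  show "germ p f = germ p g"
    unfolding germ_def using * by (auto elim: eventually_elim2)
qed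

lemma germ_self: "f \<in> germ p f"
  by (simp add: germ_def)

lemma germ_binop:
  "(\<Union>f\<in>germ p a. \<Union>g\<in>germ p b. germ p (\<lambda>Z. h (f Z) (g Z))) = germ p (\<lambda>Z. h (a Z) (b Z))"
proof -
  have "germ p (\<lambda>Z. h (f Z) (g Z)) = germ p (\<lambda>Z. h (a Z) (b Z))"
    if "f \<in> germ p a" "g \<in> germ p b" for f g
  proof -
    have "\<forall>\<^sub>F Z in nhds p. f Z = a Z" "\<forall>\<^sub>F Z in nhds p. g Z = b Z"
      using that by (simp_all add: germ_def)
    then show ?thesis unfolding germ_eq_iff by eventually_elim simp
  qed
  then show ?thesis using germ_self[of a p] germ_self[of b p] by blast
qed

lemma hol_germs_mult [simp]:
  "germ p a \<otimes>\<^bsub>hol_germs p\<^esub> germ p b = germ p (\<lambda>Z. a Z * b Z)"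
  by (simp add: hol_germs_def germ_binop)

lemma hol_germs_add [simp]:
  "germ p a \<oplus>\<^bsub>hol_germs p\<^esub> germ p b = germ p (\<lambda>Z. a Z + b Z)"
  by (simp add: hol_germs_def germ_binop)

lemma hol_germs_carrier: "carrier (hol_germs p) = germ p ` {f. hol_near p f}"
  and hol_germs_one: "\<one>\<^bsub>hol_germs p\<^esub> = germ p (\<lambda>Z. 1)"
  and hol_germs_zero: "\<zero>\<^bsub>hol_germs p\<^esub> = germ p (\<lambda>Z. 0)"
  by (simp_all add: hol_germs_def)

lemma hol_near_const: "hol_near p (\<lambda>Z. c)"
  unfolding hol_near_def complex_diff_at_def
  by (intro always_eventually allI exI[of _ "\<lambda>_. 0"]) auto

lemma hol_near_add:
  assumes "hol_near p f" "hol_near p g"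
  shows "hol_near p (\<lambda>Z. f Z + g Z)"
  using assms unfolding hol_near_def
proof (rule eventually_elim2)
  fix Z assume "complex_diff_at (*s) f Z" "complex_diff_at (*s) g Z"
  then obtain D E where "(f has_derivative D) (at Z)" "\<forall>c v. D (c *s v) = c * D v"
    "(g has_derivative E) (at Z)" "\<forall>c v. E (c *s v) = c * E v"
    unfolding complex_diff_at_def by blast
  then show "complex_diff_at (*s) (\<lambda>Z. f Z + g Z) Z"
    unfolding complex_diff_at_def
    by (intro exI[of _ "\<lambda>v. D v + E v"]) (auto intro!: derivative_intros simp: algebra_simps)
qed

lemma hol_near_mult:
  assumes "hol_near p f" "hol_near p g"
  shows "hol_near p (\<lambda>Z. f Z * g Z)"
  using assms unfolding hol_near_def
proof (rule eventually_elim2)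
  fix Z assume "complex_diff_at (*s) f Z" "complex_diff_at (*s) g Z"
  then obtain D E where "(f has_derivative D) (at Z)" "\<forall>c v. D (c *s v) = c * D v"
    "(g has_derivative E) (at Z)" "\<forall>c v. E (c *s v) = c * E v"
    unfolding complex_diff_at_def by blast
  then show "complex_diff_at (*s) (\<lambda>Z. f Z * g Z) Z"
    unfolding complex_diff_at_def
    by (intro exI[of _ "\<lambda>v. f Z * E v + D v * g Z"]) (auto intro!: derivative_eq_intros simp: algebra_simps)
qed

lemma germ_in_carrier: "hol_near p f \<Longrightarrow> germ p f \<in> carrier (hol_germs p)"
  unfolding hol_germs_carrier by (rule imageI) simp

lemma cring_hol_germs: "cring (hol_germs p)"
proof -
  have rep: "\<exists>f. hol_near p f \<and> F = germ p f" if "F \<in> carrier (hol_germs p)" for F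
    using that unfolding hol_germs_carrier by blast
  have add: "abelian_group (hol_germs p)"
  proof (rule abelian_groupI)
    fix F assume "F \<in> carrier (hol_germs p)"
    then obtain f where f: "hol_near p f" "F = germ p f" using rep by blast
    have "hol_near p (\<lambda>Z. (-1) * f Z)" by (rule hol_near_mult[OF hol_near_const f(1)])
    then have "germ p (\<lambda>Z. (-1) * f Z) \<in> carrier (hol_germs p)" by (rule germ_in_carrier)
    moreover have "germ p (\<lambda>Z. (-1) * f Z) \<oplus>\<^bsub>hol_germs p\<^esub> F = \<zero>\<^bsub>hol_germs p\<^esub>"
      unfolding f(2) hol_germs_add hol_germs_zero by simp
    ultimately show "\<exists>G\<in>carrier (hol_germs p). G \<oplus>\<^bsub>hol_germs p\<^esub> F = \<zero>\<^bsub>hol_germs p\<^esub>"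
      by blast
  qed (use hol_near_add hol_near_const in
      \<open>auto dest!: rep simp: hol_germs_zero add.assoc add.commute add.left_commute intro!: germ_in_carrier\<close>)
  have mult: "Group.comm_monoid (hol_germs p)"
    by (rule comm_monoidI)
      (use hol_near_mult hol_near_const in
        \<open>auto dest!: rep simp: hol_germs_one mult.assoc mult.commute mult.left_commute intro!: germ_in_carrier\<close>)
  show ?thesis
    by (rule cringI[OF add mult]) (auto dest!: rep simp: distrib_right)
qed

lemma germ_in_vanishing_ideal:
  "germ p f \<in> vanishing_ideal p Y \<longleftrightarrow>
    germ p f \<in> carrier (hol_germs p) \<and> (\<forall>\<^sub>F Z in nhds p. Z \<in> Y \<longrightarrow> f Z = 0)"
proof -
  have "\<forall>\<^sub>F Z in nhds p. Z \<in> Y \<longrightarrow> g Z = 0"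
    if "\<forall>\<^sub>F Z in nhds p. Z \<in> Y \<longrightarrow> f Z = 0" "g \<in> germ p f" for g
    using that unfolding germ_def mem_Collect_eq by (rule eventually_elim2) simp
  then show ?thesis unfolding vanishing_ideal_def using germ_self by blast
qed

lemma ideal_vanishing_ideal: "ideal (vanishing_ideal p Y) (hol_germs p)"
proof -
  interpret R: cring "hol_germs p" by (rule cring_hol_germs)
  have carr: "\<exists>f. hol_near p f \<and> F = germ p f \<and> (\<forall>\<^sub>F Z in nhds p. Z \<in> Y \<longrightarrow> f Z = 0)"
    if "F \<in> vanishing_ideal p Y" for F
  proof -
    from that obtain f where "hol_near p f" "F = germ p f"
      by (auto simp: vanishing_ideal_def hol_germs_carrier)
    with that show ?thesis by (auto simp: germ_in_vanishing_ideal)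
  qed
  have mult: "G \<otimes>\<^bsub>hol_germs p\<^esub> F \<in> vanishing_ideal p Y"
    if FG: "F \<in> vanishing_ideal p Y" "G \<in> carrier (hol_germs p)" for F G
  proof -
    obtain f where f: "hol_near p f" "F = germ p f" "\<forall>\<^sub>F Z in nhds p. Z \<in> Y \<longrightarrow> f Z = 0"
      using carr[OF FG(1)] by blast
    obtain g where g: "hol_near p g" "G = germ p g" using FG(2) by (auto simp: hol_germs_carrier)
    have "\<forall>\<^sub>F Z in nhds p. Z \<in> Y \<longrightarrow> g Z * f Z = 0" using f(3) by eventually_elim simp
    then show ?thesis using f g hol_near_mult
      by (auto simp: germ_in_vanishing_ideal hol_germs_carrier)
  qed
  have add: "F \<oplus>\<^bsub>hol_germs p\<^esub> G \<in> vanishing_ideal p Y"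
    if FG: "F \<in> vanishing_ideal p Y" "G \<in> vanishing_ideal p Y" for F G
  proof -
    obtain f where f: "hol_near p f" "F = germ p f" "\<forall>\<^sub>F Z in nhds p. Z \<in> Y \<longrightarrow> f Z = 0"
      using carr[OF FG(1)] by blast
    obtain g where g: "hol_near p g" "G = germ p g" "\<forall>\<^sub>F Z in nhds p. Z \<in> Y \<longrightarrow> g Z = 0"
      using carr[OF FG(2)] by blast
    have "\<forall>\<^sub>F Z in nhds p. Z \<in> Y \<longrightarrow> f Z + g Z = 0" using f(3) g(3) by eventually_elim simp
    then show ?thesis using f g hol_near_add
      by (auto simp: germ_in_vanishing_ideal hol_germs_carrier)
  qed
  have sub: "vanishing_ideal p Y \<subseteq> carrier (hol_germs p)" by (auto simp: vanishing_ideal_def)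
  have zero: "\<zero>\<^bsub>hol_germs p\<^esub> \<in> vanishing_ideal p Y"
    using R.zero_closed by (simp add: hol_germs_zero germ_in_vanishing_ideal)
  have neg: "\<ominus>\<^bsub>hol_germs p\<^esub> F \<in> vanishing_ideal p Y" if "F \<in> vanishing_ideal p Y" for F
  proof -
    have "\<ominus>\<^bsub>hol_germs p\<^esub> F = (\<ominus>\<^bsub>hol_germs p\<^esub> \<one>\<^bsub>hol_germs p\<^esub>) \<otimes>\<^bsub>hol_germs p\<^esub> F"
      using that sub by (simp add: R.l_minus subsetD)
    then show ?thesis using mult[OF that] by simp
  qed
  show ?thesis
  proof (rule idealI)
    show "subgroup (vanishing_ideal p Y) (add_monoid (hol_germs p))"
      using sub zero neg add
      by (intro R.add.subgroupI) (auto simp: a_inv_def)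
  next
    fix a x assume a: "a \<in> vanishing_ideal p Y" "x \<in> carrier (hol_germs p)"
    show *: "x \<otimes>\<^bsub>hol_germs p\<^esub> a \<in> vanishing_ideal p Y" by (rule mult[OF a])
    have "a \<otimes>\<^bsub>hol_germs p\<^esub> x = x \<otimes>\<^bsub>hol_germs p\<^esub> a"
      using a sub by (intro R.m_comm) auto
    with * show "a \<otimes>\<^bsub>hol_germs p\<^esub> x \<in> vanishing_ideal p Y" by simp
  qed (rule R.ring_axioms)
qed

lemma induced_hom_germ:
  assumes "isCont H p"
  shows "induced_hom p H (germ (H p) f) = germ p (f \<circ> H)"
proof -
  have "germ p (g \<circ> H) = germ p (f \<circ> H)" if "g \<in> germ (H p) f" for g
  proof -
    have "filterlim H (nhds (H p)) (nhds p)"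
      using assms by (simp add: isCont_def tendsto_at_iff_tendsto_nhds)
    moreover have "\<forall>\<^sub>F W in nhds (H p). g W = f W"
      using that by (simp add: germ_def)
    ultimately have "\<forall>\<^sub>F Z in nhds p. g (H Z) = f (H Z)"
      unfolding filterlim_iff by blast
    then show ?thesis by (simp add: germ_eq_iff)
  qed
  then show ?thesis unfolding induced_hom_def using germ_self by blast
qed

end

theory Submission
  imports Defs "HOL-Complex_Analysis.Cauchy_Integral_Formula"
begin

text \<open>
  Write \<open>D = H1 - H2\<close>; the claim is that \<open>D\<close> vanishes near \<open>0\<close>.

  \<^emph>\<open>What the hypothesis on \<open>\<phi>\<close> gives.\<close> Since \<open>\<pi> \<circ> \<phi>\<close> is onto, every coordinate function of
  \<open>\<Sigma>'\<^sub>0\<close> is the restriction of some \<open>F i\<close> whose germ lies in the image of \<open>\<phi>\<close>, so that \<open>F\<close> is the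
  identity on \<open>\<Sigma>'\<^sub>0\<close> and \<open>F \<circ> H1 = F \<circ> H2\<close> (\<open>germ_lift_through_section\<close>). The tangent space of
  \<open>\<Sigma>'\<^sub>0\<close> at \<open>0\<close> is the common kernel of the \<open>\<partial>\<^sub>Z\<rho>'\<^sub>j(0,0)\<close>, and there \<open>dF(0)\<close> is the identity.
  Subtracting suitable constant multiples of the \<open>\<rho>'\<^sub>j\<close> from \<open>F\<close> therefore produces a holomorphic
  \<open>Q(Z,\<zeta>)\<close> with \<open>\<partial>\<^sub>ZQ(0,0) = id\<close> (\<open>segre_adapted_coordinates\<close>). As \<open>\<rho>'\<close> vanishes on \<open>M'\<close>, the
  functions \<open>Q(H1, cnj H1)\<close> and \<open>Q(H2, cnj H2)\<close> agree on \<open>M\<close>.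

  \<^emph>\<open>Propagation along CR fields.\<close> A \<open>(1,0)\<close> field \<open>X\<close> annihilates \<open>cnj H1\<close> and \<open>cnj H2\<close> along \<open>M\<close>.
  Applying it to the equation above gives
  \<open>\<partial>\<^sub>ZQ(H1, cnj H1) \<cdot> X D = (\<partial>\<^sub>ZQ(H2, cnj H2) - \<partial>\<^sub>ZQ(H1, cnj H1)) \<cdot> X H2\<close> on \<open>M\<close>,
  where the right side is a difference of the values of one smooth function at \<open>(H1, cnj H1)\<close> and
  \<open>(H2, cnj H2)\<close>. It follows that if all derivatives of \<open>D\<close> along words of at most \<open>k\<close> CR fields
  vanish at \<open>0\<close>, then so do those along words of length \<open>k + 1\<close>: the \<open>(0,1)\<close> fields kill \<open>D\<close>
  anyway, and the invertible matrix on the left can be divided out. By induction \<open>D\<close> vanishes to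
  infinite order at \<open>0\<close> along the CR fields. This is an infinitesimal form of the propagation of
  \<open>H1 = H2\<close> from one Segre variety to the next.

  \<^emph>\<open>Finite type.\<close> The functions vanishing to infinite order in this sense are preserved by each CR
  field, hence by commutators and by the whole Lie algebra (\<open>lie_generated_vanish_infinite\<close>). A
  complex vector field acts on holomorphic functions through its \<open>(1,0)\<close> part only. By finite type
  the values at \<open>0\<close> of the Lie algebra fill the complexified tangent space of \<open>M\<close>, and as \<open>M\<close> is
  generic their \<open>(1,0)\<close> parts fill \<open>\<complex>\<^sup>N\<close>. So the complex partial derivatives of \<open>D\<close> vanish to infinite
  order as well (\<open>vanish_infinite_deriv\<close>); thus all derivatives of \<open>D\<close> at \<open>0\<close> vanish, and \<open>D = 0\<close> by
  the identity theorem on complex lines (\<open>vanish_infinite_imp_zero\<close>).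

  Two analytic facts carry this: holomorphic functions of several variables are smooth, which is
  deduced from Cauchy's formula on complex lines, and a field tangent to \<open>M\<close> maps functions that
  vanish on \<open>M\<close> to functions that vanish on \<open>M\<close>, which is an application of the inverse function
  theorem (\<open>level_set_tangent\<close>).
\<close>

section \<open>Smooth maps and their germs\<close>

lemma frechet_derivative_eq:
  "(f has_derivative D) (at x) \<Longrightarrow> frechet_derivative f (at x) = D"
  using frechet_derivative_at by metis

lemma has_derivative_frechet:
  "f differentiable at x \<Longrightarrow> (f has_derivative frechet_derivative f (at x)) (at x)"
  using frechet_derivative_works by blast

lemma has_derivative_cong_nhds:
  assumes "\<forall>\<^sub>F y in nhds x. f y = g y"
  shows "(f has_derivative D) (at x) \<longleftrightarrow> (g has_derivative D) (at x)"
proof -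
  have "eventually (\<lambda>y. f y = g y) (at x)" "f x = g x"
    using assms by (auto simp: eventually_nhds_conv_at)
  then show ?thesis
    by (auto intro: has_derivative_transform_eventually simp: eq_commute eventually_mono)
qed

lemma differentiable_cong_nhds:
  assumes "\<forall>\<^sub>F y in nhds x. f y = g y"
  shows "f differentiable at x \<longleftrightarrow> g differentiable at x"
  using has_derivative_cong_nhds[OF assms] by (auto simp: differentiable_def)

lemma frechet_derivative_cong_nhds:
  assumes "\<forall>\<^sub>F y in nhds x. f y = g y"
  shows "frechet_derivative f (at x) = frechet_derivative g (at x)"
  unfolding frechet_derivative_def using has_derivative_cong_nhds[OF assms] by simp

lemma Ck_on_cong:
  assumes "open U" "\<And>x. x \<in> U \<Longrightarrow> f x = g x"
  shows "Ck_on k f U \<longleftrightarrow> Ck_on k g U"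
  using assms(2)
proof (induction k arbitrary: f g)
  case 0
  then show ?case by (auto cong: continuous_on_cong)
next
  case (Suc k)
  have ev: "\<forall>\<^sub>F y in nhds x. f y = g y" if "x \<in> U" for x
    using eventually_nhds_in_open[OF assms(1) that] by eventually_elim (rule Suc.prems)
  have 1: "(\<forall>x\<in>U. f differentiable at x) \<longleftrightarrow> (\<forall>x\<in>U. g differentiable at x)"
    using differentiable_cong_nhds[OF ev] by blast
  have 2: "Ck_on k (\<lambda>x. frechet_derivative f (at x) v) U \<longleftrightarrow>
      Ck_on k (\<lambda>x. frechet_derivative g (at x) v) U" for v
    by (rule Suc.IH) (use frechet_derivative_cong_nhds[OF ev] in simp)
  show ?case by (simp add: 1 2)
qed

lemma Ck_on_pred: "Ck_on (Suc k) f U \<Longrightarrow> Ck_on k f U"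
proof (induction k arbitrary: f)
  case 0
  then show ?case
    by (auto intro!: continuous_at_imp_continuous_on differentiable_imp_continuous_within)
next
  case (Suc k)
  have "Ck_on k (\<lambda>x. frechet_derivative f (at x) v) U" for v
    using Suc.prems by (intro Suc.IH) simp
  then show ?case using Suc.prems by simp
qed

lemma Ck_on_subset: "Ck_on k f U \<Longrightarrow> V \<subseteq> U \<Longrightarrow> Ck_on k f V"
  by (induction k arbitrary: f) (auto intro: continuous_on_subset)

lemma Ck_on_const: "Ck_on k (\<lambda>x. c) U"
  by (induction k arbitrary: c) (auto simp: frechet_derivative_const)

lemma Ck_on_bounded_linear: "bounded_linear L \<Longrightarrow> Ck_on k L U"
proof (cases k)
  case 0
  assume "bounded_linear L"
  then show ?thesis using 0 by (simp add: linear_continuous_on)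
next
  case (Suc j)
  assume L: "bounded_linear L"
  have "frechet_derivative L (at x) = L" for x
    by (rule frechet_derivative_eq) (rule bounded_linear_imp_has_derivative[OF L])
  then show ?thesis using L Suc by (simp add: Ck_on_const bounded_linear_imp_differentiable)
qed

lemma Ck_on_add:
  assumes "open U" "Ck_on k f U" "Ck_on k g U"
  shows "Ck_on k (\<lambda>x. f x + g x) U"
  using assms(2,3)
proof (induction k arbitrary: f g)
  case 0
  then show ?case by (auto intro: continuous_on_add)
next
  case (Suc k)
  have "Ck_on k (\<lambda>x. frechet_derivative (\<lambda>x. f x + g x) (at x) v) U \<longleftrightarrow>
    Ck_on k (\<lambda>x. frechet_derivative f (at x) v + frechet_derivative g (at x) v) U" for v
  proof (rule Ck_on_cong[OF assms(1)])
    fix x assume "x \<in> U"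
    then have "((\<lambda>x. f x + g x) has_derivative
        (\<lambda>v. frechet_derivative f (at x) v + frechet_derivative g (at x) v)) (at x)"
      using Suc.prems by (intro has_derivative_add has_derivative_frechet) auto
    then show "frechet_derivative (\<lambda>x. f x + g x) (at x) v =
        frechet_derivative f (at x) v + frechet_derivative g (at x) v"
      using frechet_derivative_eq by metis
  qed
  moreover have "Ck_on k (\<lambda>x. frechet_derivative f (at x) v + frechet_derivative g (at x) v) U" for v
    by (rule Suc.IH) (use Suc.prems in auto)
  ultimately show ?case using Suc.prems by (auto intro: differentiable_add)
qed

lemma Ck_on_sum:
  assumes "open U" "\<And>i. i \<in> I \<Longrightarrow> Ck_on k (f i) U"
  shows "Ck_on k (\<lambda>x. \<Sum>i\<in>I. f i x) U"
  using assms(2)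
  by (induction I rule: infinite_finite_induct) (auto intro!: Ck_on_const Ck_on_add assms(1))

lemma Ck_on_bilinear:
  assumes "bounded_bilinear B" "open U" "Ck_on k f U" "Ck_on k g U"
  shows "Ck_on k (\<lambda>x. B (f x) (g x)) U"
  using assms(3,4)
proof (induction k arbitrary: f g)
  case 0
  then show ?case using bounded_bilinear.continuous_on[OF assms(1)] by auto
next
  case (Suc k)
  have D: "((\<lambda>x. B (f x) (g x)) has_derivative
      (\<lambda>v. B (f x) (frechet_derivative g (at x) v) + B (frechet_derivative f (at x) v) (g x))) (at x)"
    if "x \<in> U" for x
    using Suc.prems that
    by (intro bounded_bilinear.FDERIV[OF assms(1)] has_derivative_frechet) auto
  have fg: "Ck_on k f U" "Ck_on k g U" using Suc.prems by (auto intro: Ck_on_pred)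
  have "Ck_on k (\<lambda>x. frechet_derivative (\<lambda>x. B (f x) (g x)) (at x) v) U \<longleftrightarrow>
    Ck_on k (\<lambda>x. B (f x) (frechet_derivative g (at x) v) + B (frechet_derivative f (at x) v) (g x)) U"
    for v
    by (rule Ck_on_cong[OF assms(2)]) (use frechet_derivative_eq[OF D] in simp)
  moreover have "Ck_on k (\<lambda>x. B (f x) (frechet_derivative g (at x) v) +
      B (frechet_derivative f (at x) v) (g x)) U" for v
    using Suc.prems fg by (intro Ck_on_add assms(2) Suc.IH) auto
  ultimately show ?case using D by (auto simp: differentiable_def)
qed

lemma Ck_on_compose_linear:
  assumes "bounded_linear L" "open U" "Ck_on k f U"
  shows "Ck_on k (\<lambda>x. L (f x)) U"
  using assms(3)
proof (induction k arbitrary: f)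
  case 0
  then show ?case using bounded_linear.continuous_on[OF assms(1)] by auto
next
  case (Suc k)
  have D: "((\<lambda>x. L (f x)) has_derivative (\<lambda>v. L (frechet_derivative f (at x) v))) (at x)"
    if "x \<in> U" for x
    using Suc.prems that
    by (intro bounded_linear.has_derivative[OF assms(1)] has_derivative_frechet) auto
  have "Ck_on k (\<lambda>x. frechet_derivative (\<lambda>x. L (f x)) (at x) v) U \<longleftrightarrow>
    Ck_on k (\<lambda>x. L (frechet_derivative f (at x) v)) U" for v
    by (rule Ck_on_cong[OF assms(2)]) (use frechet_derivative_eq[OF D] in simp)
  moreover have "Ck_on k (\<lambda>x. L (frechet_derivative f (at x) v)) U" for v
    using Suc.prems by (intro Suc.IH) auto
  ultimately show ?case using D by (auto simp: differentiable_def)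
qed

lemma linear_eq_sum_Basis:
  fixes L :: "'a::euclidean_space \<Rightarrow> 'b::real_vector"
  assumes "linear L"
  shows "L v = (\<Sum>b\<in>Basis. (v \<bullet> b) *\<^sub>R L b)"
proof -
  have "L v = L (\<Sum>b\<in>Basis. (v \<bullet> b) *\<^sub>R b)" by (simp add: euclidean_representation)
  also have "\<dots> = (\<Sum>b\<in>Basis. (v \<bullet> b) *\<^sub>R L b)"
    by (simp add: linear_sum[OF assms] linear_scale[OF assms])
  finally show ?thesis .
qed

lemma frechet_derivative_chain:
  assumes "h differentiable at x" "f differentiable at (h x)"
  shows "frechet_derivative (\<lambda>x. f (h x)) (at x) v =
    frechet_derivative f (at (h x)) (frechet_derivative h (at x) v)"
proof -
  have "((\<lambda>x. f (h x)) has_derivative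
      (\<lambda>v. frechet_derivative f (at (h x)) (frechet_derivative h (at x) v))) (at x)"
    by (rule has_derivative_compose) (use assms has_derivative_frechet in auto)
  then show ?thesis using frechet_derivative_eq by metis
qed

lemma Ck_on_compose:
  fixes h :: "'a::euclidean_space \<Rightarrow> 'b::euclidean_space" and f :: "'b \<Rightarrow> 'c::real_normed_vector"
  assumes "open U" "open V" "\<And>x. x \<in> U \<Longrightarrow> h x \<in> V" "Ck_on k h U" "Ck_on k f V"
  shows "Ck_on k (\<lambda>x. f (h x)) U"
  using assms(4,5)
proof (induction k arbitrary: f)
  case 0
  then show ?case using assms(3) by (auto intro: continuous_on_compose2)
next
  case (Suc k)
  have diff: "h differentiable at x" "f differentiable at (h x)" if "x \<in> U" for x
    using Suc.prems that assms(3) by auto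
  have h: "Ck_on k h U" by (rule Ck_on_pred) (rule Suc.prems)
  have "Ck_on k (\<lambda>x. frechet_derivative (\<lambda>x. f (h x)) (at x) v) U \<longleftrightarrow>
    Ck_on k (\<lambda>x. \<Sum>b\<in>Basis. (frechet_derivative h (at x) v \<bullet> b) *\<^sub>R
        frechet_derivative f (at (h x)) b) U" for v
    by (rule Ck_on_cong[OF assms(1)])
      (simp add: frechet_derivative_chain diff linear_eq_sum_Basis[OF linear_frechet_derivative, symmetric])
  moreover have "Ck_on k (\<lambda>x. \<Sum>b\<in>Basis. (frechet_derivative h (at x) v \<bullet> b) *\<^sub>R
        frechet_derivative f (at (h x)) b) U" for v
  proof (intro Ck_on_sum assms(1) Ck_on_bilinear[OF bounded_bilinear_scaleR])
    fix b :: 'b assume "b \<in> Basis"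
    show "Ck_on k (\<lambda>x. frechet_derivative h (at x) v \<bullet> b) U"
      using Suc.prems by (intro Ck_on_compose_linear[OF bounded_linear_inner_left] assms(1)) auto
    show "Ck_on k (\<lambda>x. frechet_derivative f (at (h x)) b) U"
      using Suc.prems h by (intro Suc.IH) auto
  qed
  moreover have "(\<lambda>x. f (h x)) differentiable at x" if "x \<in> U" for x
    using differentiable_compose[where f=f and g=h] diff[OF that] by (simp add: differentiable_chain_at[unfolded o_def])
  ultimately show ?case by auto
qed

definition smooth_near :: "'a \<Rightarrow> ('a::euclidean_space \<Rightarrow> 'b::real_normed_vector) \<Rightarrow> bool"
  where "smooth_near p f \<longleftrightarrow> (\<exists>U. open U \<and> p \<in> U \<and> smooth_on f U)"

lemma smooth_nearI: "open U \<Longrightarrow> p \<in> U \<Longrightarrow> smooth_on f U \<Longrightarrow> smooth_near p f"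
  unfolding smooth_near_def by blast

lemma smooth_on_subset: "smooth_on f U \<Longrightarrow> V \<subseteq> U \<Longrightarrow> smooth_on f V"
  unfolding smooth_on_def using Ck_on_subset by blast

lemma smooth_near2E:
  assumes "smooth_near p f" "smooth_near p g"
  obtains U where "open U" "p \<in> U" "smooth_on f U" "smooth_on g U"
proof -
  obtain A B where "open A" "p \<in> A" "smooth_on f A" "open B" "p \<in> B" "smooth_on g B"
    using assms unfolding smooth_near_def by blast
  then show thesis
    by (intro that[of "A \<inter> B"]) (auto intro: smooth_on_subset)
qed

lemma smooth_near_eventually: "smooth_near p f \<Longrightarrow> \<forall>\<^sub>F q in nhds p. smooth_near q f"
  unfolding smooth_near_def eventually_nhds by blast

lemma smooth_near_cong:
  assumes "smooth_near p f" "\<forall>\<^sub>F x in nhds p. f x = g x"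
  shows "smooth_near p g"
proof -
  obtain A where A: "open A" "p \<in> A" "smooth_on f A"
    using assms(1) unfolding smooth_near_def by blast
  obtain B where B: "open B" "p \<in> B" "\<And>x. x \<in> B \<Longrightarrow> f x = g x"
    using assms(2) unfolding eventually_nhds by blast
  have "smooth_on f (A \<inter> B)" using A by (auto intro: smooth_on_subset)
  then have "smooth_on g (A \<inter> B)"
    unfolding smooth_on_def using Ck_on_cong[of "A \<inter> B" f g] A B by auto
  then show ?thesis using A B by (intro smooth_nearI[of "A \<inter> B"]) auto
qed

lemma smooth_near_const [simp]: "smooth_near p (\<lambda>x. c)"
  by (rule smooth_nearI[of UNIV]) (auto simp: smooth_on_def Ck_on_const)

lemma smooth_near_bounded_linear: "bounded_linear L \<Longrightarrow> smooth_near p L"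
  by (rule smooth_nearI[of UNIV]) (auto simp: smooth_on_def Ck_on_bounded_linear)

lemma smooth_near_bilinear:
  assumes "bounded_bilinear B" "smooth_near p f" "smooth_near p g"
  shows "smooth_near p (\<lambda>x. B (f x) (g x))"
proof -
  obtain U where "open U" "p \<in> U" "smooth_on f U" "smooth_on g U"
    by (rule smooth_near2E[OF assms(2,3)])
  then show ?thesis
    by (intro smooth_nearI[of U]) (auto simp: smooth_on_def intro: Ck_on_bilinear[OF assms(1)])
qed

lemma smooth_near_add:
  assumes "smooth_near p f" "smooth_near p g"
  shows "smooth_near p (\<lambda>x. f x + g x)"
proof -
  obtain U where "open U" "p \<in> U" "smooth_on f U" "smooth_on g U"
    by (rule smooth_near2E[OF assms])
  then show ?thesis
    by (intro smooth_nearI[of U]) (auto simp: smooth_on_def intro: Ck_on_add)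
qed

lemma smooth_near_sum:
  assumes "\<And>i. i \<in> I \<Longrightarrow> smooth_near p (f i)"
  shows "smooth_near p (\<lambda>x. \<Sum>i\<in>I. f i x)"
  using assms
  by (induction I rule: infinite_finite_induct) (auto intro!: smooth_near_add)

lemma smooth_near_linear:
  assumes "bounded_linear L" "smooth_near p f"
  shows "smooth_near p (\<lambda>x. L (f x))"
  using assms(2) Ck_on_compose_linear[OF assms(1)] unfolding smooth_near_def smooth_on_def
  by blast

lemma smooth_near_mult:
  fixes f g :: "_ \<Rightarrow> complex"
  shows "smooth_near p f \<Longrightarrow> smooth_near p g \<Longrightarrow> smooth_near p (\<lambda>x. f x * g x)"
  by (rule smooth_near_bilinear[OF bounded_bilinear_mult])

lemma smooth_near_diff:
  "smooth_near p f \<Longrightarrow> smooth_near p g \<Longrightarrow> smooth_near p (\<lambda>x. f x - g x)"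
  using smooth_near_add[of p f "\<lambda>x. - g x"]
    smooth_near_linear[OF bounded_linear_minus[OF bounded_linear_ident], of p g] by simp

lemma smooth_on_deriv: "smooth_on f U \<Longrightarrow> smooth_on (\<lambda>x. frechet_derivative f (at x) v) U"
  unfolding smooth_on_def
proof
  fix k assume "\<forall>k. Ck_on k f U"
  then have "Ck_on (Suc k) f U" by blast
  then show "Ck_on k (\<lambda>x. frechet_derivative f (at x) v) U" by simp
qed

lemma smooth_near_deriv:
  "smooth_near p f \<Longrightarrow> smooth_near p (\<lambda>x. frechet_derivative f (at x) v)"
  unfolding smooth_near_def using smooth_on_deriv by blast

lemma smooth_on_differentiable: "smooth_on f U \<Longrightarrow> x \<in> U \<Longrightarrow> f differentiable at x"
  unfolding smooth_on_def by (drule spec[of _ "Suc 0"]) simp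

lemma smooth_near_differentiable:
  assumes "smooth_near p f"
  shows "\<forall>\<^sub>F x in nhds p. f differentiable at x"
  using assms smooth_on_differentiable
  unfolding smooth_near_def eventually_nhds by blast

lemma smooth_near_self: "smooth_near p f \<Longrightarrow> f differentiable at p"
  using smooth_near_differentiable eventually_nhds_x_imp_x by blast

lemma smooth_near_isCont: "smooth_near p f \<Longrightarrow> isCont f p"
  using smooth_near_self differentiable_imp_continuous_within by blast

lemma smooth_near_tendsto: "smooth_near p f \<Longrightarrow> filterlim f (nhds (f p)) (nhds p)"
  using smooth_near_isCont by (simp add: isCont_def tendsto_at_iff_tendsto_nhds)

lemma smooth_near_compose:
  fixes h :: "'a::euclidean_space \<Rightarrow> 'b::euclidean_space"
  assumes "smooth_near p h" "smooth_near (h p) f"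
  shows "smooth_near p (\<lambda>x. f (h x))"
proof -
  obtain A where A: "open A" "p \<in> A" "smooth_on h A"
    using assms(1) unfolding smooth_near_def by blast
  obtain B where B: "open B" "h p \<in> B" "smooth_on f B"
    using assms(2) unfolding smooth_near_def by blast
  have "continuous_on A h" using A(3) unfolding smooth_on_def by (auto dest: spec[of _ 0])
  then have o: "open (A \<inter> h -` B)" using A(1) B(1) by (simp add: continuous_on_open_vimage Int_commute)
  have "smooth_on h (A \<inter> h -` B)" using A by (auto intro: smooth_on_subset)
  then have "Ck_on k (\<lambda>x. f (h x)) (A \<inter> h -` B)" for k
    using Ck_on_compose[OF o B(1), of h k f] B(3) unfolding smooth_on_def by blast
  then have "smooth_on (\<lambda>x. f (h x)) (A \<inter> h -` B)"
    unfolding smooth_on_def by blast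
  then show ?thesis using o A B by (intro smooth_nearI) auto
qed

lemma smooth_near_componentwise:
  fixes h :: "'a::euclidean_space \<Rightarrow> 'b::euclidean_space"
  assumes "\<And>b. b \<in> Basis \<Longrightarrow> smooth_near p (\<lambda>x. h x \<bullet> b)"
  shows "smooth_near p h"
proof -
  have "smooth_near p (\<lambda>x. \<Sum>b\<in>Basis. (h x \<bullet> b) *\<^sub>R b)"
    by (intro smooth_near_sum smooth_near_bilinear[OF bounded_bilinear_scaleR] assms) auto
  then show ?thesis by (simp add: euclidean_representation)
qed

lemma smooth_near_Pair:
  fixes f :: "'a::euclidean_space \<Rightarrow> 'b::real_normed_vector" and g :: "'a \<Rightarrow> 'c::real_normed_vector"
  assumes "smooth_near p f" "smooth_near p g"
  shows "smooth_near p (\<lambda>x. (f x, g x))"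
proof -
  have "smooth_near p (\<lambda>x. (f x, 0::'c) + (0::'b, g x))"
    by (intro smooth_near_add smooth_near_linear[of "\<lambda>y. (y, 0)"] smooth_near_linear[of "\<lambda>y. (0, y)"] assms)
      (auto intro!: bounded_linear_Pair bounded_linear_ident bounded_linear_zero)
  then show ?thesis by simp
qed

section \<open>Holomorphic functions of several variables are smooth\<close>

text \<open>
  The complex structure enters only through a scalar action extending the real one, so that the
  results apply both to \<open>\<complex>\<^sup>n\<close> and to \<open>\<complex>\<^sup>n \<times> \<complex>\<^sup>n\<close>.
\<close>

definition complex_scaling :: "(complex \<Rightarrow> 'a \<Rightarrow> 'a::real_normed_vector) \<Rightarrow> bool"
  where "complex_scaling sc \<longleftrightarrow> bounded_bilinear sc \<and> (\<forall>r v. sc (of_real r) v = r *\<^sub>R v)"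

lemma complex_diff_atD:
  assumes "complex_diff_at sc f x"
  shows "f differentiable at x" "frechet_derivative f (at x) (sc c v) = c * frechet_derivative f (at x) v"
proof -
  obtain D where D: "(f has_derivative D) (at x)" "\<And>c v. D (sc c v) = c * D v"
    using assms unfolding complex_diff_at_def by blast
  show "f differentiable at x" using D(1) by (auto simp: differentiable_def)
  show "frechet_derivative f (at x) (sc c v) = c * frechet_derivative f (at x) v"
    using frechet_derivative_eq[OF D(1)] D(2) by simp
qed

lemma complex_diff_slice:
  assumes sc: "complex_scaling sc" and f: "complex_diff_at sc f (x + sc z v)"
  shows "((\<lambda>z. f (x + sc z v)) has_field_derivative frechet_derivative f (at (x + sc z v)) v) (at z)"
proof -
  have bl: "bounded_linear (\<lambda>z. sc z v)"
    using sc unfolding complex_scaling_def by (simp add: bounded_bilinear.bounded_linear_left)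
  have "((\<lambda>z. x + sc z v) has_derivative (\<lambda>h. sc h v)) (at z)"
    using has_derivative_add[OF has_derivative_const bounded_linear_imp_has_derivative[OF bl]] by simp
  from has_derivative_compose[OF this has_derivative_frechet[OF complex_diff_atD(1)[OF f]]]
  have "((\<lambda>z. f (x + sc z v)) has_derivative
      (\<lambda>h. frechet_derivative f (at (x + sc z v)) (sc h v))) (at z)" .
  moreover have "(\<lambda>h. frechet_derivative f (at (x + sc z v)) (sc h v)) =
      (*) (frechet_derivative f (at (x + sc z v)) v)"
    by (simp add: complex_diff_atD(2)[OF f] fun_eq_iff mult.commute)
  ultimately show ?thesis unfolding has_field_derivative_def by simp
qed

text \<open>
  The density \<open>c'(t) / (2 \<pi> \<i> c(t)\<^sup>2)\<close> in Cauchy's formula for the derivative at the centre of the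
  circle \<open>c(t)\<close> of radius \<open>r\<close>.
\<close>

definition cauchy_weight :: "real \<Rightarrow> real \<Rightarrow> complex"
  where "cauchy_weight r t =
    of_real r * exp (2 * of_real pi * \<i> * of_real t) / (circlepath 0 r t)\<^sup>2"

lemma cauchy_directional_derivative:
  assumes sc: "complex_scaling sc" and r: "r > 0"
    and f: "\<And>z. cmod z \<le> r \<Longrightarrow> complex_diff_at sc f (x + sc z v)"
  shows "frechet_derivative f (at x) v =
    integral {0..1} (\<lambda>t. f (x + sc (circlepath 0 r t) v) * cauchy_weight r t)"
proof -
  let ?g = "\<lambda>z. f (x + sc z v)"
  have sc0: "sc 0 v = 0"
    using sc bounded_bilinear.zero_left unfolding complex_scaling_def by blast
  have der: "(?g has_field_derivative frechet_derivative f (at (x + sc z v)) v) (at z)"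
    if "cmod z \<le> r" for z
    by (rule complex_diff_slice[OF sc f[OF that]])
  have cont: "continuous_on (cball 0 r) ?g"
    using der by (intro continuous_at_imp_continuous_on ballI) (auto intro: DERIV_isCont)
  have hol: "?g holomorphic_on ball 0 r"
  proof (rule holomorphic_onI)
    fix z :: complex assume "z \<in> ball 0 r"
    then have "(?g has_field_derivative frechet_derivative f (at (x + sc z v)) v) (at z within ball 0 r)"
      by (intro has_field_derivative_at_within[OF der]) simp
    then show "?g field_differentiable at z within ball 0 r"
      unfolding field_differentiable_def by blast
  qed
  have "(?g has_field_derivative (1 / (2 * of_real pi * \<i>) *
      contour_integral (circlepath 0 r) (\<lambda>u. ?g u / (u - 0)^2))) (at 0)"
    by (rule Cauchy_derivative_integral_circlepath[OF cont hol]) (use r in simp)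
  then have "frechet_derivative f (at x) v = 1 / (2 * of_real pi * \<i>) *
      contour_integral (circlepath 0 r) (\<lambda>u. ?g u / u^2)"
    using DERIV_unique[OF der[of 0]] r by (simp add: sc0)
  also have "\<dots> = integral {0..1} (\<lambda>t. 1 / (2 * of_real pi * \<i>) * (?g (circlepath 0 r t) / (circlepath 0 r t)^2 *
      (2 * pi * \<i> * r * exp (2 * of_real pi * \<i> * t))))"
    unfolding contour_integral_integral vector_derivative_circlepath integral_mult_right ..
  also have "\<dots> = integral {0..1} (\<lambda>t. f (x + sc (circlepath 0 r t) v) * cauchy_weight r t)"
  proof (intro integral_cong)
    fix t :: real
    have *: "c \<noteq> 0 \<Longrightarrow> 1 / c * (a / b * (c * d * e)) = a * (d * e / b)" for a b c d e :: complex
      by simp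
    show "1 / (2 * of_real pi * \<i>) * (?g (circlepath 0 r t) / (circlepath 0 r t)^2 *
        (2 * pi * \<i> * r * exp (2 * of_real pi * \<i> * t))) = ?g (circlepath 0 r t) * cauchy_weight r t"
      unfolding cauchy_weight_def of_real_mult of_real_numeral by (rule *) simp
  qed
  finally show ?thesis .
qed

lemma continuous_on_circlepath: "continuous_on S (circlepath 0 r)"
  unfolding circlepath by (intro continuous_intros)

lemma continuous_on_cauchy_weight: "r > 0 \<Longrightarrow> continuous_on S (cauchy_weight r)"
  unfolding cauchy_weight_def circlepath by (intro continuous_intros) auto

lemma complex_scaling_radius:
  assumes sc: "complex_scaling sc" and e: "e > 0"
  obtains r where "r > 0" "\<And>z. cmod z \<le> r \<Longrightarrow> norm (sc z v) < e"
proof -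
  have bl: "bounded_linear (\<lambda>z. sc z v)"
    using sc unfolding complex_scaling_def by (simp add: bounded_bilinear.bounded_linear_left)
  then have "isCont (\<lambda>z. sc z v) 0" by (rule linear_continuous_at)
  then obtain d where "d > 0" "\<And>z. dist z 0 < d \<Longrightarrow> dist (sc z v) (sc 0 v) < e"
    using e unfolding continuous_at_eps_delta by blast
  moreover have "sc 0 v = 0" using linear_0[OF bounded_linear.linear[OF bl]] .
  ultimately show thesis by (intro that[of "d/2"]) auto
qed

lemma add_in_ball:
  fixes x :: "'a::real_normed_vector"
  assumes "x \<in> ball x0 (e / 2)" "norm w < e / 2"
  shows "x + w \<in> ball x0 e"
proof -
  have "dist x0 (x + w) \<le> dist x0 x + dist x (x + w)" by (rule dist_triangle)
  then show ?thesis using assms by (simp add: dist_norm)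
qed

lemma cmod_circlepath: "r > 0 \<Longrightarrow> cmod (circlepath 0 r t) \<le> r"
  by (simp add: circlepath norm_mult)

text \<open>
  Cauchy's formula expresses the directional derivative as an integral of values of \<open>f\<close>, and these
  depend continuously on the base point. Continuity of the derivative has to come first: it is what
  allows differentiation under the integral sign in the next lemma.
\<close>

lemma complex_diff_continuous_derivative:
  fixes f :: "'a::euclidean_space \<Rightarrow> complex"
  assumes sc: "complex_scaling sc" and U: "open U" and f: "\<And>x. x \<in> U \<Longrightarrow> complex_diff_at sc f x"
  shows "continuous_on U (\<lambda>x. frechet_derivative f (at x) v)"
proof (rule continuous_at_imp_continuous_on, rule ballI)
  fix x0 assume "x0 \<in> U"
  then obtain e where e: "e > 0" "ball x0 e \<subseteq> U" using U openE by blast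
  obtain r where r: "r > 0" "\<And>z. cmod z \<le> r \<Longrightarrow> norm (sc z v) < e / 2"
    using complex_scaling_radius[OF sc, of "e/2" v] e by auto
  have inU: "x + sc z v \<in> U" if "x \<in> ball x0 (e/2)" "cmod z \<le> r" for x z
    using add_in_ball[OF that(1) r(2)[OF that(2)]] e(2) by blast
  have contf: "continuous_on U f"
    using f complex_diff_atD(1) differentiable_imp_continuous_within
    by (intro continuous_at_imp_continuous_on) blast
  have contsc: "continuous_on S (\<lambda>p. sc (circlepath 0 r (snd p)) v)" for S :: "('a \<times> real) set"
    using sc unfolding complex_scaling_def
    by (intro bounded_bilinear.continuous_on[of sc] continuous_on_compose2[OF continuous_on_circlepath[of UNIV]]
        continuous_intros) auto
  have "continuous_on (ball x0 (e/2) \<times> cbox 0 1)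
      (\<lambda>p. f (fst p + sc (circlepath 0 r (snd p)) v) * cauchy_weight r (snd p))"
    by (intro continuous_on_mult continuous_on_compose2[OF contf]
        continuous_on_compose2[OF continuous_on_cauchy_weight[OF r(1), of UNIV]]
        continuous_on_add contsc continuous_intros)
      (use inU cmod_circlepath[OF r(1)] in auto)
  then have "continuous_on (ball x0 (e/2))
      (\<lambda>x. integral (cbox 0 1) (\<lambda>t. f (x + sc (circlepath 0 r t) v) * cauchy_weight r t))"
    by (intro integral_continuous_on_param) (simp add: case_prod_beta)
  moreover have "frechet_derivative f (at x) v =
      integral (cbox 0 1) (\<lambda>t. f (x + sc (circlepath 0 r t) v) * cauchy_weight r t)"
    if "x \<in> ball x0 (e/2)" for x
    unfolding cbox_interval
    by (rule cauchy_directional_derivative[OF sc r(1)]) (use f inU that in blast)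
  ultimately have "continuous_on (ball x0 (e/2)) (\<lambda>x. frechet_derivative f (at x) v)"
    by (subst continuous_on_cong[OF refl]) auto
  then show "isCont (\<lambda>x. frechet_derivative f (at x) v) x0"
    using e by (simp add: continuous_on_eq_continuous_at)
qed

text \<open>
  Differentiating Cauchy's formula under the integral sign; the derivative of the integrand is
  complex linear, and integration preserves that.
\<close>

lemma complex_diff_derivative:
  fixes f :: "'a::euclidean_space \<Rightarrow> complex"
  assumes sc: "complex_scaling sc" and U: "open U" and f: "\<And>x. x \<in> U \<Longrightarrow> complex_diff_at sc f x"
    and x0: "x0 \<in> U"
  shows "complex_diff_at sc (\<lambda>x. frechet_derivative f (at x) v) x0"
proof -
  obtain e where e: "e > 0" "ball x0 e \<subseteq> U" using U x0 openE by blast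
  obtain r where r: "r > 0" "\<And>z. cmod z \<le> r \<Longrightarrow> norm (sc z v) < e / 2"
    using complex_scaling_radius[OF sc, of "e/2" v] e by auto
  have inU: "x + sc z v \<in> U" if "x \<in> ball x0 (e/2)" "cmod z \<le> r" for x z
    using add_in_ball[OF that(1) r(2)[OF that(2)]] e(2) by blast
  define f' where "f' x = Blinfun (frechet_derivative f (at x))" for x
  have f': "blinfun_apply (f' x) = frechet_derivative f (at x)" if "x \<in> U" for x
    unfolding f'_def using complex_diff_atD(1)[OF f[OF that]]
    by (intro bounded_linear_Blinfun_apply has_derivative_bounded_linear[OF has_derivative_frechet])
  have contf': "continuous_on U f'"
    using complex_diff_continuous_derivative[OF sc U f]
    by (intro continuous_on_blinfun_componentwise) (simp add: f' cong: continuous_on_cong)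
  have contf: "continuous_on U f"
    using f complex_diff_atD(1) differentiable_imp_continuous_within
    by (intro continuous_at_imp_continuous_on) blast
  have contsc: "continuous_on S (\<lambda>p. sc (circlepath 0 r (snd p)) v)" for S :: "('a \<times> real) set"
    using sc unfolding complex_scaling_def
    by (intro bounded_bilinear.continuous_on[of sc] continuous_on_compose2[OF continuous_on_circlepath[of UNIV]]
        continuous_intros) auto
  have contsc1: "continuous_on S (\<lambda>t. sc (circlepath 0 r t) v)" for S
    using sc unfolding complex_scaling_def
    by (intro bounded_bilinear.continuous_on[of sc] continuous_on_compose2[OF continuous_on_circlepath[of UNIV]]
        continuous_intros) auto
  define B where "B = ball x0 (e/2)"
  define F where "F x t = f (x + sc (circlepath 0 r t) v) * cauchy_weight r t" for x t
  define F' where "F' x t = blinfun_mult_left (cauchy_weight r t) o\<^sub>L f' (x + sc (circlepath 0 r t) v)" for x t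
  have pU: "x + sc (circlepath 0 r t) v \<in> U" if "x \<in> B" for x t
    using inU[of x] that cmod_circlepath[OF r(1)] unfolding B_def by blast
  have F'_apply: "blinfun_apply (F' x t) h =
      frechet_derivative f (at (x + sc (circlepath 0 r t) v)) h * cauchy_weight r t" if "x \<in> B" for x t h
    unfolding F'_def using f'[OF pU[OF that]] by simp
  have contF': "continuous_on (B \<times> cbox 0 1) (\<lambda>(x, t). F' x t)"
    unfolding F'_def case_prod_beta
    by (intro bounded_bilinear.continuous_on[OF bounded_bilinear_blinfun_compose]
        bounded_linear.continuous_on[OF bounded_linear_blinfun_mult_left]
        continuous_on_compose2[OF contf']
        continuous_on_compose2[OF continuous_on_cauchy_weight[OF r(1), of UNIV]]
        continuous_on_add contsc continuous_intros)
      (use pU in auto)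
  have der: "((\<lambda>x. integral (cbox 0 1) (F x)) has_derivative integral (cbox 0 1) (F' x0)) (at x0 within B)"
  proof (rule leibniz_rule[OF _ _ contF'])
    fix x t assume x: "x \<in> B"
    have "((\<lambda>x. x + sc (circlepath 0 r t) v) has_derivative (\<lambda>h. h)) (at x within B)"
      by (auto intro!: derivative_eq_intros)
    from has_derivative_compose[OF this has_derivative_frechet[OF complex_diff_atD(1)[OF f[OF pU[OF x]]]]]
    have "((\<lambda>x. f (x + sc (circlepath 0 r t) v)) has_derivative
        frechet_derivative f (at (x + sc (circlepath 0 r t) v))) (at x within B)" .
    from has_derivative_mult_left[OF this, of "cauchy_weight r t"]
    show "((\<lambda>x. F x t) has_derivative blinfun_apply (F' x t)) (at x within B)"
      unfolding F_def F'_apply[OF x] by (simp add: F'_apply[OF x, abs_def] fun_eq_iff)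
  next
    fix x assume x: "x \<in> B"
    show "F x integrable_on cbox 0 1"
      unfolding F_def
      by (intro integrable_continuous continuous_on_mult continuous_on_compose2[OF contf]
        continuous_on_cauchy_weight[OF r(1)] continuous_on_add contsc1 continuous_on_const)
        (use pU[OF x] in auto)
  qed (use e in \<open>auto simp: B_def\<close>)
  have x0B: "x0 \<in> B" "open B" using e by (auto simp: B_def)
  have int: "F' x0 integrable_on cbox 0 1"
  proof -
    have "continuous_on (cbox 0 1) (\<lambda>t. (\<lambda>(x, t). F' x t) (x0, t))"
      by (rule continuous_on_compose2[OF contF']) (auto intro!: continuous_intros simp: x0B)
    then show ?thesis by (intro integrable_continuous) simp
  qed
  have D: "((\<lambda>x. frechet_derivative f (at x) v) has_derivative blinfun_apply (integral (cbox 0 1) (F' x0))) (at x0)"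
  proof (rule has_derivative_transform_within_open[OF _ x0B(2,1)])
    show "((\<lambda>x. integral (cbox 0 1) (F x)) has_derivative integral (cbox 0 1) (F' x0)) (at x0)"
      using der at_within_open[OF x0B] by simp
    fix x assume "x \<in> B"
    then show "integral (cbox 0 1) (F x) = frechet_derivative f (at x) v"
      unfolding F_def cbox_interval
      by (subst cauchy_directional_derivative[OF sc r(1), of f x v]) (use f inU B_def in auto)
  qed
  have "blinfun_apply (integral (cbox 0 1) (F' x0)) (sc c h) =
      c * blinfun_apply (integral (cbox 0 1) (F' x0)) h" for c h
  proof -
    have "blinfun_apply (integral (cbox 0 1) (F' x0)) (sc c h) =
        integral (cbox 0 1) (\<lambda>t. c * blinfun_apply (F' x0 t) h)"
      unfolding blinfun_apply_integral[OF int]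
      by (simp add: F'_apply[OF x0B(1)] complex_diff_atD(2)[OF f[OF pU[OF x0B(1)]]] mult.assoc)
    also have "\<dots> = c * integral (cbox 0 1) (\<lambda>t. blinfun_apply (F' x0 t) h)"
      by (rule integral_mult_right)
    finally show ?thesis unfolding blinfun_apply_integral[OF int] .
  qed
  with D show ?thesis unfolding complex_diff_at_def by blast
qed

lemma complex_diff_smooth_on:
  fixes f :: "'a::euclidean_space \<Rightarrow> complex"
  assumes sc: "complex_scaling sc" and U: "open U" and f: "\<And>x. x \<in> U \<Longrightarrow> complex_diff_at sc f x"
  shows "smooth_on f U"
  unfolding smooth_on_def
proof
  fix k show "Ck_on k f U"
    using f
  proof (induction k arbitrary: f)
    case 0
    then show ?case
      by (auto intro!: continuous_at_imp_continuous_on differentiable_imp_continuous_within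
          complex_diff_atD(1))
  next
    case (Suc k)
    have "Ck_on k (\<lambda>x. frechet_derivative f (at x) v) U" for v
      by (rule Suc.IH) (rule complex_diff_derivative[OF sc U Suc.prems])
    then show ?case using complex_diff_atD(1)[OF Suc.prems] by simp
  qed
qed

section \<open>Tangent vectors of level sets\<close>

text \<open>
  The map \<open>\<Phi> x = x + (\<Sum>j<d. B j (r j x - D j (x - p)))\<close>, with \<open>D j\<close> the derivative of \<open>r j\<close> at \<open>p\<close>,
  has the identity as its derivative at \<open>p\<close>, and by duality of \<open>B\<close> and \<open>D\<close> it straightens the level
  set: \<open>D i (\<Phi> x - p) = r i x\<close>. Hence its local inverse maps the line through \<open>p\<close> in a direction \<open>v\<close>
  killed by all \<open>D i\<close> to a curve in the level set with velocity \<open>v\<close>, along which \<open>f\<close> vanishes.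
  The subspace \<open>S\<close> is where the \<open>r j\<close> take their values: the real line for the defining functions of
  \<open>M\<close>, all of \<open>\<complex>\<close> for those of a Segre variety.
\<close>

lemma level_set_tangent:
  fixes r :: "nat \<Rightarrow> 'a::euclidean_space \<Rightarrow> complex" and f :: "'a \<Rightarrow> complex"
  assumes U: "open U" "p \<in> U"
    and r: "\<And>j. j < d \<Longrightarrow> Ck_on 1 (r j) U" "\<And>j. j < d \<Longrightarrow> r j p = 0"
    and B: "\<And>j. bounded_linear (B j)"
    and S: "subspace S" "\<And>j x. j < d \<Longrightarrow> x \<in> U \<Longrightarrow> r j x \<in> S"
      "\<And>j v. j < d \<Longrightarrow> frechet_derivative (r j) (at p) v \<in> S"
    and dual: "\<And>i j c. i < d \<Longrightarrow> j < d \<Longrightarrow> c \<in> S \<Longrightarrow>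
      frechet_derivative (r i) (at p) (B j c) = (if i = j then c else 0)"
    and f: "f differentiable at p" "\<forall>\<^sub>F x in nhds p. (\<forall>j<d. r j x = 0) \<longrightarrow> f x = 0"
    and v: "\<And>j. j < d \<Longrightarrow> frechet_derivative (r j) (at p) v = 0"
  shows "frechet_derivative f (at p) v = 0"
proof -
  define D where "D j = frechet_derivative (r j) (at p)" for j
  have diff: "r j differentiable at x" if "j < d" "x \<in> U" for j x
    using r(1) that by simp
  have D: "bounded_linear (D j)" if "j < d" for j
    unfolding D_def by (rule has_derivative_bounded_linear[OF has_derivative_frechet[OF diff[OF that U(2)]]])
  define \<Phi> where "\<Phi> x = x + (\<Sum>j<d. B j (r j x - D j (x - p)))" for x
  define \<Phi>' where "\<Phi>' x h = h + (\<Sum>j<d. B j (frechet_derivative (r j) (at x) h - D j h))" for x h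
  have der: "(\<Phi> has_derivative \<Phi>' x) (at x)" if "x \<in> U" for x
    unfolding \<Phi>_def[abs_def] \<Phi>'_def[abs_def]
  proof (intro has_derivative_add has_derivative_ident has_derivative_sum bounded_linear.has_derivative[OF B]
        has_derivative_diff has_derivative_frechet)
    fix j assume j: "j \<in> {..<d}"
    show "r j differentiable at x" using diff that j by simp
    have "((\<lambda>x. x - p) has_derivative (\<lambda>h. h)) (at x)" by (auto intro!: derivative_eq_intros)
    then show "((\<lambda>x. D j (x - p)) has_derivative D j) (at x)"
      using bounded_linear.has_derivative[OF D] j by fastforce
  qed
  define L where "L x = Blinfun (\<Phi>' x)" for x
  have L: "blinfun_apply (L x) = \<Phi>' x" if "x \<in> U" for x
    unfolding L_def by (rule bounded_linear_Blinfun_apply[OF has_derivative_bounded_linear[OF der[OF that]]])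
  have contL: "continuous_on U L"
  proof (rule continuous_on_blinfun_componentwise)
    fix b :: 'a
    have "continuous_on U (\<lambda>x. \<Phi>' x b)"
      unfolding \<Phi>'_def using r(1)
      by (intro continuous_intros bounded_linear.continuous_on[OF B]) auto
    then show "continuous_on U (\<lambda>x. blinfun_apply (L x) b)"
      by (subst continuous_on_cong[OF refl]) (auto simp: L)
  qed
  have \<Phi>'p: "\<Phi>' p = (\<lambda>h. h)"
    unfolding \<Phi>'_def D_def using B by (auto simp: bounded_linear.linear linear_0)
  have inv: "id_blinfun o\<^sub>L L p = id_blinfun"
    by (rule blinfun_eqI) (simp add: L[OF U(2)] \<Phi>'p)
  have \<Phi>p: "\<Phi> p = p"
    unfolding \<Phi>_def using B D r(2) by (auto simp: bounded_linear.linear linear_0)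
  obtain U' V g g' where g: "open U'" "U' \<subseteq> U" "p \<in> U'" "open V" "\<Phi> p \<in> V" "homeomorphism U' V \<Phi> g"
    "\<And>y. y \<in> V \<Longrightarrow> (g has_derivative (g' y)) (at y)"
    "\<And>y. y \<in> V \<Longrightarrow> g' y = inv_into UNIV (blinfun_apply (L (g y)))"
    by (rule inverse_function_theorem[of U \<Phi> L p id_blinfun, OF U(1) _ contL U(2) inv])
      (use der L in auto)
  have gp: "g p = p"
    using g(3,6) \<Phi>p unfolding homeomorphism_def by metis
  have pV: "p \<in> V" using g(5) \<Phi>p by simp
  have g'p: "g' p = (\<lambda>h. h)"
    using g(8)[OF pV] by (simp add: gp L[OF U(2)] \<Phi>'p inv_id[unfolded id_def])
  have zero: "r i (g y) = 0" if y: "y \<in> V" "\<And>j. j < d \<Longrightarrow> D j (y - p) = 0" and i: "i < d" for y i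
  proof -
    have gy: "g y \<in> U" "\<Phi> (g y) = y"
      using g(2,6) y(1) unfolding homeomorphism_def by blast+
    have mem: "r j (g y) - D j (g y - p) \<in> S" if "j < d" for j
      using S(2)[OF that gy(1)] S(3)[OF that] S(1) unfolding D_def by (auto intro: subspace_diff)
    have lin: "linear (D i)" using D[OF i] bounded_linear.linear by blast
    have "y - p = (g y - p) + (\<Sum>j<d. B j (r j (g y) - D j (g y - p)))"
      using gy(2) unfolding \<Phi>_def by (simp add: algebra_simps)
    then have "D i (y - p) = D i ((g y - p) + (\<Sum>j<d. B j (r j (g y) - D j (g y - p))))"
      by (rule arg_cong)
    also have "\<dots> = D i (g y - p) + (\<Sum>j<d. D i (B j (r j (g y) - D j (g y - p))))"
      unfolding linear_add[OF lin] linear_sum[OF lin] ..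
    also have "(\<Sum>j<d. D i (B j (r j (g y) - D j (g y - p)))) =
        (\<Sum>j<d. if i = j then r j (g y) - D j (g y - p) else 0)"
      using dual[OF i] mem unfolding D_def by (intro sum.cong) auto
    also have "\<dots> = r i (g y) - D i (g y - p)" using i by (simp add: sum.delta')
    finally show ?thesis using y(2)[OF i] by simp
  qed
  have line: "((\<lambda>t. p + t *\<^sub>R v) has_derivative (\<lambda>t. t *\<^sub>R v)) (at 0)"
    by (auto intro!: derivative_eq_intros)
  have tend: "filterlim (\<lambda>t. p + t *\<^sub>R v) (nhds p) (nhds 0)"
    by (auto intro!: tendsto_eq_intros filterlim_ident)
  have gder: "(g has_derivative (\<lambda>h. h)) (at p)" using g(7)[OF pV] g'p by simp
  have gline: "((\<lambda>t. g (p + t *\<^sub>R v)) has_derivative (\<lambda>t. t *\<^sub>R v)) (at 0)"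
    using has_derivative_compose[OF line, of g "\<lambda>h. h"] gder by simp
  have fgline: "((\<lambda>t. f (g (p + t *\<^sub>R v))) has_derivative (\<lambda>t. frechet_derivative f (at p) (t *\<^sub>R v))) (at 0)"
    using has_derivative_compose[OF gline, of f] has_derivative_frechet[OF f(1)] gp by simp
  have "isCont g p" using gder has_derivative_continuous by blast
  then have gtend: "filterlim g (nhds p) (nhds p)"
    using tendsto_at_iff_tendsto_nhds[of g p] by (simp add: isCont_def gp)
  have "\<forall>\<^sub>F t in nhds 0. (\<forall>j<d. r j (g (p + t *\<^sub>R v)) = 0) \<longrightarrow> f (g (p + t *\<^sub>R v)) = 0"
    using filterlim_compose[OF gtend tend] f(2) unfolding filterlim_iff by blast
  moreover have "\<forall>\<^sub>F t in nhds 0. p + t *\<^sub>R v \<in> V"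
    using tend eventually_nhds_in_open[OF g(4) pV] unfolding filterlim_iff by blast
  ultimately have "\<forall>\<^sub>F t in nhds 0. f (g (p + t *\<^sub>R v)) = 0"
  proof eventually_elim
    case (elim t)
    have "r j (g (p + t *\<^sub>R v)) = 0" if "j < d" for j
    proof (rule zero[OF elim(2) _ that])
      fix i assume "i < d"
      then show "D i (p + t *\<^sub>R v - p) = 0"
        using v linear_scale[OF bounded_linear.linear[OF D]] unfolding D_def by simp
    qed
    then show ?case using elim(1) by blast
  qed
  then have "((\<lambda>t. f (g (p + t *\<^sub>R v))) has_derivative (\<lambda>t. 0)) (at (0::real))"
    by (subst has_derivative_cong_nhds) auto
  from has_derivative_unique[OF fgline this] have "frechet_derivative f (at p) (1 *\<^sub>R v) = 0"
    by metis
  then show ?thesis by simp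
qed

section \<open>Vectors dual to independent one-forms\<close>

text \<open>
  Composing the permutations in the sum with the transposition of \<open>i\<close> and \<open>l\<close> changes all signs and
  leaves all products unchanged.
\<close>

lemma wedge_repeated_form:
  assumes "i < d" "l < d" "i \<noteq> l" "\<theta> i = \<theta> l"
  shows "wedge d \<theta> v = 0"
proof -
  define \<tau> where "\<tau> = Transposition.transpose i l"
  have \<tau>: "\<tau> permutes {..<d}" unfolding \<tau>_def using assms by (intro permutes_swap_id) auto
  have inv: "\<tau> \<circ> \<tau> = id" by (simp add: \<tau>_def)
  let ?P = "{\<sigma>. \<sigma> permutes {..<d}}"
  let ?t = "\<lambda>\<sigma>. of_int (sign \<sigma>) * (\<Prod>j<d. \<theta> j (v (\<sigma> j)))"
  have bij: "bij_betw (\<lambda>\<sigma>. \<sigma> \<circ> \<tau>) ?P ?P"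
    by (rule bij_betw_byWitness[where f' = "\<lambda>\<sigma>. \<sigma> \<circ> \<tau>"])
      (auto simp: comp_assoc inv intro: permutes_compose[OF \<tau>])
  have "wedge d \<theta> v = (\<Sum>\<sigma>\<in>?P. ?t (\<sigma> \<circ> \<tau>))"
    unfolding wedge_def by (rule sum.reindex_bij_betw[OF bij, symmetric])
  also have "\<dots> = (\<Sum>\<sigma>\<in>?P. - ?t \<sigma>)"
  proof (rule sum.cong[OF refl])
    fix \<sigma> assume "\<sigma> \<in> ?P"
    then have \<sigma>: "\<sigma> permutes {..<d}" by simp
    have perm: "permutation \<sigma>" "permutation \<tau>"
      using \<sigma> \<tau> permutation_permutes finite_lessThan by blast+
    have sg: "sign (\<sigma> \<circ> \<tau>) = - sign \<sigma>"
      using sign_compose[OF perm] sign_swap_id[of i l] assms(3) by (simp add: \<tau>_def)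
    have \<theta>\<tau>: "\<theta> (\<tau> j) = \<theta> j" for j
      using assms(4) by (auto simp: \<tau>_def Transposition.transpose_def)
    have "(\<Prod>j<d. \<theta> j (v ((\<sigma> \<circ> \<tau>) j))) = (\<Prod>j<d. \<theta> (\<tau> j) (v (\<sigma> (\<tau> j))))"
      by (simp add: \<theta>\<tau>)
    also have "\<dots> = (\<Prod>j<d. \<theta> j (v (\<sigma> j)))"
      using prod.permute[OF \<tau>, of "\<lambda>j. \<theta> j (v (\<sigma> j))"] by (simp add: o_def)
    finally show "?t (\<sigma> \<circ> \<tau>) = - ?t \<sigma>" by (simp only: sg) simp
  qed
  also have "\<dots> = - wedge d \<theta> v" unfolding wedge_def by (simp add: sum_negf)
  finally show ?thesis by simp
qed

text \<open>
  Cramer's rule: expanding a nonzero value of the wedge product along the form \<open>\<theta> i\<close> gives a vector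
  \<open>b i\<close>, up to normalization. Pairing \<open>b i\<close> with \<open>\<theta> l\<close> evaluates the wedge product in which \<open>\<theta> i\<close>
  is replaced by \<open>\<theta> l\<close>, and that is zero for \<open>l \<noteq> i\<close> since a form is repeated.
\<close>

lemma wedge_dual_vectors:
  fixes \<theta> :: "nat \<Rightarrow> complex^'n \<Rightarrow> complex"
  assumes lin: "\<And>j. j < d \<Longrightarrow> linear (\<theta> j)" "\<And>j c v. j < d \<Longrightarrow> \<theta> j (c *s v) = c * \<theta> j v"
    and w: "wedge d \<theta> \<noteq> (\<lambda>v. 0)"
  obtains b where "\<And>i j. i < d \<Longrightarrow> j < d \<Longrightarrow> \<theta> i (b j) = (if i = j then 1 else 0)"
proof -
  obtain v where v: "wedge d \<theta> v \<noteq> 0" using w by auto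
  let ?P = "{\<sigma>. \<sigma> permutes {..<d}}"
  define b where "b i = (\<Sum>\<sigma>\<in>?P. (of_int (sign \<sigma>) * (\<Prod>j\<in>{..<d}-{i}. \<theta> j (v (\<sigma> j))) / wedge d \<theta> v) *s v (\<sigma> i))" for i
  have "\<theta> l (b i) = (if l = i then 1 else 0)" if il: "i < d" "l < d" for i l
  proof -
    have pr: "(\<Prod>j\<in>{..<d}-{i}. \<theta> j (v (\<sigma> j))) * \<theta> l (v (\<sigma> i)) = (\<Prod>j<d. (\<theta>(i := \<theta> l)) j (v (\<sigma> j)))" for \<sigma>
    proof -
      have "(\<Prod>j<d. (\<theta>(i := \<theta> l)) j (v (\<sigma> j))) =
          (\<theta>(i := \<theta> l)) i (v (\<sigma> i)) * (\<Prod>j\<in>{..<d}-{i}. (\<theta>(i := \<theta> l)) j (v (\<sigma> j)))"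
        by (rule prod.remove) (use il in auto)
      also have "(\<Prod>j\<in>{..<d}-{i}. (\<theta>(i := \<theta> l)) j (v (\<sigma> j))) = (\<Prod>j\<in>{..<d}-{i}. \<theta> j (v (\<sigma> j)))"
        by (rule prod.cong) auto
      finally show ?thesis by simp
    qed
    have "\<theta> l (b i) = (\<Sum>\<sigma>\<in>?P. of_int (sign \<sigma>) * ((\<Prod>j\<in>{..<d}-{i}. \<theta> j (v (\<sigma> j))) * \<theta> l (v (\<sigma> i)))) / wedge d \<theta> v"
      unfolding b_def by (simp add: linear_sum[OF lin(1)[OF il(2)]] lin(2)[OF il(2)] sum_divide_distrib mult.assoc)
    also have "\<dots> = wedge d (\<theta>(i := \<theta> l)) v / wedge d \<theta> v"
      unfolding pr wedge_def ..
    also have "\<dots> = (if l = i then 1 else 0)"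
      using v wedge_repeated_form[of i d l "\<theta>(i := \<theta> l)" v] il by auto
    finally show ?thesis .
  qed
  then show thesis using that by blast
qed

section \<open>Second derivatives and Lie brackets\<close>

text \<open>
  The second difference of \<open>f\<close> over a small parallelogram is symmetric in its two sides. Applying the
  mean value theorem twice, in either order, writes it as \<open>h\<^sup>2\<close> times a mixed derivative at a nearby
  point, so by continuity the two mixed derivatives agree.
\<close>

lemma mixed_derivatives_real:
  fixes f :: "'a::euclidean_space \<Rightarrow> real"
  assumes "Ck_on 2 f U" "open U" "x \<in> U"
  shows "frechet_derivative (\<lambda>y. frechet_derivative f (at y) u) (at x) v =
    frechet_derivative (\<lambda>y. frechet_derivative f (at y) v) (at x) u"
proof -
  define d where "d w = (\<lambda>y. frechet_derivative f (at y) w)" for w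
  define dd where "dd w z = (\<lambda>y. frechet_derivative (d w) (at y) z)" for w z
  have f1: "f differentiable at y" if "y \<in> U" for y
    using assms(1) that by (simp add: numeral_2_eq_2)
  have f2: "d w differentiable at y" if "y \<in> U" for y w
    using assms(1) that by (simp add: numeral_2_eq_2 d_def)
  have f3: "continuous_on U (dd w z)" for w z
    using assms(1) by (simp add: numeral_2_eq_2 d_def dd_def)
  have line: "((\<lambda>t. g (y + t *\<^sub>R w)) has_real_derivative frechet_derivative g (at (y + t *\<^sub>R w)) w) (at t)"
    if "g differentiable at (y + t *\<^sub>R w)" for g :: "'a \<Rightarrow> real" and y t w
  proof -
    have "((\<lambda>t. y + t *\<^sub>R w) has_derivative (\<lambda>h. h *\<^sub>R w)) (at t)"
      by (auto intro!: derivative_eq_intros)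
    from has_derivative_compose[OF this has_derivative_frechet[OF that]]
    show ?thesis unfolding has_field_derivative_def
      by (simp add: linear_scale[OF linear_frechet_derivative[OF that]] mult_commute_abs)
  qed
  \<comment> \<open>mean value theorem in the direction \<open>u\<close>, then in the direction \<open>v\<close>\<close>
  have key: "\<exists>s t. 0 < s \<and> s < h \<and> 0 < t \<and> t < h \<and>
      f (x + h *\<^sub>R u + h *\<^sub>R v) - f (x + h *\<^sub>R u) - f (x + h *\<^sub>R v) + f x = h * h * dd u v (x + s *\<^sub>R u + t *\<^sub>R v)"
    if h: "h > 0" and inU: "\<And>s t. 0 \<le> s \<Longrightarrow> s \<le> h \<Longrightarrow> 0 \<le> t \<Longrightarrow> t \<le> h \<Longrightarrow> x + s *\<^sub>R u + t *\<^sub>R v \<in> U"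
    for h u v
  proof -
    have "((\<lambda>s. f ((x + h *\<^sub>R v) + s *\<^sub>R u) - f (x + s *\<^sub>R u)) has_real_derivative
        d u ((x + h *\<^sub>R v) + s *\<^sub>R u) - d u (x + s *\<^sub>R u)) (at s)" if "0 \<le> s" "s \<le> h" for s
      unfolding d_def
      using inU[of s h] inU[of s 0] that h
      by (intro DERIV_diff line f1) (auto simp: algebra_simps)
    from MVT2[OF h this] obtain s where s: "0 < s" "s < h"
      "f ((x + h *\<^sub>R v) + h *\<^sub>R u) - f (x + h *\<^sub>R u) - (f (x + h *\<^sub>R v) - f x) =
        h * (d u ((x + h *\<^sub>R v) + s *\<^sub>R u) - d u (x + s *\<^sub>R u))"
      by auto
    have "((\<lambda>t. d u ((x + s *\<^sub>R u) + t *\<^sub>R v)) has_real_derivative dd u v ((x + s *\<^sub>R u) + t *\<^sub>R v)) (at t)"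
      if "0 \<le> t" "t \<le> h" for t
      unfolding dd_def using inU[of s t] that s(1,2) by (intro line f2) auto
    from MVT2[OF h this] obtain t where t: "0 < t" "t < h"
      "d u ((x + s *\<^sub>R u) + h *\<^sub>R v) - d u (x + s *\<^sub>R u) = h * dd u v ((x + s *\<^sub>R u) + t *\<^sub>R v)"
      by auto
    show ?thesis
      using s t by (intro exI[of _ s] exI[of _ t]) (simp add: algebra_simps)
  qed
  have close: "\<exists>h0>0. \<forall>s t. 0 \<le> s \<longrightarrow> s \<le> h0 \<longrightarrow> 0 \<le> t \<longrightarrow> t \<le> h0 \<longrightarrow> x + s *\<^sub>R u + t *\<^sub>R v \<in> W"
    if "open W" "x \<in> W" for W u v
  proof -
    have "((\<lambda>p. x + fst p *\<^sub>R u + snd p *\<^sub>R v) \<longlongrightarrow> x + 0 *\<^sub>R u + 0 *\<^sub>R v) (nhds (0 :: real \<times> real))"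
      by (intro tendsto_intros) (auto intro!: tendsto_eq_intros filterlim_ident)
    then have "\<forall>\<^sub>F p in nhds (0 :: real \<times> real). x + fst p *\<^sub>R u + snd p *\<^sub>R v \<in> W"
      using that topological_tendstoD by fastforce
    then obtain e where e: "e > 0" "\<And>p. dist p (0 :: real \<times> real) < e \<Longrightarrow> x + fst p *\<^sub>R u + snd p *\<^sub>R v \<in> W"
      unfolding eventually_nhds_metric by blast
    have "dist (s, t) (0 :: real \<times> real) < e" if "0 \<le> s" "s \<le> e/3" "0 \<le> t" "t \<le> e/3" for s t
      using norm_Pair_le[of s t] that e(1) by (simp add: dist_norm)
    then show ?thesis using e by (intro exI[of _ "e/3"]) force
  qed
  have "dd u v x = dd v u x"
  proof (rule ccontr)
    assume ne: "dd u v x \<noteq> dd v u x"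
    define e where "e = \<bar>dd u v x - dd v u x\<bar> / 2"
    have e: "e > 0" using ne by (simp add: e_def)
    have nb: "\<exists>W. open W \<and> x \<in> W \<and> W \<subseteq> U \<and> (\<forall>y\<in>W. \<bar>dd w z y - dd w z x\<bar> < e)" for w z
    proof -
      have "isCont (dd w z) x" using f3 assms(2,3) continuous_on_eq_continuous_at by blast
      then have "\<forall>\<^sub>F y in nhds x. dist (dd w z y) (dd w z x) < e"
        using e by (intro tendstoD) (simp_all add: isCont_def tendsto_at_iff_tendsto_nhds)
      then obtain W where "open W" "x \<in> W" "\<forall>y\<in>W. dist (dd w z y) (dd w z x) < e"
        unfolding eventually_nhds by blast
      then show ?thesis using assms(2,3) by (intro exI[of _ "W \<inter> U"]) (auto simp: dist_real_def)
    qed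
    obtain W1 where W1: "open W1" "x \<in> W1" "W1 \<subseteq> U" "\<And>y. y \<in> W1 \<Longrightarrow> \<bar>dd u v y - dd u v x\<bar> < e"
      using nb[of u v] by blast
    obtain W2 where W2: "open W2" "x \<in> W2" "W2 \<subseteq> U" "\<And>y. y \<in> W2 \<Longrightarrow> \<bar>dd v u y - dd v u x\<bar> < e"
      using nb[of v u] by blast
    obtain h where h: "h > 0" "\<And>s t. 0 \<le> s \<Longrightarrow> s \<le> h \<Longrightarrow> 0 \<le> t \<Longrightarrow> t \<le> h \<Longrightarrow> x + s *\<^sub>R u + t *\<^sub>R v \<in> W1 \<inter> W2"
      using close[of "W1 \<inter> W2"] W1 W2 by blast
    have hU: "x + s *\<^sub>R u + t *\<^sub>R v \<in> U" if "0 \<le> s" "s \<le> h" "0 \<le> t" "t \<le> h" for s t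
      using h(2)[OF that] W1(3) by blast
    obtain s t where 1: "0 < s" "s < h" "0 < t" "t < h"
      "f (x + h *\<^sub>R u + h *\<^sub>R v) - f (x + h *\<^sub>R u) - f (x + h *\<^sub>R v) + f x = h * h * dd u v (x + s *\<^sub>R u + t *\<^sub>R v)"
      using key[OF h(1), of u v] hU by blast
    have h': "x + s *\<^sub>R v + t *\<^sub>R u \<in> W1 \<inter> W2" if "0 \<le> s" "s \<le> h" "0 \<le> t" "t \<le> h" for s t
      using h(2)[of t s] that by (simp add: algebra_simps)
    have hU': "x + s *\<^sub>R v + t *\<^sub>R u \<in> U" if "0 \<le> s" "s \<le> h" "0 \<le> t" "t \<le> h" for s t
      using h'[OF that] W1(3) by blast
    obtain s' t' where 2: "0 < s'" "s' < h" "0 < t'" "t' < h"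
      "f (x + h *\<^sub>R v + h *\<^sub>R u) - f (x + h *\<^sub>R v) - f (x + h *\<^sub>R u) + f x = h * h * dd v u (x + s' *\<^sub>R v + t' *\<^sub>R u)"
      using key[OF h(1), of v u] hU' by blast
    have "h * h * dd u v (x + s *\<^sub>R u + t *\<^sub>R v) = h * h * dd v u (x + s' *\<^sub>R v + t' *\<^sub>R u)"
      using 1(5) 2(5) by (simp add: algebra_simps)
    then have "dd u v (x + s *\<^sub>R u + t *\<^sub>R v) = dd v u (x + s' *\<^sub>R v + t' *\<^sub>R u)"
      using h(1) by simp
    moreover have "\<bar>dd u v (x + s *\<^sub>R u + t *\<^sub>R v) - dd u v x\<bar> < e"
      using W1(4) h(2)[of s t] 1 by auto
    moreover have "\<bar>dd v u (x + s' *\<^sub>R v + t' *\<^sub>R u) - dd v u x\<bar> < e"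
      using W2(4) h'[of s' t'] 2 by auto
    ultimately show False unfolding e_def by argo
  qed
  then show ?thesis unfolding dd_def d_def .
qed

lemma mixed_derivatives:
  fixes f :: "'a::euclidean_space \<Rightarrow> complex"
  assumes f: "smooth_on f U" and U: "open U" "x \<in> U"
  shows "frechet_derivative (\<lambda>y. frechet_derivative f (at y) u) (at x) v =
    frechet_derivative (\<lambda>y. frechet_derivative f (at y) v) (at x) u"
proof -
  have part: "T (frechet_derivative (\<lambda>y. frechet_derivative f (at y) u) (at x) v) =
      T (frechet_derivative (\<lambda>y. frechet_derivative f (at y) v) (at x) u)"
    if T: "bounded_linear T" for T :: "complex \<Rightarrow> real"
  proof -
    have der: "frechet_derivative (\<lambda>x. T (g x)) (at y) w = T (frechet_derivative g (at y) w)"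
      if "g differentiable at y" for g :: "'a \<Rightarrow> complex" and y w
      using frechet_derivative_eq[OF bounded_linear.has_derivative[OF T has_derivative_frechet[OF that]]]
      by simp
    have second: "frechet_derivative (\<lambda>y. frechet_derivative (\<lambda>x. T (f x)) (at y) u) (at x) v =
        T (frechet_derivative (\<lambda>y. frechet_derivative f (at y) u) (at x) v)" for u v
    proof -
      have "\<forall>\<^sub>F y in nhds x. frechet_derivative (\<lambda>x. T (f x)) (at y) u = T (frechet_derivative f (at y) u)"
        using eventually_nhds_in_open[OF U]
        by eventually_elim (rule der[OF smooth_on_differentiable[OF f]])
      from frechet_derivative_cong_nhds[OF this] show ?thesis
        using der[OF smooth_on_differentiable[OF smooth_on_deriv[OF f] U(2)]] by simp
    qed
    have "Ck_on 2 f U" using f unfolding smooth_on_def by blast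
    from mixed_derivatives_real[OF Ck_on_compose_linear[OF T U(1) this] U] show ?thesis
      unfolding second .
  qed
  show ?thesis
    by (rule complex_eqI) (rule part[OF bounded_linear_Re] part[OF bounded_linear_Im])+
qed

text \<open>
  The Leibniz rule for \<open>q \<mapsto> df\<^sub>q(w q)\<close>: one term differentiates \<open>f\<close> a second time with \<open>w\<close> frozen, the
  other one differentiates \<open>w\<close>. In a commutator the second order terms cancel by symmetry.
\<close>

lemma frechet_derivative_along_field:
  fixes f :: "'a::euclidean_space \<Rightarrow> complex" and w :: "'a \<Rightarrow> 'a"
  assumes f: "smooth_on f U" and U: "open U" "p \<in> U" and w: "w differentiable at p"
  shows "frechet_derivative (\<lambda>q. frechet_derivative f (at q) (w q)) (at p) h =
    frechet_derivative (\<lambda>q. frechet_derivative f (at q) (w p)) (at p) h +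
    frechet_derivative f (at p) (frechet_derivative w (at p) h)"
    and "(\<lambda>q. frechet_derivative f (at q) (w q)) differentiable at p"
proof -
  define D where "D b q = frechet_derivative f (at q) b" for b q
  have expand: "D v q = (\<Sum>b\<in>Basis. (v \<bullet> b) *\<^sub>R D b q)" if "q \<in> U" for v q
    unfolding D_def
    by (rule linear_eq_sum_Basis[OF linear_frechet_derivative[OF smooth_on_differentiable[OF f that]]])
  have dD: "(D b has_derivative frechet_derivative (D b) (at p)) (at p)" for b
    unfolding D_def
    by (intro has_derivative_frechet smooth_on_differentiable[OF smooth_on_deriv[OF f]] U)
  have dw: "((\<lambda>q. w q \<bullet> b) has_derivative (\<lambda>h. frechet_derivative w (at p) h \<bullet> b)) (at p)" for b
    by (intro bounded_linear.has_derivative[OF bounded_linear_inner_left] has_derivative_frechet w)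
  have ev: "\<forall>\<^sub>F q in nhds p. D (v q) q = (\<Sum>b\<in>Basis. (v q \<bullet> b) *\<^sub>R D b q)" for v
    using eventually_nhds_in_open[OF U] by eventually_elim (rule expand)
  have 1: "((\<lambda>q. \<Sum>b\<in>Basis. (w q \<bullet> b) *\<^sub>R D b q) has_derivative
      (\<lambda>h. \<Sum>b\<in>Basis. (w p \<bullet> b) *\<^sub>R frechet_derivative (D b) (at p) h +
        (frechet_derivative w (at p) h \<bullet> b) *\<^sub>R D b p)) (at p)"
    by (intro has_derivative_sum has_derivative_scaleR dD dw)
  have 2: "((\<lambda>q. \<Sum>b\<in>Basis. (w p \<bullet> b) *\<^sub>R D b q) has_derivative
      (\<lambda>h. \<Sum>b\<in>Basis. (w p \<bullet> b) *\<^sub>R frechet_derivative (D b) (at p) h)) (at p)"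
    by (intro has_derivative_sum bounded_linear.has_derivative[OF bounded_linear_scaleR_right] dD)
  have one': "((\<lambda>q. D (w q) q) has_derivative
      (\<lambda>h. \<Sum>b\<in>Basis. (w p \<bullet> b) *\<^sub>R frechet_derivative (D b) (at p) h +
        (frechet_derivative w (at p) h \<bullet> b) *\<^sub>R D b p)) (at p)"
    using has_derivative_cong_nhds[OF ev[of w]] 1 by blast
  have two': "((\<lambda>q. D (w p) q) has_derivative
      (\<lambda>h. \<Sum>b\<in>Basis. (w p \<bullet> b) *\<^sub>R frechet_derivative (D b) (at p) h)) (at p)"
    using has_derivative_cong_nhds[OF ev[of "\<lambda>_. w p"]] 2 by blast
  show "frechet_derivative (\<lambda>q. frechet_derivative f (at q) (w q)) (at p) h =
    frechet_derivative (\<lambda>q. frechet_derivative f (at q) (w p)) (at p) h +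
    frechet_derivative f (at p) (frechet_derivative w (at p) h)"
    using frechet_derivative_eq[OF one'] frechet_derivative_eq[OF two'] expand[OF U(2), of "frechet_derivative w (at p) h"]
    unfolding D_def by (simp add: sum.distrib)
  show "(\<lambda>q. frechet_derivative f (at q) (w q)) differentiable at p"
    using one' unfolding D_def differentiable_def by blast
qed

lemma derivative_real_bracket:
  fixes f :: "complex^'n \<Rightarrow> complex"
  assumes f: "smooth_on f U" and U: "open U" "p \<in> U"
    and u: "u differentiable at p" and w: "w differentiable at p"
  shows "frechet_derivative f (at p) (real_bracket u w p) =
    frechet_derivative (\<lambda>q. frechet_derivative f (at q) (w q)) (at p) (u p) -
    frechet_derivative (\<lambda>q. frechet_derivative f (at q) (u q)) (at p) (w p)"
  unfolding real_bracket_def frechet_derivative_along_field(1)[OF f U w] frechet_derivative_along_field(1)[OF f U u]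
    mixed_derivatives[OF f U, of "w p"]
  by (simp add: linear_diff[OF linear_frechet_derivative[OF smooth_on_differentiable[OF f U(2)]]])

text \<open>
  The action of the complexified vector field \<open>u + \<i> v\<close>, represented by the pair \<open>(u, v)\<close>, on
  complex-valued functions.
\<close>

definition field_deriv :: "'n::finite cfield \<Rightarrow> (complex^'n \<Rightarrow> complex) \<Rightarrow> complex^'n \<Rightarrow> complex"
  where "field_deriv X f p =
    frechet_derivative f (at p) (fst (X p)) + \<i> * frechet_derivative f (at p) (snd (X p))"

lemma smooth_near_fst: "smooth_near p X \<Longrightarrow> smooth_near p (\<lambda>q. fst (X q))"
  and smooth_near_snd: "smooth_near p X \<Longrightarrow> smooth_near p (\<lambda>q. snd (X q))"
  by (rule smooth_near_linear; simp add: bounded_linear_fst bounded_linear_snd)+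

lemma smooth_near_along_field:
  fixes f :: "'a::euclidean_space \<Rightarrow> 'b::real_normed_vector"
  assumes "smooth_near p f" "smooth_near p u"
  shows "smooth_near p (\<lambda>q. frechet_derivative f (at q) (u q))"
proof (rule smooth_near_cong)
  show "smooth_near p (\<lambda>q. \<Sum>b\<in>Basis. (u q \<bullet> b) *\<^sub>R frechet_derivative f (at q) b)"
    by (intro smooth_near_sum smooth_near_bilinear[OF bounded_bilinear_scaleR] smooth_near_deriv assms
        smooth_near_linear[OF bounded_linear_inner_left])
  show "\<forall>\<^sub>F q in nhds p. (\<Sum>b\<in>Basis. (u q \<bullet> b) *\<^sub>R frechet_derivative f (at q) b) =
      frechet_derivative f (at q) (u q)"
    using smooth_near_differentiable[OF assms(1)]
    by eventually_elim (rule linear_eq_sum_Basis[OF linear_frechet_derivative, symmetric])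
qed

lemma smooth_near_field_deriv:
  assumes "smooth_near p X" "smooth_near p f"
  shows "smooth_near p (field_deriv X f)"
  unfolding field_deriv_def[abs_def]
  by (intro smooth_near_add smooth_near_mult smooth_near_const smooth_near_along_field
      smooth_near_fst smooth_near_snd assms)

lemma smooth_near_lie_bracket:
  assumes "smooth_near p X" "smooth_near p Y"
  shows "smooth_near p (lie_bracket X Y)"
  unfolding lie_bracket_def[abs_def] real_bracket_def o_def
  by (intro smooth_near_Pair smooth_near_add smooth_near_diff smooth_near_along_field
      smooth_near_fst smooth_near_snd assms)

lemma field_deriv_cong:
  assumes "\<forall>\<^sub>F q in nhds p. f q = g q"
  shows "\<forall>\<^sub>F q in nhds p. field_deriv X f q = field_deriv X g q"
proof -
  have "\<forall>\<^sub>F q in nhds p. \<forall>\<^sub>F y in nhds q. f y = g y"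
    using assms by (simp add: eventually_eventually)
  then show ?thesis
    by eventually_elim (simp add: field_deriv_def frechet_derivative_cong_nhds)
qed

lemma field_deriv_add:
  assumes "f differentiable at p" "g differentiable at p"
  shows "field_deriv X (\<lambda>q. f q + g q) p = field_deriv X f p + field_deriv X g p"
  using frechet_derivative_eq[OF has_derivative_add[OF assms[THEN has_derivative_frechet]]]
  by (simp add: field_deriv_def algebra_simps)

lemma field_deriv_diff:
  assumes "f differentiable at p" "g differentiable at p"
  shows "field_deriv X (\<lambda>q. f q - g q) p = field_deriv X f p - field_deriv X g p"
  using frechet_derivative_eq[OF has_derivative_diff[OF assms[THEN has_derivative_frechet]]]
  by (simp add: field_deriv_def algebra_simps)

lemma field_deriv_mult:
  assumes "f differentiable at p" "g differentiable at p"
  shows "field_deriv X (\<lambda>q. f q * g q) p = field_deriv X f p * g p + f p * field_deriv X g p"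
  using frechet_derivative_eq[OF has_derivative_mult[OF assms[THEN has_derivative_frechet]]]
  by (simp add: field_deriv_def algebra_simps)

lemma field_deriv_const [simp]: "field_deriv X (\<lambda>q. c) p = 0"
  by (simp add: field_deriv_def frechet_derivative_const)

text \<open>
  Complex bilinearity reduces this to the four brackets of the real and imaginary parts of the fields.
\<close>

lemma field_deriv_lie_bracket:
  assumes X: "smooth_near p0 X" and Y: "smooth_near p0 Y" and f: "smooth_near p0 f"
  shows "\<forall>\<^sub>F p in nhds p0. field_deriv (lie_bracket X Y) f p =
    field_deriv X (field_deriv Y f) p - field_deriv Y (field_deriv X f) p"
proof -
  obtain U where U: "open U" "p0 \<in> U" "smooth_on f U"
    using f unfolding smooth_near_def by blast
  have "\<forall>\<^sub>F p in nhds p0. p \<in> U" by (rule eventually_nhds_in_open[OF U(1,2)])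
  with smooth_near_differentiable[OF smooth_near_fst[OF X]] smooth_near_differentiable[OF smooth_near_snd[OF X]]
    smooth_near_differentiable[OF smooth_near_fst[OF Y]] smooth_near_differentiable[OF smooth_near_snd[OF Y]]
  show ?thesis
  proof eventually_elim
    case (elim p)
    note U' = U(3,1) elim(5)
    let ?L = "\<lambda>u q. frechet_derivative f (at q) (u q)"
    note diff = frechet_derivative_along_field(2)[OF U']
    have lin: "linear (frechet_derivative f (at p))"
      by (rule linear_frechet_derivative[OF smooth_on_differentiable[OF U'(1,3)]])
    have D: "frechet_derivative (\<lambda>q. ?L u q + \<i> * ?L v q) (at p) h =
        frechet_derivative (?L u) (at p) h + \<i> * frechet_derivative (?L v) (at p) h"
      if "u differentiable at p" "v differentiable at p" for u v h
      using frechet_derivative_eq[OF has_derivative_add[OF has_derivative_frechet[OF diff[OF that(1)]]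
          has_derivative_mult_right[OF has_derivative_frechet[OF diff[OF that(2)]], of \<i>]]]
      by simp
    note br = derivative_real_bracket[OF U']
    have XX: "field_deriv X f = (\<lambda>q. ?L (\<lambda>q. fst (X q)) q + \<i> * ?L (\<lambda>q. snd (X q)) q)"
      "field_deriv Y f = (\<lambda>q. ?L (\<lambda>q. fst (Y q)) q + \<i> * ?L (\<lambda>q. snd (Y q)) q)"
      by (simp_all add: fun_eq_iff field_deriv_def)
    have 1: "field_deriv X (field_deriv Y f) p =
      frechet_derivative (field_deriv Y f) (at p) (fst (X p)) + \<i> * frechet_derivative (field_deriv Y f) (at p) (snd (X p))"
      "field_deriv Y (field_deriv X f) p =
      frechet_derivative (field_deriv X f) (at p) (fst (Y p)) + \<i> * frechet_derivative (field_deriv X f) (at p) (snd (Y p))"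
      by (simp_all add: field_deriv_def)
    have 2: "field_deriv (lie_bracket X Y) f p =
      frechet_derivative f (at p) (real_bracket (\<lambda>q. fst (X q)) (\<lambda>q. fst (Y q)) p) -
      frechet_derivative f (at p) (real_bracket (\<lambda>q. snd (X q)) (\<lambda>q. snd (Y q)) p) +
      \<i> * (frechet_derivative f (at p) (real_bracket (\<lambda>q. fst (X q)) (\<lambda>q. snd (Y q)) p) +
      frechet_derivative f (at p) (real_bracket (\<lambda>q. snd (X q)) (\<lambda>q. fst (Y q)) p))"
      by (simp add: field_deriv_def lie_bracket_def o_def linear_diff[OF lin] linear_add[OF lin])
    show ?case
      unfolding 1 2
      unfolding XX D[OF elim(1,2)] D[OF elim(3,4)]
        br[OF elim(1,3)] br[OF elim(1,4)] br[OF elim(2,3)] br[OF elim(2,4)]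
      by (simp add: algebra_simps)
  qed
qed

lemma field_deriv_compose:
  fixes h :: "complex^'n \<Rightarrow> 'b::euclidean_space"
  assumes h: "h differentiable at p" and f: "f differentiable at (h p)"
  shows "field_deriv X (\<lambda>q. f (h q)) p =
    (\<Sum>b\<in>Basis. frechet_derivative f (at (h p)) b * field_deriv X (\<lambda>q. of_real (h q \<bullet> b)) p)"
proof -
  have c: "frechet_derivative (\<lambda>q. complex_of_real (h q \<bullet> b)) (at p) v =
      of_real (frechet_derivative h (at p) v \<bullet> b)" for b v
  proof -
    have "bounded_linear (\<lambda>x::'b. complex_of_real (x \<bullet> b))"
      by (intro bounded_linear_compose[OF bounded_linear_of_real bounded_linear_inner_left])
    from frechet_derivative_eq[OF bounded_linear.has_derivative[OF this has_derivative_frechet[OF h]]]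
    show ?thesis by simp
  qed
  show ?thesis
    unfolding field_deriv_def c frechet_derivative_chain[OF h f]
      linear_eq_sum_Basis[OF linear_frechet_derivative[OF f], of "frechet_derivative h _ _"]
    by (simp add: sum_distrib_left sum.distrib[symmetric] scaleR_conv_of_real algebra_simps)
qed

lemma smooth_near_coordinate:
  fixes h :: "complex^'n \<Rightarrow> 'b::euclidean_space"
  shows "smooth_near 0 h \<Longrightarrow> smooth_near 0 (\<lambda>q. complex_of_real (h q \<bullet> b))"
  by (intro smooth_near_linear[OF bounded_linear_of_real] smooth_near_linear[OF bounded_linear_inner_left])

lemma eventually_differentiable_at_image:
  fixes h :: "complex^'n \<Rightarrow> 'b::euclidean_space"
  assumes "smooth_near 0 h" "smooth_near (h 0) f"
  shows "\<forall>\<^sub>F p in nhds 0. f differentiable at (h p)"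
  using smooth_near_tendsto[OF assms(1)] smooth_near_differentiable[OF assms(2)]
  unfolding filterlim_iff by blast

section \<open>Order of vanishing along a family of vector fields\<close>

text \<open>
  Vanishing at \<open>0\<close> of all derivatives along words of at most \<open>k\<close> fields, the empty word included. The
  recursion strips off the field applied first, so that a field lowers the order by at most one.
\<close>

primrec vanish_order :: "'n::finite cfield set \<Rightarrow> nat \<Rightarrow> (complex^'n \<Rightarrow> complex) set"
  where
    "vanish_order G 0 = {f. smooth_near 0 f \<and> f 0 = 0}"
  | "vanish_order G (Suc k) = {f \<in> vanish_order G k. \<forall>X\<in>G. field_deriv X f \<in> vanish_order G k}"

lemma vanish_order_smooth: "f \<in> vanish_order G k \<Longrightarrow> smooth_near 0 f"
  by (induction k) auto

lemma vanish_order_zero: "f \<in> vanish_order G k \<Longrightarrow> f 0 = 0"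
  by (induction k) auto

lemma vanish_order_cong:
  assumes "f \<in> vanish_order G k" "\<forall>\<^sub>F p in nhds 0. f p = g p"
  shows "g \<in> vanish_order G k"
  using assms
proof (induction k arbitrary: f g)
  case 0
  then show ?case using smooth_near_cong eventually_nhds_x_imp_x[of _ "0 :: complex^'n"] by fastforce
next
  case (Suc k)
  have "field_deriv X g \<in> vanish_order G k" if "X \<in> G" for X
    using Suc.IH[of "field_deriv X f"] field_deriv_cong[OF Suc.prems(2)] Suc.prems(1) that by auto
  then show ?case using Suc.IH[of f g] Suc.prems by auto
qed

locale smooth_fields =
  fixes G :: "'n::finite cfield set"
  assumes smooth_field: "X \<in> G \<Longrightarrow> smooth_near 0 X"
begin

lemma vanish_order_add:
  "f \<in> vanish_order G k \<Longrightarrow> g \<in> vanish_order G k \<Longrightarrow> (\<lambda>p. f p + g p) \<in> vanish_order G k"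
proof (induction k arbitrary: f g)
  case 0
  then show ?case by (auto intro: smooth_near_add)
next
  case (Suc k)
  have "field_deriv X (\<lambda>p. f p + g p) \<in> vanish_order G k" if "X \<in> G" for X
  proof (rule vanish_order_cong)
    show "(\<lambda>p. field_deriv X f p + field_deriv X g p) \<in> vanish_order G k"
      using Suc.prems that by (intro Suc.IH) auto
    show "\<forall>\<^sub>F p in nhds 0. field_deriv X f p + field_deriv X g p = field_deriv X (\<lambda>p. f p + g p) p"
      using Suc.prems[THEN vanish_order_smooth, THEN smooth_near_differentiable]
      by eventually_elim (simp add: field_deriv_add)
  qed
  then show ?case using Suc by auto
qed

lemma vanish_order_mult:
  "smooth_near 0 a \<Longrightarrow> f \<in> vanish_order G k \<Longrightarrow> (\<lambda>p. a p * f p) \<in> vanish_order G k"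
proof (induction k arbitrary: a f)
  case 0
  then show ?case by (auto intro: smooth_near_mult)
next
  case (Suc k)
  have "field_deriv X (\<lambda>p. a p * f p) \<in> vanish_order G k" if "X \<in> G" for X
  proof (rule vanish_order_cong)
    show "(\<lambda>p. field_deriv X a p * f p + a p * field_deriv X f p) \<in> vanish_order G k"
      using Suc.prems that smooth_field
      by (intro vanish_order_add Suc.IH smooth_near_field_deriv) auto
    show "\<forall>\<^sub>F p in nhds 0. field_deriv X a p * f p + a p * field_deriv X f p = field_deriv X (\<lambda>p. a p * f p) p"
      using Suc.prems(1)[THEN smooth_near_differentiable]
        Suc.prems(2)[THEN vanish_order_smooth, THEN smooth_near_differentiable]
      by eventually_elim (simp add: field_deriv_mult)
  qed
  then show ?case using Suc by auto
qed

lemma vanish_order_sum: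
  assumes "\<And>i. i \<in> I \<Longrightarrow> f i \<in> vanish_order G k"
  shows "(\<lambda>p. \<Sum>i\<in>I. f i p) \<in> vanish_order G k"
proof -
  have zero: "(\<lambda>p. 0) \<in> vanish_order G k" for k
    by (induction k) (auto simp: field_deriv_const[abs_def])
  show ?thesis using assms
    by (induction I rule: infinite_finite_induct) (auto intro: zero vanish_order_add)
qed

lemma vanish_order_diff:
  assumes "f \<in> vanish_order G k" "g \<in> vanish_order G k"
  shows "(\<lambda>p. f p - g p) \<in> vanish_order G k"
  using vanish_order_add[OF assms(1) vanish_order_mult[OF smooth_near_const assms(2), of "-1"]] by simp

text \<open>
  In each derivative of the product along a word of length \<open>k + 1\<close>, either a factor \<open>a\<close> is left
  undifferentiated, or at most \<open>k\<close> fields fall on \<open>f\<close>.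
\<close>

lemma vanish_order_mult_Suc:
  "smooth_near 0 a \<Longrightarrow> a 0 = 0 \<Longrightarrow> f \<in> vanish_order G k \<Longrightarrow> (\<lambda>p. a p * f p) \<in> vanish_order G (Suc k)"
proof (induction k arbitrary: f)
  case 0
  have "field_deriv X (\<lambda>p. a p * f p) \<in> vanish_order G 0" if "X \<in> G" for X
  proof -
    have "field_deriv X (\<lambda>p. a p * f p) 0 = field_deriv X a 0 * f 0 + a 0 * field_deriv X f 0"
      using 0 smooth_near_self by (intro field_deriv_mult) auto
    then show ?thesis using 0 that smooth_field
      by (auto intro!: smooth_near_field_deriv smooth_near_mult)
  qed
  moreover have "(\<lambda>p. a p * f p) \<in> vanish_order G 0"
    using 0 by (auto intro: smooth_near_mult)
  ultimately show ?case by simp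
next
  case (Suc k)
  have "field_deriv X (\<lambda>p. a p * f p) \<in> vanish_order G (Suc k)" if "X \<in> G" for X
  proof (rule vanish_order_cong)
    have "(\<lambda>p. field_deriv X a p * f p) \<in> vanish_order G (Suc k)"
      using Suc.prems that smooth_field by (intro vanish_order_mult smooth_near_field_deriv) auto
    moreover have "(\<lambda>p. a p * field_deriv X f p) \<in> vanish_order G (Suc k)"
      using Suc.prems that by (intro Suc.IH) auto
    ultimately show "(\<lambda>p. field_deriv X a p * f p + a p * field_deriv X f p) \<in> vanish_order G (Suc k)"
      by (rule vanish_order_add)
    show "\<forall>\<^sub>F p in nhds 0. field_deriv X a p * f p + a p * field_deriv X f p = field_deriv X (\<lambda>p. a p * f p) p"
      using Suc.prems(1)[THEN smooth_near_differentiable]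
        Suc.prems(3)[THEN vanish_order_smooth, THEN smooth_near_differentiable]
      by eventually_elim (simp add: field_deriv_mult)
  qed
  moreover have "(\<lambda>p. a p * f p) \<in> vanish_order G (Suc k)"
    using Suc.prems by (intro vanish_order_mult)
  ultimately show ?case by simp
qed

text \<open>
  Division by a matrix that is the identity at \<open>0\<close>, without inverting it: in
  \<open>g = E g - (E - 1) g\<close> the entries of \<open>E - 1\<close> vanish at \<open>0\<close>, so the last term gains one order over \<open>g\<close>.
\<close>

lemma vanish_order_matrix:
  fixes g :: "'m::finite \<Rightarrow> complex^'n \<Rightarrow> complex"
  assumes E: "\<And>i j. smooth_near 0 (E i j)" "\<And>i j. E i j 0 = (if i = j then 1 else 0)"
    and g: "\<And>i. smooth_near 0 (g i)"
  shows "(\<And>i. (\<lambda>p. \<Sum>j\<in>UNIV. E i j p * g j p) \<in> vanish_order G k) \<Longrightarrow> g i \<in> vanish_order G k"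
proof (induction k arbitrary: i)
  case 0
  have "(\<Sum>j\<in>UNIV. E i j 0 * g j 0) = 0" for i using 0[of i] by simp
  then have "g i 0 = 0" for i by (simp add: E(2) if_distrib[of "\<lambda>c. c * _"] cong: if_cong)
  then show ?case using g by simp
next
  case (Suc k)
  have IH: "g i \<in> vanish_order G k" for i
    by (rule Suc.IH) (use Suc.prems in simp)
  have "(\<lambda>p. (E i j p - (if i = j then 1 else 0)) * g j p) \<in> vanish_order G (Suc k)" for j
    using E IH by (intro vanish_order_mult_Suc smooth_near_diff) auto
  then have "(\<lambda>p. (\<Sum>j\<in>UNIV. E i j p * g j p) - (\<Sum>j\<in>UNIV. (E i j p - (if i = j then 1 else 0)) * g j p))
      \<in> vanish_order G (Suc k)"
    by (intro vanish_order_diff vanish_order_sum Suc.prems)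
  moreover have "(\<Sum>j\<in>UNIV. E i j p * g j p) - (\<Sum>j\<in>UNIV. (E i j p - (if i = j then 1 else 0)) * g j p) = g i p" for p
    by (simp add: sum_subtractf[symmetric] left_diff_distrib if_distrib[of "\<lambda>c. c * _"] cong: if_cong)
  ultimately show ?case by simp
qed

text \<open>
  If two maps agree to order \<open>k\<close>, so do their compositions with a smooth \<open>f\<close>. By the chain rule a
  derivative of the difference splits into derivatives of \<open>h1 - h2\<close>, and differences of the same kind
  with \<open>f\<close> replaced by a partial derivative; this is why \<open>f\<close> is arbitrary in the induction.
\<close>

lemma vanish_order_compose_diff:
  fixes h1 h2 :: "complex^'n \<Rightarrow> 'b::euclidean_space"
  assumes h: "smooth_near 0 h1" "smooth_near 0 h2" "h1 0 = x0" "h2 0 = x0"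
  shows "smooth_near x0 f \<Longrightarrow>
    (\<And>b. b \<in> Basis \<Longrightarrow> (\<lambda>p. of_real (h1 p \<bullet> b) - of_real (h2 p \<bullet> b)) \<in> vanish_order G k) \<Longrightarrow>
    (\<lambda>p. f (h1 p) - f (h2 p)) \<in> vanish_order G k"
proof (induction k arbitrary: f)
  case 0
  then show ?case
    using h smooth_near_compose[of 0 h1 f] smooth_near_compose[of 0 h2 f]
    by (simp add: smooth_near_diff)
next
  case (Suc k)
  let ?c = "\<lambda>h b q. complex_of_real (h q \<bullet> b)"
  let ?df = "\<lambda>h b q. frechet_derivative f (at (h q)) b"
  have f: "smooth_near (h1 0) f" "smooth_near (h2 0) f" using Suc.prems h by auto
  have sm: "smooth_near 0 (\<lambda>q. f (h1 q))" "smooth_near 0 (\<lambda>q. f (h2 q))"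
    by (rule smooth_near_compose[OF h(1) f(1)], rule smooth_near_compose[OF h(2) f(2)])
  have IH: "(\<lambda>p. f (h1 p) - f (h2 p)) \<in> vanish_order G k" if "smooth_near x0 f" for f
    using Suc.IH[OF that] Suc.prems(2) by simp
  have "field_deriv X (\<lambda>p. f (h1 p) - f (h2 p)) \<in> vanish_order G k" if X: "X \<in> G" for X
  proof (rule vanish_order_cong)
    show "(\<lambda>p. \<Sum>b\<in>Basis. ?df h1 b p * field_deriv X (\<lambda>q. ?c h1 b q - ?c h2 b q) p +
        field_deriv X (?c h2 b) p * (?df h1 b p - ?df h2 b p)) \<in> vanish_order G k"
    proof (intro vanish_order_sum vanish_order_add vanish_order_mult)
      fix b :: 'b assume b: "b \<in> Basis"
      show "smooth_near 0 (?df h1 b)"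
        using smooth_near_compose[OF h(1), of "\<lambda>x. frechet_derivative f (at x) b"] smooth_near_deriv[OF f(1)] by simp
      show "field_deriv X (\<lambda>q. ?c h1 b q - ?c h2 b q) \<in> vanish_order G k"
        using Suc.prems(2)[OF b] X by simp
      show "smooth_near 0 (field_deriv X (?c h2 b))"
        by (intro smooth_near_field_deriv smooth_field X smooth_near_coordinate h)
      show "(\<lambda>p. ?df h1 b p - ?df h2 b p) \<in> vanish_order G k"
        by (rule IH[OF smooth_near_deriv[OF Suc.prems(1)]])
    qed
    show "\<forall>\<^sub>F p in nhds 0. (\<Sum>b\<in>Basis. ?df h1 b p * field_deriv X (\<lambda>q. ?c h1 b q - ?c h2 b q) p +
        field_deriv X (?c h2 b) p * (?df h1 b p - ?df h2 b p)) = field_deriv X (\<lambda>p. f (h1 p) - f (h2 p)) p"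
      using smooth_near_differentiable[OF h(1)] smooth_near_differentiable[OF h(2)]
        eventually_differentiable_at_image[OF h(1) f(1)] eventually_differentiable_at_image[OF h(2) f(2)]
        smooth_near_differentiable[OF sm(1)] smooth_near_differentiable[OF sm(2)]
    proof eventually_elim
      case (elim p)
      have cd: "?c h1 b differentiable at p" "?c h2 b differentiable at p" for b
        using elim(1,2) bounded_linear_compose[OF bounded_linear_of_real bounded_linear_inner_left[of b]]
        by (auto simp: differentiable_def dest: bounded_linear.has_derivative)
      show ?case
        unfolding field_deriv_diff[OF elim(5,6)] field_deriv_diff[OF cd]
          field_deriv_compose[OF elim(1,3)] field_deriv_compose[OF elim(2,4)] sum_subtractf[symmetric]
        by (intro sum.cong) (auto simp: algebra_simps)
    qed
  qed
  moreover have "(\<lambda>p. f (h1 p) - f (h2 p)) \<in> vanish_order G k" by (rule IH[OF Suc.prems(1)])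
  ultimately show ?case by simp
qed

definition vanish_infinite :: "(complex^'n \<Rightarrow> complex) set"
  where "vanish_infinite = (\<Inter>k. vanish_order G k)"

text \<open>
  For a single order of vanishing this fails, as each field costs one order. With all orders at once
  the set is stable under \<open>X\<close> and \<open>Y\<close>, hence under \<open>X Y - Y X\<close>.
\<close>

lemma lie_generated_vanish_infinite:
  assumes "W \<in> lie_generated G"
  shows "smooth_near 0 W \<and> (\<forall>f\<in>vanish_infinite. field_deriv W f \<in> vanish_infinite)"
  using assms
proof induction
  case (gen X)
  have "field_deriv X f \<in> vanish_order G k" if "f \<in> vanish_infinite" for f k
  proof -
    have "f \<in> vanish_order G (Suc k)" using that unfolding vanish_infinite_def by blast
    then show ?thesis using gen by simp
  qed
  then show ?case using smooth_field[OF gen] unfolding vanish_infinite_def by blast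
next
  case (add X Y)
  have "field_deriv (\<lambda>q. X q + Y q) f \<in> vanish_infinite" if f: "f \<in> vanish_infinite" for f
    unfolding vanish_infinite_def
  proof
    fix k
    have "\<forall>\<^sub>F p in nhds 0. field_deriv X f p + field_deriv Y f p = field_deriv (\<lambda>q. X q + Y q) f p"
    proof -
      have "smooth_near 0 f" using f vanish_order_smooth unfolding vanish_infinite_def by blast
      from smooth_near_differentiable[OF this] show ?thesis
        by eventually_elim (simp add: field_deriv_def linear_add[OF linear_frechet_derivative] algebra_simps)
    qed
    moreover have "(\<lambda>p. field_deriv X f p + field_deriv Y f p) \<in> vanish_order G k"
      using add f unfolding vanish_infinite_def by (intro vanish_order_add) auto
    ultimately show "field_deriv (\<lambda>q. X q + Y q) f \<in> vanish_order G k"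
      using vanish_order_cong by blast
  qed
  then show ?case using add by (auto intro: smooth_near_add)
next
  case (scale X c)
  have "field_deriv (\<lambda>q. cscale c (X q)) f \<in> vanish_infinite" if f: "f \<in> vanish_infinite" for f
    unfolding vanish_infinite_def
  proof
    fix k
    have "\<forall>\<^sub>F p in nhds 0. c * field_deriv X f p = field_deriv (\<lambda>q. cscale c (X q)) f p"
    proof -
      have "smooth_near 0 f" using f vanish_order_smooth unfolding vanish_infinite_def by blast
      from smooth_near_differentiable[OF this] show ?thesis
      proof eventually_elim
        case (elim p)
        show ?case
          unfolding field_deriv_def cscale_def fst_conv snd_conv linear_add[OF linear_frechet_derivative[OF elim]]
            linear_diff[OF linear_frechet_derivative[OF elim]] linear_scale[OF linear_frechet_derivative[OF elim]]
          by (simp add: complex_eq_iff algebra_simps)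
      qed
    qed
    moreover have "(\<lambda>p. c * field_deriv X f p) \<in> vanish_order G k"
      using scale f unfolding vanish_infinite_def by (intro vanish_order_mult) auto
    ultimately show "field_deriv (\<lambda>q. cscale c (X q)) f \<in> vanish_order G k"
      using vanish_order_cong by blast
  qed
  moreover have "smooth_near 0 (\<lambda>q. cscale c (X q))"
    unfolding cscale_def using scale
    by (intro smooth_near_Pair smooth_near_add smooth_near_diff smooth_near_linear[OF bounded_linear_scaleR_right]
        smooth_near_fst smooth_near_snd) auto
  ultimately show ?case by blast
next
  case (bracket X Y)
  have "field_deriv (lie_bracket X Y) f \<in> vanish_infinite" if f: "f \<in> vanish_infinite" for f
    unfolding vanish_infinite_def
  proof
    fix k
    have "smooth_near 0 f" using f vanish_order_smooth unfolding vanish_infinite_def by blast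
    with bracket have ev: "\<forall>\<^sub>F p in nhds 0. field_deriv X (field_deriv Y f) p - field_deriv Y (field_deriv X f) p =
        field_deriv (lie_bracket X Y) f p"
      using field_deriv_lie_bracket[of 0 X Y f] by (simp add: eq_commute)
    have "(\<lambda>p. field_deriv X (field_deriv Y f) p - field_deriv Y (field_deriv X f) p) \<in> vanish_order G k"
      using bracket f unfolding vanish_infinite_def by (intro vanish_order_diff) auto
    then show "field_deriv (lie_bracket X Y) f \<in> vanish_order G k"
      using vanish_order_cong ev by blast
  qed
  then show ?case using bracket by (auto intro: smooth_near_lie_bracket)
qed

end

section \<open>CR fields on a generic submanifold\<close>

abbreviation pair_scale :: "complex \<Rightarrow> (complex^'n) \<times> (complex^'n) \<Rightarrow> (complex^'n) \<times> (complex^'n)"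
  where "pair_scale \<equiv> \<lambda>c (Z, \<zeta>). (c *s Z, c *s \<zeta>)"

lemma complex_scaling_vec: "complex_scaling ((*s) :: complex \<Rightarrow> complex^'n \<Rightarrow> complex^'n)"
proof -
  have "bilinear ((*s) :: complex \<Rightarrow> complex^'n \<Rightarrow> complex^'n)"
    unfolding bilinear_def by (auto intro!: linearI simp: vec_eq_iff algebra_simps)
  then show ?thesis unfolding complex_scaling_def
    by (simp add: bilinear_conv_bounded_bilinear vec_eq_iff) (simp add: scaleR_conv_of_real)
qed

lemma complex_scaling_pair: "complex_scaling (pair_scale :: _ \<Rightarrow> (complex^'n) \<times> (complex^'n) \<Rightarrow> _)"
proof -
  have "bilinear (pair_scale :: _ \<Rightarrow> (complex^'n) \<times> (complex^'n) \<Rightarrow> _)"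
    unfolding bilinear_def by (auto intro!: linearI simp: vec_eq_iff algebra_simps)
  then show ?thesis unfolding complex_scaling_def
    by (simp add: bilinear_conv_bounded_bilinear vec_eq_iff) (simp add: scaleR_conv_of_real)
qed

lemma eventually_complex_diff_smooth:
  fixes f :: "'a::euclidean_space \<Rightarrow> complex"
  assumes "complex_scaling sc" "\<forall>\<^sub>F x in nhds p. complex_diff_at sc f x"
  shows "smooth_near p f"
proof -
  obtain U where U: "open U" "p \<in> U" "\<And>x. x \<in> U \<Longrightarrow> complex_diff_at sc f x"
    using assms(2) unfolding eventually_nhds by blast
  show ?thesis
    using U complex_diff_smooth_on[OF assms(1) U(1,3)] by (intro smooth_nearI)
qed

lemma hol_near_smooth: "hol_near p f \<Longrightarrow> smooth_near p f"
  unfolding hol_near_def by (rule eventually_complex_diff_smooth[OF complex_scaling_vec])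

lemma hol_near2_smooth: "hol_near2 p f \<Longrightarrow> smooth_near p f"
  unfolding hol_near2_def by (rule eventually_complex_diff_smooth[OF complex_scaling_pair])

lemma bounded_linear_vcnj: "bounded_linear vcnj"
  unfolding linear_conv_bounded_linear[symmetric]
  by (rule linearI) (simp_all add: vcnj_def vec_eq_iff)

lemma vcnj_vcnj [simp]: "vcnj (vcnj Z) = Z"
  by (simp add: vcnj_def vec_eq_iff)

lemma vcnj_scale: "vcnj (c *s Z) = cnj c *s vcnj Z"
  by (simp add: vcnj_def vec_eq_iff)

lemma vcnj_zero [simp]: "vcnj 0 = 0"
  by (simp add: vcnj_def vec_eq_iff)

lemma vcnj_nth [simp]: "vcnj Z $ k = cnj (Z $ k)"
  by (simp add: vcnj_def)

lemma bounded_linear_graph_vcnj: "bounded_linear (\<lambda>Z. (Z, vcnj Z))"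
  by (intro bounded_linear_Pair bounded_linear_ident bounded_linear_vcnj)

lemma filterlim_graph_vcnj: "filterlim (\<lambda>Z. (Z, vcnj Z)) (nhds (0, 0)) (nhds 0)"
  using smooth_near_tendsto[OF smooth_near_bounded_linear[OF bounded_linear_graph_vcnj], of 0] by simp

definition real_defining ::
  "(nat \<Rightarrow> (complex^'n) \<times> (complex^'n) \<Rightarrow> complex) \<Rightarrow> nat \<Rightarrow> complex^'n \<Rightarrow> complex"
  where "real_defining \<rho> j Z = \<rho> j (Z, vcnj Z)"

lemma partial_Z_eq:
  assumes "r differentiable at (Z, \<zeta>)"
  shows "partial_Z r (Z, \<zeta>) u = frechet_derivative r (at (Z, \<zeta>)) (u, 0)"
proof -
  have "((\<lambda>W. (W, \<zeta>)) has_derivative (\<lambda>h. (h, 0))) (at Z)"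
    by (auto intro!: derivative_eq_intros)
  from has_derivative_compose[OF this has_derivative_frechet[OF assms]]
  show ?thesis unfolding partial_Z_def by (simp add: frechet_derivative_eq)
qed

lemma partial_Z_linear:
  assumes "complex_diff_at pair_scale r (Z, \<zeta>)"
  shows "linear (partial_Z r (Z, \<zeta>))" "partial_Z r (Z, \<zeta>) (c *s u) = c * partial_Z r (Z, \<zeta>) u"
proof -
  have e: "partial_Z r (Z, \<zeta>) = (\<lambda>u. frechet_derivative r (at (Z, \<zeta>)) (u, 0))"
    using partial_Z_eq[OF complex_diff_atD(1)[OF assms]] by blast
  have "linear (\<lambda>u. frechet_derivative r (at (Z, \<zeta>)) (u, 0))"
    using linear_compose[OF _ linear_frechet_derivative[OF complex_diff_atD(1)[OF assms]], of "\<lambda>u. (u, 0)"]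
    by (simp add: o_def linear_iff)
  then show "linear (partial_Z r (Z, \<zeta>))" unfolding e .
  show "partial_Z r (Z, \<zeta>) (c *s u) = c * partial_Z r (Z, \<zeta>) u"
    unfolding e using complex_diff_atD(2)[OF assms, of c "(u, 0)"] by simp
qed

text \<open>
  A real-valued real-linear form is twice the real part of its complex linear part, and the complex
  linear part of the differential of \<open>Z \<mapsto> \<rho> j (Z, vcnj Z)\<close> is \<open>\<partial>\<^sub>Z\<rho> j\<close>.
\<close>

lemma frechet_derivative_real_defining:
  assumes cd: "complex_diff_at pair_scale (\<rho> j) (q, vcnj q)"
    and real: "\<forall>\<^sub>F Z in nhds q. real_defining \<rho> j Z = cnj (real_defining \<rho> j Z)"
  shows "frechet_derivative (real_defining \<rho> j) (at q) u = of_real (2 * Re (partial_Z (\<rho> j) (q, vcnj q) u))"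
proof -
  define D where "D = frechet_derivative (\<rho> j) (at (q, vcnj q))"
  have lin: "linear D" unfolding D_def by (rule linear_frechet_derivative[OF complex_diff_atD(1)[OF cd]])
  have "((\<lambda>Z. (Z, vcnj Z)) has_derivative (\<lambda>u. (u, vcnj u))) (at q)"
    by (rule bounded_linear_imp_has_derivative[OF bounded_linear_graph_vcnj])
  from has_derivative_compose[OF this has_derivative_frechet[OF complex_diff_atD(1)[OF cd]]]
  have der: "(real_defining \<rho> j has_derivative (\<lambda>u. D (u, vcnj u))) (at q)"
    unfolding D_def real_defining_def[abs_def] .
  have eq: "frechet_derivative (real_defining \<rho> j) (at q) u = D (u, vcnj u)" for u
    by (simp add: frechet_derivative_eq[OF der])
  have split: "D (u, vcnj u) = D (u, 0) + D (0, vcnj u)" for u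
    using linear_add[OF lin, of "(u, 0)" "(0, vcnj u)"] by simp
  have "((\<lambda>Z. cnj (real_defining \<rho> j Z)) has_derivative (\<lambda>u. cnj (D (u, vcnj u)))) (at q)"
    by (rule bounded_linear.has_derivative[OF bounded_linear_cnj der])
  then have "(real_defining \<rho> j has_derivative (\<lambda>u. cnj (D (u, vcnj u)))) (at q)"
    using has_derivative_cong_nhds[OF real] by blast
  from has_derivative_unique[OF der this] have re: "D (u, vcnj u) = cnj (D (u, vcnj u))" for u
    by metis
  have "D (\<i> *s u, 0) = \<i> * D (u, 0)" "D (0, vcnj (\<i> *s u)) = - \<i> * D (0, vcnj u)"
    using complex_diff_atD(2)[OF cd, of \<i> "(u, 0)"] complex_diff_atD(2)[OF cd, of "-\<i>" "(0, vcnj u)"]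
    unfolding D_def by (simp_all add: vcnj_scale)
  then have "D (\<i> *s u, vcnj (\<i> *s u)) = \<i> * D (u, 0) - \<i> * D (0, vcnj u)"
    unfolding split by simp
  then show ?thesis
    using re[of u] re[of "\<i> *s u"] unfolding eq split partial_Z_eq[OF complex_diff_atD(1)[OF cd]] D_def[symmetric]
    by (simp add: complex_eq_iff)
qed

locale generic_mfd =
  fixes d :: nat and \<rho> :: "nat \<Rightarrow> (complex^'n) \<times> (complex^'n) \<Rightarrow> complex" and M :: "(complex^'n) set"
  assumes generic: "generic_submanifold d \<rho> M"
begin

text \<open>
  The conditions on \<open>M\<close> and its defining functions, as conditions on the germs at a point \<open>q\<close>. They
  hold at all \<open>q\<close> close to \<open>0\<close>, which is needed since tangency is used along \<open>M\<close> and not only at \<open>0\<close>.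
\<close>

definition regular_point :: "complex^'n \<Rightarrow> bool"
  where "regular_point q \<longleftrightarrow>
    (\<forall>j<d. complex_diff_at pair_scale (\<rho> j) (q, vcnj q)) \<and>
    (\<forall>j<d. \<forall>\<^sub>F Z in nhds q. real_defining \<rho> j Z = cnj (real_defining \<rho> j Z)) \<and>
    wedge d (\<lambda>j. partial_Z (\<rho> j) (q, vcnj q)) \<noteq> (\<lambda>v. 0) \<and>
    (\<forall>\<^sub>F Z in nhds q. Z \<in> M \<longleftrightarrow> (\<forall>j<d. real_defining \<rho> j Z = 0)) \<and>
    (\<forall>j<d. smooth_near q (real_defining \<rho> j))"

lemma real_defining_smooth: "j < d \<Longrightarrow> smooth_near 0 (real_defining \<rho> j)"
  using generic smooth_near_compose[OF smooth_near_bounded_linear[OF bounded_linear_graph_vcnj], of 0 "\<rho> j"]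
  unfolding generic_submanifold_def real_defining_def[abs_def] by (simp add: hol_near2_smooth)

lemma eventually_regular_point: "\<forall>\<^sub>F q in nhds 0. regular_point q"
proof -
  have *: "\<forall>\<^sub>F q in nhds 0. P (q, vcnj q)" if "eventually P (nhds (0, 0))" for P :: "(complex^'n) \<times> (complex^'n) \<Rightarrow> bool"
    using filterlim_graph_vcnj that unfolding filterlim_iff by blast
  have 1: "\<forall>\<^sub>F q in nhds 0. \<forall>j\<in>{..<d}. complex_diff_at pair_scale (\<rho> j) (q, vcnj q)"
    using generic by (intro eventually_ball_finite) (auto simp: generic_submanifold_def hol_near2_def intro: *)
  have "\<forall>\<^sub>F q in nhds 0. real_defining \<rho> j q = cnj (real_defining \<rho> j q)" if "j < d" for j
  proof -
    have "\<forall>\<^sub>F (Z, \<zeta>) in nhds (0, 0). \<rho> j (Z, \<zeta>) = cnj (\<rho> j (vcnj \<zeta>, vcnj Z))"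
      using generic that unfolding generic_submanifold_def by blast
    from *[OF this] show ?thesis by (simp add: real_defining_def)
  qed
  then have 2: "\<forall>\<^sub>F q in nhds 0. \<forall>j\<in>{..<d}. \<forall>\<^sub>F Z in nhds q. real_defining \<rho> j Z = cnj (real_defining \<rho> j Z)"
    by (intro eventually_ball_finite) (auto simp: eventually_eventually)
  have 3: "\<forall>\<^sub>F q in nhds 0. wedge d (\<lambda>j. partial_Z (\<rho> j) (q, vcnj q)) \<noteq> (\<lambda>v. 0)"
    using generic unfolding generic_submanifold_def by (intro *) blast
  have 4: "\<forall>\<^sub>F q in nhds 0. \<forall>\<^sub>F Z in nhds q. Z \<in> M \<longleftrightarrow> (\<forall>j<d. real_defining \<rho> j Z = 0)"
    using generic unfolding generic_submanifold_def eventually_eventually real_defining_def by blast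
  have 5: "\<forall>\<^sub>F q in nhds 0. \<forall>j\<in>{..<d}. smooth_near q (real_defining \<rho> j)"
    by (intro eventually_ball_finite) (auto intro: smooth_near_eventually real_defining_smooth)
  show ?thesis using 1 2 3 4 5
    by eventually_elim (simp add: regular_point_def)
qed

lemma regular_point_0: "regular_point 0"
  using eventually_nhds_x_imp_x[OF eventually_regular_point] .

lemma zero_in_M: "0 \<in> M"
  using generic unfolding generic_submanifold_def by blast

lemma tangent_space_eq:
  assumes "regular_point q"
  shows "tangent_space d \<rho> q = {u. \<forall>j<d. Re (partial_Z (\<rho> j) (q, vcnj q) u) = 0}"
proof -
  have "frechet_derivative (\<lambda>Z. \<rho> j (Z, vcnj Z)) (at q) u = of_real (2 * Re (partial_Z (\<rho> j) (q, vcnj q) u))"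
    if "j < d" for j u
    using frechet_derivative_real_defining[of \<rho> j q u] assms that
    unfolding regular_point_def real_defining_def[abs_def] by simp
  then show ?thesis unfolding tangent_space_def by simp
qed

lemma dual_vectors:
  assumes "regular_point q"
  obtains b where "\<And>i j. i < d \<Longrightarrow> j < d \<Longrightarrow> partial_Z (\<rho> i) (q, vcnj q) (b j) = (if i = j then 1 else 0)"
proof -
  have "linear (partial_Z (\<rho> j) (q, vcnj q))"
    "partial_Z (\<rho> j) (q, vcnj q) (c *s v) = c * partial_Z (\<rho> j) (q, vcnj q) v" if "j < d" for j c v
    using assms that partial_Z_linear unfolding regular_point_def by blast+
  moreover have "wedge d (\<lambda>j. partial_Z (\<rho> j) (q, vcnj q)) \<noteq> (\<lambda>v. 0)"
    using assms unfolding regular_point_def by blast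
  ultimately show thesis
    using that wedge_dual_vectors[of d "\<lambda>j. partial_Z (\<rho> j) (q, vcnj q)"] by blast
qed

text \<open>
  Here the vectors dual to the differentials \<open>2 Re \<partial>\<^sub>Z\<rho> j\<close> are the halves of the vectors dual to the
  forms \<open>\<partial>\<^sub>Z\<rho> j\<close>.
\<close>

lemma tangent_derivative_zero:
  fixes f :: "complex^'n \<Rightarrow> complex"
  assumes q: "regular_point q" "q \<in> M" and f: "f differentiable at q"
    and zero: "\<forall>\<^sub>F Z in nhds q. Z \<in> M \<longrightarrow> f Z = 0"
    and v: "v \<in> tangent_space d \<rho> q"
  shows "frechet_derivative f (at q) v = 0"
proof -
  obtain b where b: "\<And>i j. i < d \<Longrightarrow> j < d \<Longrightarrow> partial_Z (\<rho> i) (q, vcnj q) (b j) = (if i = j then 1 else 0)"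
    by (rule dual_vectors[OF q(1)]) blast
  have real: "\<forall>\<^sub>F Z in nhds q. real_defining \<rho> j Z \<in> \<real>" if "j < d" for j
  proof -
    have "\<forall>\<^sub>F Z in nhds q. real_defining \<rho> j Z = cnj (real_defining \<rho> j Z)"
      using q(1) that unfolding regular_point_def by blast
    then show ?thesis by eventually_elim (metis Reals_cnj_iff)
  qed
  have sm: "\<forall>\<^sub>F Z in nhds q. \<forall>j\<in>{..<d}. real_defining \<rho> j Z \<in> \<real>"
    by (intro eventually_ball_finite) (auto intro: real)
  then obtain A where A: "open A" "q \<in> A" "\<And>Z j. Z \<in> A \<Longrightarrow> j < d \<Longrightarrow> real_defining \<rho> j Z \<in> \<real>"
    unfolding eventually_nhds by blast
  have "\<forall>j\<in>{..<d}. \<exists>B. open B \<and> q \<in> B \<and> smooth_on (real_defining \<rho> j) B"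
    using q(1) unfolding regular_point_def smooth_near_def by blast
  then obtain B where B: "\<And>j. j < d \<Longrightarrow> open (B j) \<and> q \<in> B j \<and> smooth_on (real_defining \<rho> j) (B j)"
    by (metis lessThan_iff)
  define U where "U = A \<inter> (\<Inter>j<d. B j)"
  have U: "open U" "q \<in> U" unfolding U_def using A B by (auto intro!: open_Int open_INT)
  have onM: "\<forall>\<^sub>F Z in nhds q. Z \<in> M \<longleftrightarrow> (\<forall>j<d. real_defining \<rho> j Z = 0)"
    using q(1) unfolding regular_point_def by blast
  have der: "frechet_derivative (real_defining \<rho> j) (at q) u = of_real (2 * Re (partial_Z (\<rho> j) (q, vcnj q) u))"
    if "j < d" for j u
    using frechet_derivative_real_defining[of \<rho> j q u] q(1) that unfolding regular_point_def by blast
  have lin: "linear (partial_Z (\<rho> j) (q, vcnj q))" if "j < d" for j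
    using q(1) that partial_Z_linear unfolding regular_point_def by blast
  show ?thesis
  proof (rule level_set_tangent[OF U, where r = "real_defining \<rho>" and d = d
        and B = "\<lambda>j c. (Re c / 2) *\<^sub>R b j" and S = "\<real>"])
    fix j assume j: "j < d"
    show "Ck_on 1 (real_defining \<rho> j) U"
      by (rule Ck_on_subset[of _ _ "B j"]) (use B[OF j] j in \<open>auto simp only: smooth_on_def U_def\<close>)
    show "real_defining \<rho> j q = 0"
      using eventually_nhds_x_imp_x[OF onM] q(2) j by blast
    show "frechet_derivative (real_defining \<rho> j) (at q) v = 0"
      using v j der[OF j] unfolding tangent_space_eq[OF q(1)] by simp
    show "real_defining \<rho> j x \<in> \<real>" if "x \<in> U" for x
      using A(3) j that unfolding U_def by blast
    show "frechet_derivative (real_defining \<rho> j) (at q) v \<in> \<real>" for v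
      by (simp add: der[OF j])
  next
    show "bounded_linear (\<lambda>c. (Re c / 2) *\<^sub>R b j)" for j
      by (rule bounded_linear_scaleR_left[THEN bounded_linear_compose])
        (rule bounded_linear_divide[THEN bounded_linear_compose], rule bounded_linear_Re)
    show "subspace (\<real> :: complex set)"
      by (auto simp: subspace_def scaleR_conv_of_real)
    fix i j c assume ij: "i < d" "j < d" and c: "c \<in> (\<real> :: complex set)"
    show "frechet_derivative (real_defining \<rho> i) (at q) ((Re c / 2) *\<^sub>R b j) = (if i = j then c else 0)"
      using b[OF ij] c by (simp add: der[OF ij(1)] linear_scale[OF lin[OF ij(1)]] complex_is_Real_iff complex_eq_iff)
  next
    show "\<forall>\<^sub>F x in nhds q. (\<forall>j<d. real_defining \<rho> j x = 0) \<longrightarrow> f x = 0"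
      using onM zero by eventually_elim blast
  qed (rule f)
qed

lemma cr_fields_smooth: "X \<in> cr_fields d \<rho> M 0 \<Longrightarrow> smooth_near 0 X"
  unfolding cr_fields_def by (auto intro: smooth_nearI)

sublocale smooth_fields "cr_fields d \<rho> M 0"
  by unfold_locales (rule cr_fields_smooth)

lemma cr_fields_tangent:
  assumes "X \<in> cr_fields d \<rho> M 0"
  shows "\<forall>\<^sub>F q in nhds 0. q \<in> M \<longrightarrow> fst (X q) \<in> tangent_space d \<rho> q \<and> snd (X q) \<in> tangent_space d \<rho> q"
proof -
  obtain U where U: "open U" "0 \<in> U" "\<forall>q\<in>M \<inter> U. X q \<in> ctangent_space d \<rho> q"
    using assms unfolding cr_fields_def by blast
  show ?thesis
    using eventually_nhds_in_open[OF U(1,2)]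
    by eventually_elim (use U(3) in \<open>auto simp: ctangent_space_def mem_Times_iff\<close>)
qed

lemma cr_fields_type:
  assumes "X \<in> cr_fields d \<rho> M 0"
  obtains "\<forall>\<^sub>F q in nhds 0. q \<in> M \<longrightarrow> type10 (X q)" | "\<forall>\<^sub>F q in nhds 0. q \<in> M \<longrightarrow> type01 (X q)"
proof -
  obtain U where U: "open U" "0 \<in> U" "(\<forall>q\<in>M \<inter> U. type10 (X q)) \<or> (\<forall>q\<in>M \<inter> U. type01 (X q))"
    using assms unfolding cr_fields_def by blast
  have ev: "\<forall>\<^sub>F q in nhds 0. q \<in> U" by (rule eventually_nhds_in_open[OF U(1,2)])
  from U(3) show thesis
  proof
    assume *: "\<forall>q\<in>M \<inter> U. type10 (X q)"
    show thesis by (rule that(1)) (use ev * in \<open>auto elim: eventually_mono\<close>)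
  next
    assume *: "\<forall>q\<in>M \<inter> U. type01 (X q)"
    show thesis by (rule that(2)) (use ev * in \<open>auto elim: eventually_mono\<close>)
  qed
qed

lemma cr_fields_conjugate:
  assumes "X \<in> cr_fields d \<rho> M 0"
  shows "(\<lambda>q. (fst (X q), - snd (X q))) \<in> cr_fields d \<rho> M 0"
proof -
  obtain U where U: "open U" "0 \<in> U" "smooth_on X U" "\<forall>q\<in>M \<inter> U. X q \<in> ctangent_space d \<rho> q"
    "(\<forall>q\<in>M \<inter> U. type10 (X q)) \<or> (\<forall>q\<in>M \<inter> U. type01 (X q))"
    using assms unfolding cr_fields_def by blast
  obtain A where A: "open A" "0 \<in> A" "\<And>q. q \<in> A \<Longrightarrow> regular_point q"
    using eventually_regular_point unfolding eventually_nhds by blast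
  let ?L = "\<lambda>v :: 'n ctangent. (fst v, - snd v)"
  have L: "bounded_linear ?L"
    by (intro bounded_linear_Pair bounded_linear_fst bounded_linear_minus bounded_linear_snd)
  have "smooth_on X (U \<inter> A)" using U(3) by (rule smooth_on_subset) simp
  then have sm: "smooth_on (\<lambda>q. ?L (X q)) (U \<inter> A)"
    unfolding smooth_on_def using Ck_on_compose_linear[OF L] U(1) A(1) by blast
  have tan: "?L (X q) \<in> ctangent_space d \<rho> q" if "q \<in> M \<inter> (U \<inter> A)" for q
  proof -
    have reg: "regular_point q" using A(3) that by blast
    have "linear (partial_Z (\<rho> j) (q, vcnj q))" if "j < d" for j
      using reg that partial_Z_linear unfolding regular_point_def by blast
    moreover have "X q \<in> ctangent_space d \<rho> q" using U(4) that by blast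
    ultimately show ?thesis
      by (auto simp: ctangent_space_def tangent_space_eq[OF reg] mem_Times_iff linear_neg)
  qed
  have t: "type10 (?L v) = type01 v" "type01 (?L v) = type10 v" for v
    by (auto simp: type10_def type01_def cJ_def cscale_def prod_eq_iff vec_eq_iff) (metis minus_equation_iff)
  show ?thesis
    unfolding cr_fields_def mem_Collect_eq
    using U A sm tan by (intro exI[of _ "U \<inter> A"]) (auto simp: t)
qed

text \<open>
  A CR field is tangent to \<open>M\<close>, so it maps functions vanishing on \<open>M\<close> to such functions. Thus the
  order of vanishing depends on the restriction to \<open>M\<close> only.
\<close>

lemma vanish_order_zero_on:
  assumes "smooth_near 0 f" "\<forall>\<^sub>F q in nhds 0. q \<in> M \<longrightarrow> f q = 0"
  shows "f \<in> vanish_order (cr_fields d \<rho> M 0) k"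
  using assms
proof (induction k arbitrary: f)
  case 0
  then show ?case using eventually_nhds_x_imp_x[of _ "0 :: complex^'n"] zero_in_M by fastforce
next
  case (Suc k)
  have "field_deriv X f \<in> vanish_order (cr_fields d \<rho> M 0) k" if X: "X \<in> cr_fields d \<rho> M 0" for X
  proof (rule Suc.IH)
    show "smooth_near 0 (field_deriv X f)"
      by (intro smooth_near_field_deriv cr_fields_smooth X Suc.prems)
    have "\<forall>\<^sub>F q in nhds 0. \<forall>\<^sub>F Z in nhds q. Z \<in> M \<longrightarrow> f Z = 0"
      using Suc.prems(2) by (simp add: eventually_eventually)
    with eventually_regular_point cr_fields_tangent[OF X] smooth_near_differentiable[OF Suc.prems(1)]
    show "\<forall>\<^sub>F q in nhds 0. q \<in> M \<longrightarrow> field_deriv X f q = 0"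
      by eventually_elim (simp add: field_deriv_def tangent_derivative_zero)
  qed
  then show ?case using Suc by simp
qed

lemma vanish_order_cong_on:
  assumes "f \<in> vanish_order (cr_fields d \<rho> M 0) k" "smooth_near 0 g"
    and "\<forall>\<^sub>F q in nhds 0. q \<in> M \<longrightarrow> f q = g q"
  shows "g \<in> vanish_order (cr_fields d \<rho> M 0) k"
proof -
  have "(\<lambda>q. g q - f q) \<in> vanish_order (cr_fields d \<rho> M 0) k"
    using assms(2,3) vanish_order_smooth[OF assms(1)]
    by (intro vanish_order_zero_on smooth_near_diff) (auto elim: eventually_mono)
  from vanish_order_add[OF this assms(1)] show ?thesis by simp
qed

text \<open>
  \<open>X (cnj f)\<close> is the conjugate of \<open>(cnj X) f\<close>, and conjugation exchanges \<open>(1,0)\<close> and \<open>(0,1)\<close> fields.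
\<close>

lemma vanish_order_cnj:
  "f \<in> vanish_order (cr_fields d \<rho> M 0) k \<Longrightarrow> (\<lambda>q. cnj (f q)) \<in> vanish_order (cr_fields d \<rho> M 0) k"
proof (induction k arbitrary: f)
  case 0
  then show ?case by (auto intro: smooth_near_linear[OF bounded_linear_cnj])
next
  case (Suc k)
  have "field_deriv X (\<lambda>q. cnj (f q)) \<in> vanish_order (cr_fields d \<rho> M 0) k" if X: "X \<in> cr_fields d \<rho> M 0" for X
  proof (rule vanish_order_cong)
    let ?Y = "\<lambda>q. (fst (X q), - snd (X q))"
    show "(\<lambda>q. cnj (field_deriv ?Y f q)) \<in> vanish_order (cr_fields d \<rho> M 0) k"
      using Suc.prems cr_fields_conjugate[OF X] by (intro Suc.IH) auto
    have "smooth_near 0 f" using Suc.prems by (rule vanish_order_smooth)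
    from smooth_near_differentiable[OF this]
    show "\<forall>\<^sub>F q in nhds 0. cnj (field_deriv ?Y f q) = field_deriv X (\<lambda>q. cnj (f q)) q"
    proof eventually_elim
      case (elim q)
      have "frechet_derivative (\<lambda>q. cnj (f q)) (at q) = (\<lambda>v. cnj (frechet_derivative f (at q) v))"
        by (rule frechet_derivative_eq[OF bounded_linear.has_derivative[OF bounded_linear_cnj
              has_derivative_frechet[OF elim]]])
      then show ?case by (simp add: field_deriv_def linear_neg[OF linear_frechet_derivative[OF elim]])
    qed
  qed
  then show ?case using Suc by simp
qed

end

section \<open>Finite type and holomorphic functions\<close>

lemma frechet_derivative_axis:
  fixes f :: "complex^'k \<Rightarrow> complex"
  assumes "complex_diff_at (*s) f q"
  shows "frechet_derivative f (at q) v = (\<Sum>k\<in>UNIV. v $ k * frechet_derivative f (at q) (axis k 1))"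
proof -
  let ?D = "frechet_derivative f (at q)"
  have lin: "linear ?D" by (rule linear_frechet_derivative[OF complex_diff_atD(1)[OF assms]])
  have "?D v = ?D (\<Sum>k\<in>UNIV. v $ k *s axis k 1)" by (simp only: basis_expansion)
  then show ?thesis by (simp only: linear_sum[OF lin] complex_diff_atD(2)[OF assms])
qed

text \<open>
  On a holomorphic function the field \<open>(u, v)\<close> acts as the complex direction \<open>u + \<i> v\<close>, its \<open>(1,0)\<close> part.
\<close>

lemma field_deriv_holomorphic:
  assumes "complex_diff_at (*s) f q"
  shows "field_deriv X f q = (\<Sum>k\<in>UNIV. (fst (X q) + \<i> *s snd (X q)) $ k * frechet_derivative f (at q) (axis k 1))"
proof -
  have "field_deriv X f q = frechet_derivative f (at q) (fst (X q) + \<i> *s snd (X q))"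
    unfolding field_deriv_def linear_add[OF linear_frechet_derivative[OF complex_diff_atD(1)[OF assms]]]
      complex_diff_atD(2)[OF assms] ..
  also have "\<dots> = (\<Sum>k\<in>UNIV. (fst (X q) + \<i> *s snd (X q)) $ k * frechet_derivative f (at q) (axis k 1))"
    by (rule frechet_derivative_axis[OF assms])
  finally show ?thesis .
qed

context generic_mfd
begin

text \<open>
  The forms \<open>\<theta> j = \<partial>\<^sub>Z\<rho> j\<close> are linearly independent because \<open>M\<close> is generic, so they have dual vectors.
  Subtracting from \<open>u\<close> the real multiples \<open>Re (\<theta> j u)\<close> of these makes the real parts of all
  \<open>\<theta> j u\<close> vanish, and the subtracted vector becomes tangent after multiplication by \<open>\<i>\<close>.
\<close>

lemma complexified_tangent_space:
  obtains a b where "a \<in> tangent_space d \<rho> 0" "b \<in> tangent_space d \<rho> 0" "a + \<i> *s b = u"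
proof -
  let ?\<theta> = "\<lambda>j. partial_Z (\<rho> j) (0, vcnj 0)"
  obtain e where e: "\<And>i j. i < d \<Longrightarrow> j < d \<Longrightarrow> ?\<theta> i (e j) = (if i = j then 1 else 0)"
    by (rule dual_vectors[OF regular_point_0]) blast
  have lin: "linear (?\<theta> j)" and sc: "?\<theta> j (c *s v) = c * ?\<theta> j v" if "j < d" for j c v
    using regular_point_0 that partial_Z_linear unfolding regular_point_def by blast+
  define w where "w = (\<Sum>j<d. complex_of_real (Re (?\<theta> j u)) *s e j)"
  have w: "?\<theta> i w = of_real (Re (?\<theta> i u))" if i: "i < d" for i
  proof -
    have "?\<theta> i w = (\<Sum>j<d. of_real (Re (?\<theta> j u)) * (if i = j then 1 else 0))"
      unfolding w_def using e[OF i] by (simp add: linear_sum[OF lin[OF i]] sc[OF i] del: vcnj_zero)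
    also have "\<dots> = of_real (Re (?\<theta> i u))"
      using i by (simp add: if_distrib[of "\<lambda>x. _ * x"] cong: if_cong)
    finally show ?thesis .
  qed
  show thesis
  proof (rule that[of "u - w" "(- \<i>) *s w"])
    show "u - w \<in> tangent_space d \<rho> 0" "(- \<i>) *s w \<in> tangent_space d \<rho> 0"
      unfolding tangent_space_eq[OF regular_point_0] using w by (auto simp: linear_diff[OF lin] linear_neg[OF lin] sc simp del: vcnj_zero)
    show "u - w + \<i> *s ((- \<i>) *s w) = u" by (simp add: vec_eq_iff)
  qed
qed

text \<open>
  Finite type provides fields \<open>W k\<close> in the Lie algebra whose \<open>(1,0)\<close> parts at \<open>0\<close> are the standard
  basis vectors. Near \<open>0\<close> the functions \<open>W i f\<close> are then the partial derivatives of \<open>f\<close>, transformed by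
  a matrix that is the identity at \<open>0\<close>.
\<close>

lemma vanish_infinite_deriv:
  assumes ft: "finite_type d \<rho> M 0" and f: "hol_near 0 f" "f \<in> vanish_infinite"
  shows "(\<lambda>q. frechet_derivative f (at q) v) \<in> vanish_infinite"
proof -
  let ?G = "cr_fields d \<rho> M 0"
  have "\<exists>W\<in>lie_generated ?G. fst (W 0) + \<i> *s snd (W 0) = axis k 1" for k
  proof -
    obtain a b where ab: "a \<in> tangent_space d \<rho> 0" "b \<in> tangent_space d \<rho> 0" "a + \<i> *s b = axis k 1"
      by (rule complexified_tangent_space)
    then have "(a, b) \<in> (\<lambda>X. X 0) ` lie_generated ?G"
      using ft unfolding finite_type_def ctangent_space_def by simp
    then obtain W where "W \<in> lie_generated ?G" "W 0 = (a, b)" by force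
    then show ?thesis using ab(3) by (intro bexI[of _ W]) auto
  qed
  then obtain W where W: "\<And>k. W k \<in> lie_generated ?G" "\<And>k. fst (W k 0) + \<i> *s snd (W k 0) = axis k 1"
    by metis
  define E where "E i k = (\<lambda>q. (fst (W i q) + \<i> *s snd (W i q)) $ k)" for i k
  define g where "g k = (\<lambda>q. frechet_derivative f (at q) (axis k 1))" for k
  have fs: "smooth_near 0 f" by (rule hol_near_smooth[OF f(1)])
  have blk: "bounded_linear (\<lambda>v :: complex^'n. v $ k)" for k
    by (rule bounded_linear_vec_nth)
  have Wsm: "smooth_near 0 (W i)" for i using lie_generated_vanish_infinite[OF W(1)] by blast
  have Esm: "smooth_near 0 (E i k)" for i k
    unfolding E_def
    by (simp, intro smooth_near_add smooth_near_mult smooth_near_const smooth_near_linear[OF blk]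
        smooth_near_fst smooth_near_snd Wsm)
  have g: "g k \<in> vanish_order ?G j" for k j
  proof (rule vanish_order_matrix[of E g])
    show "E i k 0 = (if i = k then 1 else 0)" for i k
      unfolding E_def by (simp only: W(2)) (simp add: axis_def)
    show "smooth_near 0 (g i)" for i unfolding g_def by (rule smooth_near_deriv[OF fs])
    show "(\<lambda>p. \<Sum>k\<in>UNIV. E i k p * g k p) \<in> vanish_order ?G j" for i
    proof (rule vanish_order_cong)
      show "field_deriv (W i) f \<in> vanish_order ?G j"
        using lie_generated_vanish_infinite[OF W(1)] f(2) unfolding vanish_infinite_def by blast
      show "\<forall>\<^sub>F p in nhds 0. field_deriv (W i) f p = (\<Sum>k\<in>UNIV. E i k p * g k p)"
        using f(1) unfolding hol_near_def
        by eventually_elim (simp only: field_deriv_holomorphic E_def g_def)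
    qed
  qed (rule Esm)
  show ?thesis
    unfolding vanish_infinite_def
  proof
    fix j
    show "(\<lambda>q. frechet_derivative f (at q) v) \<in> vanish_order ?G j"
    proof (rule vanish_order_cong)
      show "(\<lambda>p. \<Sum>k\<in>UNIV. v $ k * g k p) \<in> vanish_order ?G j"
        by (intro vanish_order_sum vanish_order_mult smooth_near_const g)
      show "\<forall>\<^sub>F p in nhds 0. (\<Sum>k\<in>UNIV. v $ k * g k p) = frechet_derivative f (at p) v"
        using f(1) unfolding hol_near_def
        by eventually_elim (simp only: g_def frechet_derivative_axis[symmetric])
    qed
  qed
qed

text \<open>
  Iterating the previous lemma, all derivatives of \<open>f\<close> along a complex line through \<open>0\<close> vanish at \<open>0\<close>,
  so \<open>f\<close> vanishes on that line by the identity theorem in one variable.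
\<close>

lemma vanish_infinite_imp_zero:
  assumes ft: "finite_type d \<rho> M 0" and f: "hol_near 0 f" "f \<in> vanish_infinite"
  shows "\<forall>\<^sub>F q in nhds 0. f q = 0"
proof -
  obtain e where e: "e > 0" "\<And>x. x \<in> ball 0 e \<Longrightarrow> complex_diff_at (*s) f x"
    using f(1) unfolding hol_near_def eventually_nhds_metric by (auto simp: dist_commute)
  have "f v = 0" if v: "v \<in> ball 0 e" for v
  proof -
    define F where "F n = ((\<lambda>h x. frechet_derivative h (at x) v) ^^ n) f" for n
    have F0: "F 0 = f" and FS: "F (Suc n) = (\<lambda>x. frechet_derivative (F n) (at x) v)" for n
      by (simp_all add: F_def)
    have cd: "complex_diff_at (*s) (F n) x" if "x \<in> ball 0 e" for n x
      using that
      by (induction n arbitrary: x)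
        (auto simp: F0 FS e intro!: complex_diff_derivative[OF complex_scaling_vec open_ball[of 0 e]])
    have hn: "hol_near 0 (F n)" for n
      unfolding hol_near_def using eventually_nhds_in_open[OF open_ball, of 0 0 e] e(1) cd
      by (auto elim: eventually_mono)
    have Fv: "F n \<in> vanish_infinite" for n
      by (induction n) (auto simp: F0 FS f(2) intro!: vanish_infinite_deriv[OF ft hn])
    have F00: "F n 0 = 0" for n
      using Fv[of n] vanish_order_zero unfolding vanish_infinite_def by blast
    define S where "S = (\<lambda>z. z *s v) -` ball 0 e"
    have bl: "bounded_linear (\<lambda>z. z *s v)"
      using complex_scaling_vec unfolding complex_scaling_def by (blast intro: bounded_bilinear.bounded_linear_left)
    have S: "open S" "convex S" "0 \<in> S" "1 \<in> S"
      unfolding S_def using e(1) v bounded_linear.linear[OF bl]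
      by (auto intro!: open_vimage linear_continuous_on[OF bl] convex_linear_vimage)
    have der: "((\<lambda>z. F n (z *s v)) has_field_derivative F (Suc n) (z *s v)) (at z)" if "z \<in> S" for n z
      using complex_diff_slice[OF complex_scaling_vec, of "F n" 0 z v] cd[of "z *s v" n] that
      unfolding S_def FS by simp
    have hd: "(deriv ^^ n) (\<lambda>z. f (z *s v)) z = F n (z *s v)" if "z \<in> S" for n z
      using that
    proof (induction n arbitrary: z)
      case 0
      then show ?case by (simp add: F0)
    next
      case (Suc n)
      have "\<forall>\<^sub>F y in nhds z. (deriv ^^ n) (\<lambda>z. f (z *s v)) y = F n (y *s v)"
        using eventually_nhds_in_open[OF S(1) Suc.prems] by eventually_elim (rule Suc.IH)
      then have "deriv ((deriv ^^ n) (\<lambda>z. f (z *s v))) z = deriv (\<lambda>z. F n (z *s v)) z"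
        by (rule deriv_cong_ev) simp
      then show ?case using DERIV_imp_deriv[OF der[OF Suc.prems]] by simp
    qed
    have "(\<lambda>z. f (z *s v)) holomorphic_on S"
      unfolding holomorphic_on_open[OF S(1)] using der[of _ 0] by (auto simp: F0)
    from holomorphic_fun_eq_0_on_connected[OF this S(1) convex_connected[OF S(2)], of 0 1]
    have "f (1 *s v) = 0" using S hd[OF S(3)] F00 by simp
    then show ?thesis by simp
  qed
  then show ?thesis
    using eventually_nhds_in_open[OF open_ball, of 0 0 e] e(1) by (auto elim: eventually_mono)
qed

end

section \<open>Uniqueness of mappings from finite-type submanifolds\<close>

lemma field_deriv_type01_holomorphic:
  assumes "type01 (X q)" "complex_diff_at (*s) f q"
  shows "field_deriv X f q = 0"
proof -
  have "fst (X q) + \<i> *s snd (X q) = 0"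
    using assms(1) by (simp add: type01_def cJ_def cscale_def prod_eq_iff vec_eq_iff)
  then show ?thesis by (simp only: field_deriv_holomorphic[OF assms(2)]) simp
qed

text \<open>
  For \<open>X = u - \<i> J u\<close> of type \<open>(1,0)\<close> the contributions of \<open>u\<close> and \<open>J u\<close> to the derivative of
  \<open>cnj H\<close> cancel, while those to the derivative of \<open>H\<close> add up. Only \<open>\<partial>\<^sub>ZQ\<close> remains.
\<close>

lemma field_deriv_type10_composition:
  fixes H :: "complex^'n \<Rightarrow> complex^'m"
  assumes X: "type10 (X q)" and H: "\<And>k. complex_diff_at (*s) (\<lambda>Z. H Z $ k) q"
    and Q: "complex_diff_at pair_scale Q (H q, vcnj (H q))"
  shows "field_deriv X (\<lambda>Z. Q (H Z, vcnj (H Z))) q =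
    (\<Sum>k\<in>UNIV. frechet_derivative Q (at (H q, vcnj (H q))) (axis k 1, 0) * field_deriv X (\<lambda>Z. H Z $ k) q)"
proof -
  let ?D = "frechet_derivative Q (at (H q, vcnj (H q)))"
  define dH where "dH u = (\<chi> k. frechet_derivative (\<lambda>Z. H Z $ k) (at q) u)" for u
  have lin: "linear ?D" by (rule linear_frechet_derivative[OF complex_diff_atD(1)[OF Q]])
  have Hd: "(H has_derivative dH) (at q)"
    unfolding dH_def[abs_def] has_derivative_componentwise_within[of H]
  proof
    fix b :: "complex^'m" assume "b \<in> Basis"
    then obtain k c where b: "b = axis k c" by (auto simp: Basis_vec_def)
    show "((\<lambda>x. H x \<bullet> b) has_derivative (\<lambda>x. (\<chi> k. frechet_derivative (\<lambda>Z. H Z $ k) (at q) x) \<bullet> b)) (at q)"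
      unfolding b inner_axis
      using bounded_linear.has_derivative[OF bounded_linear_inner_left has_derivative_frechet[OF complex_diff_atD(1)[OF H]]]
      by simp
  qed
  have dH_scale: "dH (c *s u) = c *s dH u" for c u
    by (simp add: dH_def vec_eq_iff complex_diff_atD(2)[OF H])
  have "((\<lambda>Z. (H Z, vcnj (H Z))) has_derivative (\<lambda>u. (dH u, vcnj (dH u)))) (at q)"
    by (intro has_derivative_Pair Hd bounded_linear.has_derivative[OF bounded_linear_vcnj])
  from has_derivative_compose[OF this has_derivative_frechet[OF complex_diff_atD(1)[OF Q]]]
  have Qd: "frechet_derivative (\<lambda>Z. Q (H Z, vcnj (H Z))) (at q) = (\<lambda>u. ?D (dH u, vcnj (dH u)))"
    by (rule frechet_derivative_eq)
  have v: "snd (X q) = (- \<i>) *s fst (X q)"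
    using X by (simp add: type10_def cJ_def cscale_def prod_eq_iff vec_eq_iff)
  let ?u = "dH (fst (X q))"
  have Hk: "field_deriv X (\<lambda>Z. H Z $ k) q = 2 * ?u $ k" for k
    unfolding field_deriv_def v complex_diff_atD(2)[OF H] by (simp add: dH_def)
  have "field_deriv X (\<lambda>Z. Q (H Z, vcnj (H Z))) q = ?D (?u, vcnj ?u) + \<i> * ?D ((- \<i>) *s ?u, vcnj ((- \<i>) *s ?u))"
    unfolding field_deriv_def Qd v dH_scale ..
  also have "\<dots> = ?D (?u, vcnj ?u) + ?D (pair_scale \<i> ((- \<i>) *s ?u, vcnj ((- \<i>) *s ?u)))"
    unfolding complex_diff_atD(2)[OF Q] ..
  also have "\<dots> = ?D ((?u, vcnj ?u) + pair_scale \<i> ((- \<i>) *s ?u, vcnj ((- \<i>) *s ?u)))"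
    unfolding linear_add[OF lin] ..
  also have "(?u, vcnj ?u) + pair_scale \<i> ((- \<i>) *s ?u, vcnj ((- \<i>) *s ?u)) =
      (\<Sum>k\<in>UNIV. pair_scale (2 * ?u $ k) (axis k 1, 0))"
  proof -
    have "fst (\<Sum>k\<in>UNIV. pair_scale (2 * ?u $ k) (axis k 1, 0 :: complex^'m)) = (\<Sum>k\<in>UNIV. (2 *s ?u) $ k *s axis k 1)"
      by (simp add: fst_sum)
    also have "\<dots> = 2 *s ?u" by (rule basis_expansion)
    finally have "fst (\<Sum>k\<in>UNIV. pair_scale (2 * ?u $ k) (axis k 1, 0 :: complex^'m)) = 2 *s ?u" .
    moreover have "snd (\<Sum>k\<in>UNIV. pair_scale (2 * ?u $ k) (axis k 1, 0 :: complex^'m)) = 0"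
      by (simp add: snd_sum)
    ultimately show ?thesis
      by (simp add: prod_eq_iff vec_eq_iff)
  qed
  also have "?D (\<Sum>k\<in>UNIV. pair_scale (2 * ?u $ k) (axis k 1, 0)) = (\<Sum>k\<in>UNIV. 2 * ?u $ k * ?D (axis k 1, 0))"
    unfolding linear_sum[OF lin] complex_diff_atD(2)[OF Q] ..
  finally show ?thesis unfolding Hk by (simp add: mult.commute)
qed

lemma hol_map_near_smooth:
  fixes H :: "complex^'n \<Rightarrow> complex^'m"
  assumes "hol_map_near p H"
  shows "smooth_near p H"
proof (rule smooth_near_componentwise)
  fix b :: "complex^'m" assume "b \<in> Basis"
  then obtain k c where b: "b = axis k c" by (auto simp: Basis_vec_def)
  have "smooth_near p (\<lambda>Z. H Z $ k)"
    using assms unfolding hol_map_near_def by (blast intro: hol_near_smooth)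
  from smooth_near_linear[OF bounded_linear_inner_left this, of c]
  show "smooth_near p (\<lambda>Z. H Z \<bullet> b)" unfolding b inner_axis .
qed

lemma complex_of_real_inner:
  fixes x y :: "complex^'m"
  shows "complex_of_real (x \<bullet> y) = (\<Sum>k\<in>UNIV. (x $ k * cnj (y $ k) + cnj (x $ k) * (y $ k)) / 2)"
proof -
  have "complex_of_real (a \<bullet> c) = (a * cnj c + cnj a * c) / 2" for a c :: complex
    by (simp add: complex_eq_iff inner_complex_def)
  moreover have "complex_of_real (x \<bullet> y) = (\<Sum>k\<in>UNIV. complex_of_real (x $ k \<bullet> y $ k))"
    by (simp add: inner_vec_def)
  ultimately show ?thesis by (simp only:)
qed

context generic_mfd
begin

text \<open>
  The real coordinates of \<open>(H, cnj H)\<close> are complex linear combinations of the components of \<open>H\<close> and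
  \<open>cnj H\<close>.
\<close>

lemma vanish_order_inner_diff:
  fixes H1 H2 :: "complex^'n \<Rightarrow> complex^'m"
  assumes D: "\<And>k. (\<lambda>p. H1 p $ k - H2 p $ k) \<in> vanish_order (cr_fields d \<rho> M 0) j"
  shows "(\<lambda>p. complex_of_real ((H1 p, vcnj (H1 p)) \<bullet> b) - of_real ((H2 p, vcnj (H2 p)) \<bullet> b))
    \<in> vanish_order (cr_fields d \<rho> M 0) j"
proof -
  define \<alpha> where "\<alpha> k = (cnj (fst b $ k) + snd b $ k) / 2" for k
  have eq: "complex_of_real ((H1 p, vcnj (H1 p)) \<bullet> b) - of_real ((H2 p, vcnj (H2 p)) \<bullet> b) =
      (\<Sum>k\<in>UNIV. \<alpha> k * (H1 p $ k - H2 p $ k) + cnj (\<alpha> k) * cnj (H1 p $ k - H2 p $ k))" for p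
    by (cases b)
      (simp add: \<alpha>_def complex_of_real_inner sum.distrib[symmetric] sum_subtractf[symmetric],
        intro sum.cong refl, simp add: field_simps)
  show ?thesis unfolding eq
    by (intro vanish_order_sum vanish_order_add vanish_order_mult smooth_near_const vanish_order_cnj D)
qed

text \<open>
  The equation on \<open>M\<close> determines \<open>H\<close> in terms of \<open>cnj H\<close> by the implicit function theorem. This alone
  does not bound \<open>D = H1 - H2\<close>; but \<open>(1,0)\<close> fields annihilate \<open>cnj H\<close>, so the differentiated equation
  bounds the derivatives of \<open>D\<close> along such fields by \<open>D\<close> and \<open>cnj D\<close>.
\<close>

proposition mapping_uniqueness:
  fixes H1 H2 :: "complex^'n \<Rightarrow> complex^'m" and Q :: "'m \<Rightarrow> (complex^'m) \<times> (complex^'m) \<Rightarrow> complex"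
  assumes ft: "finite_type d \<rho> M 0"
    and Q: "\<And>i. hol_near2 (0, 0) (Q i)"
    and dQ: "\<And>i k. frechet_derivative (Q i) (at (0, 0)) (axis k 1, 0) = (if i = k then 1 else 0)"
    and H: "hol_map_near 0 H1" "H1 0 = 0" "hol_map_near 0 H2" "H2 0 = 0"
    and eq: "\<And>i. \<forall>\<^sub>F Z in nhds 0. Z \<in> M \<longrightarrow> Q i (H1 Z, vcnj (H1 Z)) = Q i (H2 Z, vcnj (H2 Z))"
  shows "\<forall>\<^sub>F Z in nhds 0. H1 Z = H2 Z"
proof -
  let ?G = "cr_fields d \<rho> M 0"
  define D where "D k = (\<lambda>Z. H1 Z $ k - H2 Z $ k)" for k
  define h where "h H = (\<lambda>Z. (H Z, vcnj (H Z)))" for H :: "complex^'n \<Rightarrow> complex^'m"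
  define P where "P H i k = (\<lambda>Z. frechet_derivative (Q i) (at (h H Z)) (axis k 1, 0))" for H i k
  note props = hol_map_near_smooth[OF H(1)] hol_map_near_smooth[OF H(3)]
  have Hk: "hol_near 0 (\<lambda>Z. H1 Z $ k)" "hol_near 0 (\<lambda>Z. H2 Z $ k)" for k
    using H unfolding hol_map_near_def by auto
  have Hks: "smooth_near 0 (\<lambda>Z. H1 Z $ k)" "smooth_near 0 (\<lambda>Z. H2 Z $ k)" for k
    using Hk hol_near_smooth by auto
  have Dhol: "hol_near 0 (D k)" for k
    using hol_near_add[OF Hk(1) hol_near_mult[OF hol_near_const Hk(2)], of k "-1" k] by (simp add: D_def)
  have Dsm: "smooth_near 0 (D k)" for k by (rule hol_near_smooth[OF Dhol])
  have hsm: "smooth_near 0 (h H1)" "smooth_near 0 (h H2)"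
    unfolding h_def using props by (auto intro!: smooth_near_Pair smooth_near_linear[OF bounded_linear_vcnj])
  have h0: "h H1 0 = (0, 0)" "h H2 0 = (0, 0)" using H by (simp_all add: h_def)
  have htend: "filterlim (h H1) (nhds (0, 0)) (nhds 0)" "filterlim (h H2) (nhds (0, 0)) (nhds 0)"
    using hsm[THEN smooth_near_tendsto] h0 by simp_all
  have Qcd: "\<forall>\<^sub>F Z in nhds 0. complex_diff_at pair_scale (Q i) (h H1 Z)"
    "\<forall>\<^sub>F Z in nhds 0. complex_diff_at pair_scale (Q i) (h H2 Z)" for i
    using Q[of i] htend unfolding hol_near2_def filterlim_iff by blast+
  have Hcd: "\<forall>\<^sub>F Z in nhds 0. \<forall>k. complex_diff_at (*s) (\<lambda>Z. H1 Z $ k) Z"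
    "\<forall>\<^sub>F Z in nhds 0. \<forall>k. complex_diff_at (*s) (\<lambda>Z. H2 Z $ k) Z"
    using Hk unfolding hol_near_def by (auto intro: eventually_all_finite)
  have Qsm: "smooth_near (0, 0) (Q i)" for i by (rule hol_near2_smooth[OF Q])
  have Qhsm: "smooth_near 0 (\<lambda>Z. Q i (h H1 Z))" "smooth_near 0 (\<lambda>Z. Q i (h H2 Z))" for i
    using smooth_near_compose[OF hsm(1), of "Q i"] smooth_near_compose[OF hsm(2), of "Q i"] h0 Qsm by auto
  have Psm: "smooth_near 0 (P H1 i k)" "smooth_near 0 (P H2 i k)" for i k
    using smooth_near_compose[OF hsm(1), of "\<lambda>x. frechet_derivative (Q i) (at x) (axis k 1, 0)"]
      smooth_near_compose[OF hsm(2), of "\<lambda>x. frechet_derivative (Q i) (at x) (axis k 1, 0)"]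
      h0 smooth_near_deriv[OF Qsm] unfolding P_def by auto
  \<comment> \<open>the propagation step: one more \<open>(1,0)\<close> field at the same order of vanishing\<close>
  have step10: "field_deriv X (D k) \<in> vanish_order ?G j"
    if IH: "\<And>k. D k \<in> vanish_order ?G j" and X: "X \<in> ?G"
      and t: "\<forall>\<^sub>F q in nhds 0. q \<in> M \<longrightarrow> type10 (X q)" for X j k
  proof (rule vanish_order_matrix[of "P H1" "\<lambda>k. field_deriv X (D k)"])
    show "P H1 i k 0 = (if i = k then 1 else 0)" for i k
      by (simp add: P_def h0 dQ)
    show "smooth_near 0 (field_deriv X (D i))" for i
      by (intro smooth_near_field_deriv cr_fields_smooth X Dsm)
    fix i
    have smX: "smooth_near 0 (field_deriv X f)" if "smooth_near 0 f" for f
      by (intro smooth_near_field_deriv cr_fields_smooth X that)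
    have PP: "(\<lambda>q. P H1 i k q - P H2 i k q) \<in> vanish_order ?G j" for k
      unfolding P_def
      by (rule vanish_order_compose_diff[OF hsm h0 smooth_near_deriv[OF Qsm]])
        (use vanish_order_inner_diff[OF IH[unfolded D_def]] in \<open>simp add: h_def\<close>)
    \<comment> \<open>the right side \<open>(\<partial>\<^sub>ZQ(H2, cnj H2) - \<partial>\<^sub>ZQ(H1, cnj H1)) \<cdot> X H2\<close> of the differentiated equation\<close>
    have rem: "(\<lambda>q. \<Sum>k\<in>UNIV. - (field_deriv X (\<lambda>Z. H2 Z $ k) q) * (P H1 i k q - P H2 i k q)) \<in> vanish_order ?G j"
      using smooth_near_mult[OF smooth_near_const smX[OF Hks(2)], of "-1"]
      by (intro vanish_order_sum vanish_order_mult PP) simp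
    show "(\<lambda>q. \<Sum>k\<in>UNIV. P H1 i k q * field_deriv X (D k) q) \<in> vanish_order ?G j"
    proof (rule vanish_order_cong_on[OF rem])
      show "smooth_near 0 (\<lambda>q. \<Sum>k\<in>UNIV. P H1 i k q * field_deriv X (D k) q)"
        by (intro smooth_near_sum smooth_near_mult Psm smX Dsm)
      have ev0: "\<forall>\<^sub>F q in nhds 0. \<forall>\<^sub>F Z in nhds q. Z \<in> M \<longrightarrow> Q i (h H1 Z) - Q i (h H2 Z) = 0"
        using eq[of i] unfolding eventually_eventually h_def by (auto elim: eventually_mono)
      show "\<forall>\<^sub>F q in nhds 0. q \<in> M \<longrightarrow>
          (\<Sum>k\<in>UNIV. - (field_deriv X (\<lambda>Z. H2 Z $ k) q) * (P H1 i k q - P H2 i k q)) =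
          (\<Sum>k\<in>UNIV. P H1 i k q * field_deriv X (D k) q)"
        using t ev0 eventually_regular_point cr_fields_tangent[OF X] Hcd Qcd[of i]
          smooth_near_differentiable[OF Qhsm(1)[of i]] smooth_near_differentiable[OF Qhsm(2)[of i]]
      proof eventually_elim
        case (elim q)
        show ?case
        proof
          assume q: "q \<in> M"
          have "field_deriv X (\<lambda>Z. Q i (h H1 Z) - Q i (h H2 Z)) q = 0"
            unfolding field_deriv_def
            using elim(4) q tangent_derivative_zero[OF elim(3) q differentiable_diff[OF elim(9,10)] elim(2)] by simp
          then have "field_deriv X (\<lambda>Z. Q i (h H1 Z)) q = field_deriv X (\<lambda>Z. Q i (h H2 Z)) q"
            unfolding field_deriv_diff[OF elim(9,10)] by simp
          moreover have "field_deriv X (\<lambda>Z. Q i (h H Z)) q =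
              (\<Sum>k\<in>UNIV. P H i k q * field_deriv X (\<lambda>Z. H Z $ k) q)"
            if "\<forall>k. complex_diff_at (*s) (\<lambda>Z. H Z $ k) q" "complex_diff_at pair_scale (Q i) (h H q)"
            for H :: "complex^'n \<Rightarrow> complex^'m"
            unfolding P_def h_def
            by (rule field_deriv_type10_composition) (use that elim(1) q in \<open>auto simp: h_def\<close>)
          ultimately have "(\<Sum>k\<in>UNIV. P H1 i k q * field_deriv X (\<lambda>Z. H1 Z $ k) q) =
              (\<Sum>k\<in>UNIV. P H2 i k q * field_deriv X (\<lambda>Z. H2 Z $ k) q)"
            using elim by simp
          moreover have "field_deriv X (D k) q = field_deriv X (\<lambda>Z. H1 Z $ k) q - field_deriv X (\<lambda>Z. H2 Z $ k) q" for k
            unfolding D_def by (rule field_deriv_diff) (use elim complex_diff_atD(1) in blast)+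
          ultimately show "(\<Sum>k\<in>UNIV. - (field_deriv X (\<lambda>Z. H2 Z $ k) q) * (P H1 i k q - P H2 i k q)) =
            (\<Sum>k\<in>UNIV. P H1 i k q * field_deriv X (D k) q)"
            by (simp only: right_diff_distrib sum_subtractf) (simp add: mult.commute sum_negf)
        qed
      qed
    qed
  qed (rule Psm)
  have step01: "field_deriv X (D k) \<in> vanish_order ?G j"
    if X: "X \<in> ?G" and t: "\<forall>\<^sub>F q in nhds 0. q \<in> M \<longrightarrow> type01 (X q)" for X j k
  proof (rule vanish_order_zero_on)
    show "smooth_near 0 (field_deriv X (D k))"
      by (intro smooth_near_field_deriv cr_fields_smooth X Dsm)
    show "\<forall>\<^sub>F q in nhds 0. q \<in> M \<longrightarrow> field_deriv X (D k) q = 0"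
      using t Dhol[of k] unfolding hol_near_def
      by eventually_elim (blast intro: field_deriv_type01_holomorphic)
  qed
  have "D k \<in> vanish_order ?G j" for j k
  proof (induction j arbitrary: k)
    case 0
    show ?case using Dsm H(2,4) by (simp add: D_def)
  next
    case (Suc j)
    have "field_deriv X (D k) \<in> vanish_order ?G j" if X: "X \<in> ?G" for X
      using cr_fields_type[OF X] step10[OF Suc.IH X] step01[OF X] by blast
    then show ?case using Suc.IH by simp
  qed
  then have "\<forall>\<^sub>F Z in nhds 0. D k Z = 0" for k
    by (intro vanish_infinite_imp_zero[OF ft Dhol]) (simp add: vanish_infinite_def)
  then have "\<forall>\<^sub>F Z in nhds 0. \<forall>k. D k Z = 0" by (intro eventually_all_finite)
  then show ?thesis by eventually_elim (simp add: D_def vec_eq_iff)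
qed

section \<open>Germs on the Segre variety\<close>

text \<open>
  The differential of \<open>F\<close> at \<open>0\<close> is the identity on the tangent space \<open>\<Inter>j<d. ker (\<theta> j)\<close> of the Segre
  variety, \<open>\<theta> j\<close> being \<open>\<partial>\<^sub>Z\<rho> j(0,0)\<close>. So \<open>dF - id\<close> is a combination of the \<open>\<theta> j\<close>; its coefficients
  are read off on the dual vectors \<open>b j\<close>, whence \<open>c i j = dF\<^sub>i(b j) - (b j)\<^sub>i\<close>.
\<close>

lemma segre_adapted_coordinates:
  fixes F :: "'n \<Rightarrow> complex^'n \<Rightarrow> complex"
  assumes F: "\<And>i. hol_near 0 (F i)"
    and id: "\<And>i. \<forall>\<^sub>F Z in nhds 0. (\<forall>j<d. \<rho> j (Z, 0) = 0) \<longrightarrow> F i Z = Z $ i"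
  obtains c where "\<And>i. hol_near2 (0, 0) (\<lambda>(Z, \<zeta>). F i Z - (\<Sum>j<d. \<rho> j (Z, \<zeta>) * c i j))"
    and "\<And>i v. frechet_derivative (\<lambda>(Z, \<zeta>). F i Z - (\<Sum>j<d. \<rho> j (Z, \<zeta>) * c i j)) (at (0, 0)) (v, 0) = v $ i"
proof -
  define r where "r j = (\<lambda>Z. \<rho> j (Z, 0))" for j
  define \<theta> where "\<theta> j = frechet_derivative (r j) (at 0)" for j
  have \<theta>: "\<theta> j = partial_Z (\<rho> j) (0, vcnj 0)" for j
    unfolding \<theta>_def r_def partial_Z_def by simp
  obtain b where b: "\<And>i j. i < d \<Longrightarrow> j < d \<Longrightarrow> \<theta> i (b j) = (if i = j then 1 else 0)"
    unfolding \<theta> by (rule dual_vectors[OF regular_point_0]) blast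
  have \<rho>cd: "complex_diff_at pair_scale (\<rho> j) (0, 0)" if "j < d" for j
    using regular_point_0 that unfolding regular_point_def by simp
  have lin: "linear (\<theta> j)" and sc: "\<theta> j (a *s v) = a * \<theta> j v" if "j < d" for j a v
    unfolding \<theta> using partial_Z_linear[OF \<rho>cd[OF that]] by simp_all
  have \<rho>sm: "smooth_near (0, 0) (\<rho> j)" if "j < d" for j
    using generic that unfolding generic_submanifold_def by (blast intro: hol_near2_smooth)
  have rsm: "smooth_near 0 (r j)" if "j < d" for j
    unfolding r_def
    using smooth_near_compose[OF smooth_near_Pair[OF smooth_near_bounded_linear[OF bounded_linear_ident] smooth_near_const], of 0 "0" "\<rho> j"]
      \<rho>sm[OF that] by simp
  have r0: "r j 0 = 0" if "j < d" for j
  proof -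
    have "\<forall>\<^sub>F Z in nhds 0. Z \<in> M \<longleftrightarrow> (\<forall>j<d. \<rho> j (Z, vcnj Z) = 0)"
      using generic unfolding generic_submanifold_def by blast
    from eventually_nhds_x_imp_x[OF this] show ?thesis using zero_in_M that by (simp add: r_def)
  qed
  have "\<forall>j\<in>{..<d}. \<exists>B. open B \<and> 0 \<in> B \<and> smooth_on (r j) B"
    using rsm unfolding smooth_near_def by blast
  then obtain B where B: "\<And>j. j < d \<Longrightarrow> open (B j) \<and> 0 \<in> B j \<and> smooth_on (r j) (B j)"
    by (metis lessThan_iff)
  define U where "U = (\<Inter>j<d. B j)"
  have U: "open U" "0 \<in> U" unfolding U_def using B by (auto intro!: open_INT)
  have Fcd: "complex_diff_at (*s) (F i) 0" for i
    using F[of i] eventually_nhds_x_imp_x unfolding hol_near_def by blast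
  define \<phi> where "\<phi> i = frechet_derivative (F i) (at 0)" for i
  have F': "(F i has_derivative \<phi> i) (at 0)" for i
    unfolding \<phi>_def by (rule has_derivative_frechet[OF complex_diff_atD(1)[OF Fcd]])
  have \<phi>lin: "linear (\<phi> i)" for i
    unfolding \<phi>_def by (rule linear_frechet_derivative[OF complex_diff_atD(1)[OF Fcd]])
  have \<phi>sc: "\<phi> i (a *s v) = a * \<phi> i v" for i a v
    unfolding \<phi>_def by (rule complex_diff_atD(2)[OF Fcd])
  have tangent: "\<phi> i v = v $ i" if v: "\<And>j. j < d \<Longrightarrow> \<theta> j v = 0" for i v
  proof -
    have der: "((\<lambda>Z. F i Z - Z $ i) has_derivative (\<lambda>v. \<phi> i v - v $ i)) (at 0)"
      by (intro has_derivative_diff F' bounded_linear_imp_has_derivative bounded_linear_vec_nth)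
    have "frechet_derivative (\<lambda>Z. F i Z - Z $ i) (at 0) v = 0"
    proof (rule level_set_tangent[OF U, where r = r and d = d and B = "\<lambda>j c. c *s b j" and S = UNIV])
      show "Ck_on 1 (r j) U" if "j < d" for j
        by (rule Ck_on_subset[of _ _ "B j"]) (use B[OF that] that in \<open>auto simp only: smooth_on_def U_def\<close>)
      show "bounded_linear (\<lambda>c. c *s b j)" for j
        using complex_scaling_vec unfolding complex_scaling_def by (blast intro: bounded_bilinear.bounded_linear_left)
      show "frechet_derivative (r k) (at 0) (c *s b j) = (if k = j then c else 0)" if "k < d" "j < d" for k j c
        unfolding \<theta>_def[symmetric] using b[OF that] by (simp add: sc[OF that(1)])
      show "(\<lambda>Z. F i Z - Z $ i) differentiable at 0" using der by (auto simp: differentiable_def)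
      show "\<forall>\<^sub>F x in nhds 0. (\<forall>j<d. r j x = 0) \<longrightarrow> F i x - x $ i = 0"
        using id[of i] by (auto simp: r_def elim: eventually_mono)
    qed (use r0 v in \<open>auto simp: \<theta>_def\<close>)
    then show ?thesis unfolding frechet_derivative_eq[OF der] by simp
  qed
  define c where "c i j = \<phi> i (b j) - b j $ i" for i j
  let ?Q = "\<lambda>i (Z, \<zeta>). F i Z - (\<Sum>j<d. \<rho> j (Z, \<zeta>) * c i j)"
  have Qcd: "complex_diff_at pair_scale (?Q i) x"
    if "complex_diff_at (*s) (F i) (fst x)" "\<forall>j\<in>{..<d}. complex_diff_at pair_scale (\<rho> j) x" for i x
  proof -
    let ?D = "\<lambda>h. frechet_derivative (F i) (at (fst x)) (fst h) - (\<Sum>j<d. frechet_derivative (\<rho> j) (at x) h * c i j)"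
    have "((\<lambda>x. F i (fst x)) has_derivative (\<lambda>h. frechet_derivative (F i) (at (fst x)) (fst h))) (at x)"
      by (rule has_derivative_compose[OF bounded_linear_imp_has_derivative[OF bounded_linear_fst]
            has_derivative_frechet[OF complex_diff_atD(1)[OF that(1)]]])
    moreover have "((\<lambda>x. \<Sum>j<d. \<rho> j x * c i j) has_derivative (\<lambda>h. \<Sum>j<d. frechet_derivative (\<rho> j) (at x) h * c i j)) (at x)"
      using that(2) by (intro has_derivative_sum has_derivative_mult_left has_derivative_frechet complex_diff_atD(1)) auto
    ultimately have "((\<lambda>x. F i (fst x) - (\<Sum>j<d. \<rho> j x * c i j)) has_derivative ?D) (at x)"
      by (rule has_derivative_diff)
    moreover have "(\<lambda>x. F i (fst x) - (\<Sum>j<d. \<rho> j x * c i j)) = ?Q i" by (auto simp: fun_eq_iff)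
    moreover have "?D (pair_scale a h) = a * ?D h" for a h
    proof -
      have "frechet_derivative (F i) (at (fst x)) (fst (pair_scale a h)) = a * frechet_derivative (F i) (at (fst x)) (fst h)"
        using complex_diff_atD(2)[OF that(1)] by (simp add: case_prod_beta)
      moreover have "(\<Sum>j<d. frechet_derivative (\<rho> j) (at x) (pair_scale a h) * c i j) =
          a * (\<Sum>j<d. frechet_derivative (\<rho> j) (at x) h * c i j)"
        unfolding sum_distrib_left
      proof (rule sum.cong[OF refl])
        fix j assume "j \<in> {..<d}"
        with that(2) have "complex_diff_at pair_scale (\<rho> j) x" by blast
        from complex_diff_atD(2)[OF this, of a h]
        show "frechet_derivative (\<rho> j) (at x) (pair_scale a h) * c i j =
            a * (frechet_derivative (\<rho> j) (at x) h * c i j)" by simp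
      qed
      ultimately show ?thesis by (simp add: right_diff_distrib)
    qed
    ultimately show ?thesis unfolding complex_diff_at_def by (intro exI[of _ ?D]) simp
  qed
  have Qhol: "hol_near2 (0, 0) (?Q i)" for i
  proof -
    have 1: "\<forall>\<^sub>F x in nhds (0 :: complex^'n, 0 :: complex^'n). complex_diff_at (*s) (F i) (fst x)"
    proof -
      have "filterlim fst (nhds (0 :: complex^'n)) (nhds (0 :: complex^'n, 0 :: complex^'n))"
        using tendsto_fst[OF filterlim_ident, of "(0 :: complex^'n, 0 :: complex^'n)"] by simp
      then show ?thesis using F[of i] unfolding hol_near_def filterlim_iff by blast
    qed
    have 2: "\<forall>\<^sub>F x in nhds (0, 0). \<forall>j\<in>{..<d}. complex_diff_at pair_scale (\<rho> j) x"
      using generic by (intro eventually_ball_finite) (auto simp: generic_submanifold_def hol_near2_def)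
    show ?thesis unfolding hol_near2_def using 1 2 by eventually_elim (rule Qcd)
  qed
  have Qder: "frechet_derivative (?Q i) (at (0, 0)) (v, 0) = v $ i" for i v
  proof -
    have "complex_diff_at pair_scale (?Q i) (0, 0)"
      by (rule Qcd) (use Fcd \<rho>cd in auto)
    from partial_Z_eq[OF complex_diff_atD(1)[OF this], of v]
    have "frechet_derivative (?Q i) (at (0, 0)) (v, 0) = frechet_derivative (\<lambda>Z. F i Z - (\<Sum>j<d. r j Z * c i j)) (at 0) v"
      unfolding partial_Z_def r_def by simp
    also have "((\<lambda>Z. F i Z - (\<Sum>j<d. r j Z * c i j)) has_derivative (\<lambda>v. \<phi> i v - (\<Sum>j<d. \<theta> j v * c i j))) (at 0)"
      unfolding \<theta>_def
      by (intro has_derivative_diff F' has_derivative_sum has_derivative_mult_left has_derivative_frechet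
          smooth_near_self rsm) auto
    from frechet_derivative_eq[OF this]
    have "frechet_derivative (\<lambda>Z. F i Z - (\<Sum>j<d. r j Z * c i j)) (at 0) v = \<phi> i v - (\<Sum>j<d. \<theta> j v * c i j)"
      by simp
    also have "\<dots> = v $ i"
    proof -
      define w where "w = v - (\<Sum>j<d. \<theta> j v *s b j)"
      have "\<theta> k w = 0" if k: "k < d" for k
      proof -
        have "\<theta> k w = \<theta> k v - (\<Sum>j<d. \<theta> j v * (if k = j then 1 else 0))"
          unfolding w_def using b[OF k] by (simp add: linear_diff[OF lin[OF k]] linear_sum[OF lin[OF k]] sc[OF k])
        then show ?thesis using k by (simp add: if_distrib[of "\<lambda>x. _ * x"] cong: if_cong)
      qed
      then have "\<phi> i w = w $ i" by (rule tangent)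
      moreover have "\<phi> i w = \<phi> i v - (\<Sum>j<d. \<theta> j v * \<phi> i (b j))"
        unfolding w_def by (simp add: linear_diff[OF \<phi>lin] linear_sum[OF \<phi>lin] \<phi>sc)
      moreover have "w $ i = v $ i - (\<Sum>j<d. \<theta> j v * b j $ i)"
        unfolding w_def by simp
      ultimately show ?thesis
        unfolding c_def by (simp add: right_diff_distrib sum_subtractf algebra_simps)
    qed
    finally show ?thesis .
  qed
  from that[OF Qhol Qder] show thesis .
qed

end

lemma canonical_hom_eqD:
  assumes "germ p f \<in> carrier (hol_germs p)" "germ p g \<in> carrier (hol_germs p)"
    and "canonical_hom p Y (germ p f) = canonical_hom p Y (germ p g)"
  shows "\<forall>\<^sub>F Z in nhds p. Z \<in> Y \<longrightarrow> f Z = g Z"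
proof -
  interpret I: ideal "vanishing_ideal p Y" "hol_germs p" by (rule ideal_vanishing_ideal)
  have "germ p f \<in> vanishing_ideal p Y +>\<^bsub>hol_germs p\<^esub> germ p f"
    by (rule I.a_rcos_self[OF assms(1)])
  then have "germ p f \<in> vanishing_ideal p Y +>\<^bsub>hol_germs p\<^esub> germ p g"
    using assms(3) unfolding canonical_hom_def by simp
  then obtain E where E: "E \<in> vanishing_ideal p Y" "germ p f = E \<oplus>\<^bsub>hol_germs p\<^esub> germ p g"
    unfolding a_r_coset_def' by blast
  then obtain e where e: "E = germ p e" "\<forall>\<^sub>F Z in nhds p. Z \<in> Y \<longrightarrow> e Z = 0"
    using germ_in_vanishing_ideal unfolding vanishing_ideal_def hol_germs_carrier by blast
  have "\<forall>\<^sub>F Z in nhds p. f Z = e Z + g Z"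
    using E(2) unfolding e(1) hol_germs_add germ_eq_iff .
  with e(2) show ?thesis by eventually_elim simp
qed

text \<open>
  Surjectivity of \<open>\<pi> \<circ> \<phi>\<close>, on representatives of germs.
\<close>

lemma germ_lift_through_section:
  assumes \<phi>: "\<phi> \<in> ring_hom (hol_germs_on p Y) (hol_germs p)"
    and iso: "canonical_hom p Y \<circ> \<phi> \<in> ring_iso (hol_germs_on p Y) (hol_germs_on p Y)"
    and g: "hol_near p g"
  obtains a f where "a \<in> carrier (hol_germs_on p Y)" "hol_near p f" "\<phi> a = germ p f"
    "\<forall>\<^sub>F Z in nhds p. Z \<in> Y \<longrightarrow> f Z = g Z"
proof -
  have gc: "germ p g \<in> carrier (hol_germs p)" by (rule germ_in_carrier[OF g])
  have "canonical_hom p Y (germ p g) \<in> carrier (hol_germs_on p Y)"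
    using gc unfolding canonical_hom_def hol_germs_on_def FactRing_def A_RCOSETS_def' by auto
  then obtain a where a: "a \<in> carrier (hol_germs_on p Y)" "canonical_hom p Y (\<phi> a) = canonical_hom p Y (germ p g)"
  proof -
    have "(canonical_hom p Y \<circ> \<phi>) ` carrier (hol_germs_on p Y) = carrier (hol_germs_on p Y)"
      using iso by (simp add: ring_iso_def bij_betw_def)
    with \<open>canonical_hom p Y (germ p g) \<in> _\<close>
    have "canonical_hom p Y (germ p g) \<in> (canonical_hom p Y \<circ> \<phi>) ` carrier (hol_germs_on p Y)" by simp
    then show thesis using that by (auto simp: image_iff)
  qed
  have "\<phi> a \<in> carrier (hol_germs p)" by (rule ring_hom_closed[OF \<phi> a(1)])
  then obtain f where f: "hol_near p f" "\<phi> a = germ p f" unfolding hol_germs_carrier by blast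
  show thesis
    using that[OF a(1) f] canonical_hom_eqD[OF germ_in_carrier[OF f(1)] gc] a(2) f(2) by simp
qed

theorem theorem1p5:
  fixes M :: "(complex^'n) set" and M' :: "(complex^'m) set"
    and d d' :: nat
    and \<rho> :: "nat \<Rightarrow> (complex^'n) \<times> (complex^'n) \<Rightarrow> complex"
    and \<rho>' :: "nat \<Rightarrow> (complex^'m) \<times> (complex^'m) \<Rightarrow> complex"
    and U' :: "(complex^'m) set" and \<Sigma>\<^sub>0' :: "(complex^'m) set"
    and \<phi> :: "(complex^'m \<Rightarrow> complex) set set \<Rightarrow> (complex^'m \<Rightarrow> complex) set"
    and H1 H2 :: "complex^'n \<Rightarrow> complex^'m"
  assumes "generic_submanifold d \<rho> M"
    and "finite_type d \<rho> M 0"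
    and "generic_submanifold d' \<rho>' M'"
    and "open U'" and "0 \<in> U'"
    and "\<Sigma>\<^sub>0' = segre_variety d' \<rho>' U' 0"
    and "\<phi> \<in> ring_hom (hol_germs_on 0 \<Sigma>\<^sub>0') (hol_germs 0)"
    and "canonical_hom 0 \<Sigma>\<^sub>0' \<circ> \<phi> \<in> ring_iso (hol_germs_on 0 \<Sigma>\<^sub>0') (hol_germs_on 0 \<Sigma>\<^sub>0')"
    and "hol_map_near 0 H1" and "H1 0 = 0" and "\<forall>\<^sub>F Z in nhds 0. Z \<in> M \<longrightarrow> H1 Z \<in> M'"
    and "hol_map_near 0 H2" and "H2 0 = 0" and "\<forall>\<^sub>F Z in nhds 0. Z \<in> M \<longrightarrow> H2 Z \<in> M'"
    and "\<forall>a\<in>carrier (hol_germs_on 0 \<Sigma>\<^sub>0'). (induced_hom 0 H1 \<circ> \<phi>) a = (induced_hom 0 H2 \<circ> \<phi>) a"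
  shows "\<forall>F\<in>carrier (hol_germs (0 :: complex^'m)). induced_hom 0 H1 F = induced_hom 0 H2 F"
proof -
  interpret M: generic_mfd d \<rho> M by unfold_locales fact
  interpret M': generic_mfd d' \<rho>' M' by unfold_locales fact
  have cont: "isCont H1 0" "isCont H2 0"
    using assms(9,12) by (auto intro: smooth_near_isCont hol_map_near_smooth)
  have hom: "induced_hom 0 H1 (germ 0 f) = germ 0 (f \<circ> H1)" "induced_hom 0 H2 (germ 0 f) = germ 0 (f \<circ> H2)" for f
    using induced_hom_germ[OF cont(1), of f] induced_hom_germ[OF cont(2), of f] assms(10,13) by simp_all
  have coord: "hol_near 0 (\<lambda>Z :: complex^'m. Z $ i)" for i
    unfolding hol_near_def complex_diff_at_def
    by (intro always_eventually allI exI[of _ "\<lambda>v. v $ i"])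
      (auto intro: bounded_linear_imp_has_derivative bounded_linear_vec_nth)
  have ex: "\<forall>i. \<exists>f. hol_near 0 f \<and> (\<forall>\<^sub>F Z in nhds 0. Z \<in> \<Sigma>\<^sub>0' \<longrightarrow> f Z = Z $ i) \<and>
      (\<forall>\<^sub>F Z in nhds 0. f (H1 Z) = f (H2 Z))"
  proof
    fix i
    obtain a f where af: "a \<in> carrier (hol_germs_on 0 \<Sigma>\<^sub>0')" "hol_near 0 f" "\<phi> a = germ 0 f"
      "\<forall>\<^sub>F Z in nhds 0. Z \<in> \<Sigma>\<^sub>0' \<longrightarrow> f Z = Z $ i"
      by (rule germ_lift_through_section[OF assms(7,8) coord[of i]])
    have "induced_hom 0 H1 (\<phi> a) = induced_hom 0 H2 (\<phi> a)" using assms(15) af(1) by simp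
    then have "germ 0 (f \<circ> H1) = germ 0 (f \<circ> H2)" unfolding af(3) hom .
    then show "\<exists>f. hol_near 0 f \<and> (\<forall>\<^sub>F Z in nhds 0. Z \<in> \<Sigma>\<^sub>0' \<longrightarrow> f Z = Z $ i) \<and>
        (\<forall>\<^sub>F Z in nhds 0. f (H1 Z) = f (H2 Z))"
      using af(2,4) unfolding germ_eq_iff by (auto simp: o_def)
  qed
  obtain F where F: "\<And>i. hol_near 0 (F i)" "\<And>i. \<forall>\<^sub>F Z in nhds 0. Z \<in> \<Sigma>\<^sub>0' \<longrightarrow> F i Z = Z $ i"
    "\<And>i. \<forall>\<^sub>F Z in nhds 0. F i (H1 Z) = F i (H2 Z)"
    using choice[OF ex] by blast
  have id: "\<forall>\<^sub>F Z in nhds 0. (\<forall>j<d'. \<rho>' j (Z, 0) = 0) \<longrightarrow> F i Z = Z $ i" for i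
    using F(2)[of i] eventually_nhds_in_open[OF assms(4,5)]
    by eventually_elim (simp add: assms(6) segre_variety_def)
  obtain c where Q: "\<And>i. hol_near2 (0, 0) (\<lambda>(Z, \<zeta>). F i Z - (\<Sum>j<d'. \<rho>' j (Z, \<zeta>) * c i j))"
    "\<And>i v. frechet_derivative (\<lambda>(Z, \<zeta>). F i Z - (\<Sum>j<d'. \<rho>' j (Z, \<zeta>) * c i j)) (at (0, 0)) (v, 0) = v $ i"
    by (rule M'.segre_adapted_coordinates[OF F(1) id]) blast
  have M'eq: "\<forall>\<^sub>F W in nhds 0. W \<in> M' \<longleftrightarrow> (\<forall>j<d'. \<rho>' j (W, vcnj W) = 0)"
    using assms(3) unfolding generic_submanifold_def by blast
  have on_M: "\<forall>\<^sub>F Z in nhds 0. Z \<in> M \<longrightarrow> (\<forall>j<d'. \<rho>' j (H Z, vcnj (H Z)) = 0)"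
    if "isCont H 0" "H 0 = 0" "\<forall>\<^sub>F Z in nhds 0. Z \<in> M \<longrightarrow> H Z \<in> M'" for H
  proof -
    have "filterlim H (nhds 0) (nhds 0)"
      using that(1,2) tendsto_at_iff_tendsto_nhds[of H 0] by (simp add: isCont_def)
    then have "\<forall>\<^sub>F Z in nhds 0. H Z \<in> M' \<longleftrightarrow> (\<forall>j<d'. \<rho>' j (H Z, vcnj (H Z)) = 0)"
      using M'eq unfolding filterlim_iff by blast
    with that(3) show ?thesis by eventually_elim blast
  qed
  have "\<forall>\<^sub>F Z in nhds 0. H1 Z = H2 Z"
  proof (rule M.mapping_uniqueness[OF assms(2) Q(1) _ assms(9,10,12,13)])
    show "frechet_derivative (\<lambda>(Z, \<zeta>). F i Z - (\<Sum>j<d'. \<rho>' j (Z, \<zeta>) * c i j)) (at (0, 0)) (axis k 1, 0) =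
        (if i = k then 1 else 0)" for i k
      unfolding Q(2) by (simp add: axis_def)
    show "\<forall>\<^sub>F Z in nhds 0. Z \<in> M \<longrightarrow>
        (\<lambda>(Z, \<zeta>). F i Z - (\<Sum>j<d'. \<rho>' j (Z, \<zeta>) * c i j)) (H1 Z, vcnj (H1 Z)) =
        (\<lambda>(Z, \<zeta>). F i Z - (\<Sum>j<d'. \<rho>' j (Z, \<zeta>) * c i j)) (H2 Z, vcnj (H2 Z))" for i
      using F(3)[of i] on_M[OF cont(1) assms(10,11)] on_M[OF cont(2) assms(13,14)]
      by eventually_elim simp
  qed
  then have "germ 0 (f \<circ> H1) = germ 0 (f \<circ> H2)" for f :: "complex^'m \<Rightarrow> complex"
    unfolding germ_eq_iff by eventually_elim simp
  then show ?thesis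
    unfolding hol_germs_carrier using hom by auto
qed

end
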